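(* Let $L=L(\sigma,T_1,T_2,H_2)$ and $\tilde L=L(\tilde\sigma,\tilde T_1,\tilde T_2,\tilde H_2)$ be two boundary value problems of the form described in the context, with Weyl matrices $M(\lambda)$ and $\tilde M(\lambda)$, respectively. If $M(\lambda)\equiv\tilde M(\lambda)$, then $\sigma(x)=\tilde\sigma(x)$ a.e. on $(0,\pi)$, $T_1=\tilde T_1$, $T_2=\tilde T_2$, $H_2=\tilde H_2$. Thus, the Weyl matrix $M(\lambda)$ uniquely specifies the problem $L(\sigma,T_1,T_2,H_2)$.
   Context: Let $m\ge 1$; $\dagger$ denotes conjugate transpose and $I$ the unit $(m\times m)$-matrix. Let $\sigma\in L_2((0,\pi);\mathbb C^{m\times m})$ with $\sigma(x)=(\sigma(x))^\dagger$. Put $Y^{[1]}:=Y'-\sigma Y$ and $\ell Y:=-(Y^{[1]})'-\sigma Y^{[1]}-\sigma^2Y$. Let $T_1,T_2,H_2\in\mathbb C^{m\times m}$ satisfy $T_j=T_j^\dagger=T_j^2$, $T_j^\perp:=I-T_j$ ($j=1,2$), $H_2=H_2^\dagger=T_2H_2T_2$. Denote $$V_1(Y):=T_1Y^{[1]}(0)-T_1^\perp Y(0),\quad V_2(Y):=T_2(Y^{[1]}(\pi)-H_2Y(\pi))-T_2^\perp Y(\pi),\quad V_1^\perp(Y):=T_1Y(0)+T_1^\perp Y^{[1]}(0).$$ $L=L(\sigma,T_1,T_2,H_2)$ is the boundary value problem $\ell Y=\lambda Y$ on $(0,\pi)$, $V_1(Y)=V_2(Y)=0$ (solutions have $Y,Y^{[1]}$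 absolutely continuous on $[0,\pi]$). The Weyl solution $\Phi(x,\lambda)$ is the matrix solution of $\ell\Phi=\lambda\Phi$ with $V_1(\Phi)=I$, $V_2(\Phi)=0$; the Weyl matrix is the meromorphic matrix function $M(\lambda):=V_1^\perp(\Phi)$, with poles at the eigenvalues of $L$. Objects with a tilde are the analogous objects for $\tilde L$, which has the same $m$; in particular its quasi-derivative is $Y'-\tilde\sigma Y$. *)

theory Defs
  imports "HOL-Analysis.Analysis"
begin

definition dagger :: "complex^'n^'m \<Rightarrow> complex^'m^'n" where
  "dagger A = (\<chi> i j. cnj (A $ j $ i))"

definition abs_continuous_on :: "real \<Rightarrow> real \<Rightarrow> (real \<Rightarrow> 'a::real_normed_vector) \<Rightarrow> bool" where
  "abs_continuous_on a b f \<longleftrightarrow>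
     (\<forall>\<epsilon>>0. \<exists>\<delta>>0. \<forall>(n::nat) (u::nat \<Rightarrow> real) v.
        (\<forall>i<n. a \<le> u i \<and> u i \<le> v i \<and> v i \<le> b) \<longrightarrow>
        (\<forall>i<n. \<forall>j<n. i \<noteq> j \<longrightarrow> {u i<..<v i} \<inter> {u j<..<v j} = {}) \<longrightarrow>
        (\<Sum>i<n. v i - u i) < \<delta> \<longrightarrow>
        (\<Sum>i<n. norm (f (v i) - f (u i))) < \<epsilon>)"

text \<open>
  The norm of the type \<^typ>\<open>complex^'m^'m\<close> is the Frobenius norm. The potential
  represents a class modulo null sets, so it is Hermitian only almost everywhere.
\<close>

definition L2_potential :: "(real \<Rightarrow> complex^'m^'m) \<Rightarrow> bool" where
  "L2_potential \<sigma> \<longleftrightarrow>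
     \<sigma> \<in> borel_measurable (lebesgue_on {0<..<pi}) \<and>
     integrable (lebesgue_on {0<..<pi}) (\<lambda>x. (norm (\<sigma> x))\<^sup>2) \<and>
     (AE x in lebesgue_on {0<..<pi}. \<sigma> x = dagger (\<sigma> x))"

definition orth_projector :: "complex^'m^'m \<Rightarrow> bool" where
  "orth_projector T \<longleftrightarrow> T = dagger T \<and> T = T ** T"

definition bvp ::
  "(real \<Rightarrow> complex^'m^'m) \<Rightarrow> complex^'m^'m \<Rightarrow> complex^'m^'m \<Rightarrow> complex^'m^'m \<Rightarrow> bool" where
  "bvp \<sigma> T1 T2 H2 \<longleftrightarrow>
     L2_potential \<sigma> \<and> orth_projector T1 \<and> orth_projector T2 \<and>
     H2 = dagger H2 \<and> H2 = T2 ** H2 ** T2"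

definition perp :: "complex^'m^'m \<Rightarrow> complex^'m^'m" where
  "perp T = mat 1 - T"

text \<open>
  The formula for the quasi-derivative defines it only almost everywhere, whereas the boundary
  conditions evaluate it at the end points. Hence it is carried along as a second function
  \<open>Z\<close>; for a solution, \<open>Z\<close> is absolutely continuous, which determines it uniquely on
  \<open>[0,\<pi>]\<close> from \<open>Y\<close>. Functions have values in the matrices with \<open>m\<close> rows and any fixed number
  of columns; columns of type \<^typ>\<open>complex^1^'m\<close> are the vector-valued case.
\<close>

definition quasi_derivative ::
  "(real \<Rightarrow> complex^'m^'m) \<Rightarrow> (real \<Rightarrow> complex^'n^'m) \<Rightarrow> (real \<Rightarrow> complex^'n^'m) \<Rightarrow> bool" where
  "quasi_derivative \<sigma> Y Z \<longleftrightarrow>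
     (AE x in lebesgue_on {0<..<pi}.
        Y differentiable (at x) \<and> Z x = vector_derivative Y (at x) - \<sigma> x ** Y x)"

definition solution ::
  "(real \<Rightarrow> complex^'m^'m) \<Rightarrow> complex \<Rightarrow>
   (real \<Rightarrow> complex^'n^'m) \<Rightarrow> (real \<Rightarrow> complex^'n^'m) \<Rightarrow> bool" where
  "solution \<sigma> lam Y Z \<longleftrightarrow>
     abs_continuous_on 0 pi Y \<and> abs_continuous_on 0 pi Z \<and> quasi_derivative \<sigma> Y Z \<and>
     (AE x in lebesgue_on {0<..<pi}.
        Z differentiable (at x) \<and>
        - vector_derivative Z (at x) - \<sigma> x ** Z x - \<sigma> x ** \<sigma> x ** Y x = mat lam ** Y x)"

definition V1 ::
  "complex^'m^'m \<Rightarrow> (real \<Rightarrow> complex^'n^'m) \<Rightarrow> (real \<Rightarrow> complex^'n^'m) \<Rightarrow> complex^'n^'m" where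
  "V1 T1 Y Z = T1 ** Z 0 - perp T1 ** Y 0"

definition V2 ::
  "complex^'m^'m \<Rightarrow> complex^'m^'m \<Rightarrow>
   (real \<Rightarrow> complex^'n^'m) \<Rightarrow> (real \<Rightarrow> complex^'n^'m) \<Rightarrow> complex^'n^'m" where
  "V2 T2 H2 Y Z = T2 ** (Z pi - H2 ** Y pi) - perp T2 ** Y pi"

definition V1_perp ::
  "complex^'m^'m \<Rightarrow> (real \<Rightarrow> complex^'n^'m) \<Rightarrow> (real \<Rightarrow> complex^'n^'m) \<Rightarrow> complex^'n^'m" where
  "V1_perp T1 Y Z = T1 ** Y 0 + perp T1 ** Z 0"

definition eigenvalue ::
  "(real \<Rightarrow> complex^'m^'m) \<Rightarrow> complex^'m^'m \<Rightarrow> complex^'m^'m \<Rightarrow> complex^'m^'m \<Rightarrow> complex \<Rightarrow> bool"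
where
  "eigenvalue \<sigma> T1 T2 H2 lam \<longleftrightarrow>
     (\<exists>(Y :: real \<Rightarrow> complex^1^'m) Z.
        solution \<sigma> lam Y Z \<and> V1 T1 Y Z = 0 \<and> V2 T2 H2 Y Z = 0 \<and> (\<exists>x\<in>{0..pi}. Y x \<noteq> 0))"

definition weyl_solution ::
  "(real \<Rightarrow> complex^'m^'m) \<Rightarrow> complex^'m^'m \<Rightarrow> complex^'m^'m \<Rightarrow> complex^'m^'m \<Rightarrow> complex \<Rightarrow>
   (real \<Rightarrow> complex^'m^'m) \<Rightarrow> (real \<Rightarrow> complex^'m^'m) \<Rightarrow> bool" where
  "weyl_solution \<sigma> T1 T2 H2 lam \<Phi> \<Phi>q \<longleftrightarrow>
     solution \<sigma> lam \<Phi> \<Phi>q \<and> V1 T1 \<Phi> \<Phi>q = mat 1 \<and> V2 T2 H2 \<Phi> \<Phi>q = 0"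

text \<open>
  When \<open>lam\<close> is not an eigenvalue, the Weyl solution exists and is unique on \<open>[0,\<pi>]\<close>. At an
  eigenvalue, which is a pole of the Weyl matrix, there is no Weyl solution and the value is
  meaningless.
\<close>

definition weyl_matrix ::
  "(real \<Rightarrow> complex^'m^'m) \<Rightarrow> complex^'m^'m \<Rightarrow> complex^'m^'m \<Rightarrow> complex^'m^'m \<Rightarrow> complex \<Rightarrow>
   complex^'m^'m" where
  "weyl_matrix \<sigma> T1 T2 H2 lam =
     (THE M. \<exists>\<Phi> \<Phi>q. weyl_solution \<sigma> T1 T2 H2 lam \<Phi> \<Phi>q \<and> M = V1_perp T1 \<Phi> \<Phi>q)"

text \<open>
  Identity of the two Weyl matrices as meromorphic functions: their values agree off the poles.
\<close>

definition same_weyl_matrix ::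
  "(real \<Rightarrow> complex^'m^'m) \<Rightarrow> complex^'m^'m \<Rightarrow> complex^'m^'m \<Rightarrow> complex^'m^'m \<Rightarrow>
   (real \<Rightarrow> complex^'m^'m) \<Rightarrow> complex^'m^'m \<Rightarrow> complex^'m^'m \<Rightarrow> complex^'m^'m \<Rightarrow> bool" where
  "same_weyl_matrix \<sigma> T1 T2 H2 \<sigma>' T1' T2' H2' \<longleftrightarrow>
     (\<forall>lam. \<not> eigenvalue \<sigma> T1 T2 H2 lam \<and> \<not> eigenvalue \<sigma>' T1' T2' H2' lam \<longrightarrow>
        weyl_matrix \<sigma> T1 T2 H2 lam = weyl_matrix \<sigma>' T1' T2' H2' lam)"

end

theory Submission
  imports Defs "HOL-Complex_Analysis.Complex_Analysis"
begin

text \<open>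
  Let \<open>C\<close> and \<open>S\<close> be the matrix solutions with \<open>V1 C = I\<close>, \<open>V1_perp C = 0\<close>, \<open>V1 S = 0\<close>,
  \<open>V1_perp S = I\<close>, so that the Weyl solution is \<open>\<Phi> = C + S M\<close>. Put \<open>\<lambda> = - \<kappa>\<^sup>2\<close>. In the sector where
  \<open>Re \<kappa>\<close> is at least half the modulus of \<open>\<kappa>\<close>, the functions \<open>\<kappa> Y + Z\<close> and \<open>\<kappa> Y - Z\<close> satisfy a
  system with diagonal part \<open>\<plusminus> \<kappa>\<close> and a small square integrable perturbation, which gives sharp exponential bounds
  for \<open>\<Phi>\<close> and \<open>S\<close> as well as the leading term of \<open>M\<close>; the latter determines \<open>T1\<close>. If the Weyl matrices agree, then
  \<open>C(\<lambda>) S'(cnj \<lambda>)\<^sup>* - S(\<lambda>) C'(cnj \<lambda>)\<^sup>*\<close>, where the prime marks the second problem and the star the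
  conjugate transpose, is entire of order one half in \<open>\<lambda>\<close> and equals
  \<open>\<Phi> S'\<^sup>* - S \<Phi>'\<^sup>*\<close>, hence tends to zero along the imaginary axis. By the Phragmen-Lindelof
  principle and Liouville's theorem it vanishes, and its differential equation in \<open>x\<close> forces the
  potentials to agree. Then the Weyl solutions agree too, and their values at \<open>pi\<close> span
  the subspace that determines \<open>T2\<close> and \<open>H2\<close>.
\<close>

section \<open>Absolutely continuous functions and the fundamental theorem of calculus\<close>

text \<open>The potential is only square integrable, so the coupling between
  \<open>\<kappa> Y + Z\<close> and \<open>\<kappa> Y - Z\<close> is not small pointwise. It becomes
  O(1/sqrt|kappa|) only after integration against exponentials. The two kinds of boundary condition
  at 0 scale differently in kappa. Hence \<open>\<Phi>\<close> is weighted by kappa T1 + perp T1 and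
  \<open>S\<close> by the inverse weight; the weights and the exponentials cancel in the products,
  which leaves O(1/|kappa|). Replacing \<open>C\<close> and \<open>C'\<close> by Weyl solutions adds
  the terms S M(lambda) S'^* and S M(cnj lambda)^* S'^*. They cancel because the adjoint of M at the
  conjugate point is M; this is where Hermitian data enter. The sector is stable under conjugation,
  so on the imaginary axis both lambda and its conjugate are reached by large kappa for which the
  Weyl solutions exist. The combination of \<open>C\<close> and \<open>S\<close> has no poles, which
  is why it, and not the Weyl solutions, is fed to Liouville. This combination is the upper right
  block of one fundamental matrix times the inverse of the other, the inverse being written with
  adjoints as for a symplectic matrix.\<close>

lemma sum_lengths_disjoint_intervals_le:
  fixes u v :: "'i \<Rightarrow> real"
  assumes "finite I" "\<And>i. i \<in> I \<Longrightarrow> u i \<le> v i"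
    and disj: "\<And>i j. i \<in> I \<Longrightarrow> j \<in> I \<Longrightarrow> i \<noteq> j \<Longrightarrow> {u i<..<v i} \<inter> {u j<..<v j} = {}"
    and sub: "\<And>i. i \<in> I \<Longrightarrow> {u i<..<v i} \<subseteq> U" and U: "U \<in> lmeasurable"
  shows "(\<Sum>i\<in>I. v i - u i) \<le> measure lebesgue U"
proof -
  have lm: "{u i<..<v i} \<in> lmeasurable" for i
    using lmeasurable_box[of "u i" "v i"] by simp
  have "(\<Sum>i\<in>I. v i - u i) = (\<Sum>i\<in>I. measure lebesgue {u i<..<v i})"
    using assms(2) by (intro sum.cong) auto
  also have "\<dots> = measure lebesgue (\<Union>i\<in>I. {u i<..<v i})"
    using lm fmeasurableD2[OF lm] disj assms(1)
    by (intro measure_finite_Union[symmetric]) (auto simp: disjoint_family_on_def simp del: Int_greaterThanLessThan)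
  also have "\<dots> \<le> measure lebesgue U"
    using sub U assms(1) lm by (intro measure_mono_fmeasurable) (auto)
  finally show ?thesis .
qed

text \<open>The definition numbers intervals by naturals below \<open>n\<close>. Reindexing along a
  bijection allows any finite index set, such as the tagged pieces of a division in the fundamental
  theorem.\<close>

lemma abs_continuous_on_finite_family:
  fixes f :: "real \<Rightarrow> 'a::real_normed_vector"
  assumes "abs_continuous_on a b f" "\<epsilon> > 0"
  obtains \<delta> where "\<delta> > 0"
    "\<And>(I::'i set) u v. finite I \<Longrightarrow> (\<And>i. i \<in> I \<Longrightarrow> a \<le> u i \<and> u i \<le> v i \<and> v i \<le> b) \<Longrightarrow>
       (\<And>i j. i \<in> I \<Longrightarrow> j \<in> I \<Longrightarrow> i \<noteq> j \<Longrightarrow> {u i<..<v i} \<inter> {u j<..<v j} = {}) \<Longrightarrow>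
       (\<Sum>i\<in>I. v i - u i) < \<delta> \<Longrightarrow> (\<Sum>i\<in>I. norm (f (v i) - f (u i))) < \<epsilon>"
proof -
  from assms obtain \<delta> where \<delta>: "\<delta> > 0" and *: "\<And>(n::nat) u v.
       (\<forall>i<n. a \<le> u i \<and> u i \<le> v i \<and> v i \<le> b) \<Longrightarrow>
        (\<forall>i<n. \<forall>j<n. i \<noteq> j \<longrightarrow> {u i<..<v i} \<inter> {u j<..<v j} = {}) \<Longrightarrow>
        (\<Sum>i<n. v i - u i) < \<delta> \<Longrightarrow>
        (\<Sum>i<n. norm (f (v i) - f (u i))) < \<epsilon>"
    unfolding abs_continuous_on_def by blast
  show ?thesis
  proof (rule that[OF \<delta>])
    fix I :: "'i set" and u v
    assume I: "finite I" and uv: "\<And>i. i \<in> I \<Longrightarrow> a \<le> u i \<and> u i \<le> v i \<and> v i \<le> b"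
      and disj: "\<And>i j. i \<in> I \<Longrightarrow> j \<in> I \<Longrightarrow> i \<noteq> j \<Longrightarrow> {u i<..<v i} \<inter> {u j<..<v j} = {}"
      and sum: "(\<Sum>i\<in>I. v i - u i) < \<delta>"
    obtain h where h: "bij_betw h {0..<card I} I"
      using ex_bij_betw_nat_finite[OF I] by blast
    then have h': "bij_betw h {..<card I} I" by (simp add: atLeast0LessThan)
    have hI: "h i \<in> I" if "i < card I" for i
      using h' that by (auto simp: bij_betw_def)
    have hne: "h i \<noteq> h j" if "i < card I" "j < card I" "i \<noteq> j" for i j
      using h' that by (auto simp: bij_betw_def inj_on_def)
    have re: "(\<Sum>i<card I. g (h i)) = (\<Sum>i\<in>I. g i)" for g :: "'i \<Rightarrow> real"
      using sum.reindex_bij_betw[OF h'] .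
    have "(\<Sum>i<card I. norm (f (v (h i)) - f (u (h i)))) < \<epsilon>"
      by (rule *) (use uv disj hI hne sum re[of "\<lambda>i. v i - u i"] in auto)
    then show "(\<Sum>i\<in>I. norm (f (v i) - f (u i))) < \<epsilon>"
      using re[of "\<lambda>i. norm (f (v i) - f (u i))"] by simp
  qed
qed

text \<open>The tags in the exceptional null set contribute little because the intervals carrying them
  lie in an open set of small measure, where absolute continuity applies.\<close>

lemma FTC_abs_continuous:
  fixes f :: "real \<Rightarrow> 'a::banach"
  assumes "a \<le> b" and ac: "abs_continuous_on a b f" and N: "negligible N"
    and vecd: "\<And>x. x \<in> {a..b} - N \<Longrightarrow> (f has_vector_derivative f' x) (at x within {a..b})"
  shows "(f' has_integral (f b - f a)) {a..b}"
proof -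
  \<comment> \<open>Values on \<open>N\<close> do not affect the integral. With value 0 there, a tag
    in \<open>N\<close> contributes only an increment of \<open>f\<close> to the error of the
    Riemann sum.\<close>
  define g where "g x = (if x \<in> N then 0 else f' x)" for x
  have "(g has_integral (f b - f a)) (cbox a b)"
    unfolding has_integral
  proof (intro allI impI)
    fix e :: real assume "e > 0"
    define \<eta> where "\<eta> = e / (2 * (b - a + 1))"
    have \<eta>: "\<eta> > 0" using \<open>e > 0\<close> \<open>a \<le> b\<close> by (simp add: \<eta>_def)
    have "\<eta> * (b - a) \<le> e / 2"
    proof -
      have "\<eta> * (b - a) \<le> \<eta> * (b - a + 1)" using \<eta> by simp
      also have "\<dots> = e / 2" using \<open>a \<le> b\<close> by (simp add: \<eta>_def field_simps)
      finally show ?thesis .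
    qed
    have "\<forall>x. \<exists>d>0. x \<in> {a..b} - N \<longrightarrow>
         (\<forall>y\<in>{a..b}. norm (y-x) < d \<longrightarrow> norm (f y - f x - (y-x) *\<^sub>R f' x) \<le> \<eta> * norm (y-x))"
    proof
      fix x
      show "\<exists>d>0. x \<in> {a..b} - N \<longrightarrow>
         (\<forall>y\<in>{a..b}. norm (y-x) < d \<longrightarrow> norm (f y - f x - (y-x) *\<^sub>R f' x) \<le> \<eta> * norm (y-x))"
      proof (cases "x \<in> {a..b} - N")
        case True
        then show ?thesis
          using vecd[OF True, unfolded has_vector_derivative_def has_derivative_within_alt] \<eta> by blast
      qed (auto intro: exI[of _ 1])
    qed
    then obtain d where d: "\<And>x. 0 < d x"
      "\<And>x y. \<lbrakk>x \<in> {a..b} - N; y \<in> {a..b}; norm (y-x) < d x\<rbrakk>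
                        \<Longrightarrow> norm (f y - f x - (y-x) *\<^sub>R f' x) \<le> \<eta> * norm (y-x)"
      by metis
    obtain \<delta> where \<delta>: "\<delta> > 0" and
      ac': "\<And>(I::(real \<times> real set) set) u v. finite I \<Longrightarrow> (\<And>i. i \<in> I \<Longrightarrow> a \<le> u i \<and> u i \<le> v i \<and> v i \<le> b) \<Longrightarrow>
       (\<And>i j. i \<in> I \<Longrightarrow> j \<in> I \<Longrightarrow> i \<noteq> j \<Longrightarrow> {u i<..<v i} \<inter> {u j<..<v j} = {}) \<Longrightarrow>
       (\<Sum>i\<in>I. v i - u i) < \<delta> \<Longrightarrow> (\<Sum>i\<in>I. norm (f (v i) - f (u i))) < e / 2"
      by (rule abs_continuous_on_finite_family[OF ac, of "e/2", where 'i="real \<times> real set"])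
         (use \<open>e > 0\<close> in simp, blast)
    obtain U where U: "open U" "N \<subseteq> U" "U \<in> lmeasurable" "measure lebesgue U < \<delta>"
    proof -
      have Nm: "N \<in> sets lebesgue" "emeasure lebesgue N = 0"
        using N negligible_iff_null_sets by blast+
      obtain U where U: "open U" "N \<subseteq> U" "(U - N) \<in> lmeasurable" "emeasure lebesgue (U - N) < ennreal \<delta>"
        using sets_lebesgue_outer_open[OF Nm(1) \<delta>] by blast
      have *: "U = (U - N) \<union> N" using U by auto
      have "U \<in> lmeasurable"
        by (subst *) (use U N negligible_imp_measurable in blast)
      moreover have "measure lebesgue U = measure lebesgue (U - N)"
        using N by (simp add: measure_Diff_null_set negligible_iff_null_sets \<open>U \<in> lmeasurable\<close> fmeasurableD)
      moreover have "measure lebesgue (U - N) < \<delta>"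
        using U(3,4) by (simp add: emeasure_eq_measure2 \<delta> ennreal_less_iff)
      ultimately show ?thesis using that U by simp
    qed
    let ?\<gamma> = "\<lambda>x. if x \<in> N then U else ball x (d x)"
    show "\<exists>\<gamma>. gauge \<gamma> \<and> (\<forall>\<D>. \<D> tagged_division_of cbox a b \<and> \<gamma> fine \<D> \<longrightarrow>
          norm ((\<Sum>(x,k)\<in>\<D>. measure lborel k *\<^sub>R g x) - (f b - f a)) < e)"
    proof (intro exI conjI allI impI)
      show "gauge ?\<gamma>" using U d by (auto simp: gauge_def)
      fix p assume "p tagged_division_of cbox a b \<and> ?\<gamma> fine p"
      then have p: "p tagged_division_of cbox a b" and fine: "?\<gamma> fine p" by auto
      have fin: "finite p" using p by blast
      define q where "q = {xk\<in>p. fst xk \<in> N}"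
      have K: "\<exists>u v. K = {u..v} \<and> a \<le> u \<and> u \<le> x \<and> x \<le> v \<and> v \<le> b \<and> Inf K = u \<and> Sup K = v" if xK: "(x,K) \<in> p" for x K
      proof -
        from tagged_division_ofD(2-4)[OF p xK] obtain u v where "x \<in> K" "K \<subseteq> cbox a b" "K = cbox u v" by auto
        then show ?thesis by (intro exI[of _ u] exI[of _ v]) auto
      qed
      have int: "{Inf (snd i)<..<Sup (snd i)} \<inter> {Inf (snd j)<..<Sup (snd j)} = {}"
        if "i \<in> p" "j \<in> p" "i \<noteq> j" for i j
      proof -
        have "interior (snd i) \<inter> interior (snd j) = {}"
          using tagged_division_ofD(5)[OF p, of "fst i" "snd i" "fst j" "snd j"] that by auto
        moreover have "interior (snd i) = {Inf (snd i)<..<Sup (snd i)}" if "i \<in> p" for i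
          by (metis K interior_atLeastAtMost_real prod.collapse that)
        ultimately show ?thesis using that by metis
      qed
      have qlen: "(\<Sum>i\<in>q. Sup (snd i) - Inf (snd i)) < \<delta>"
      proof -
        have "(\<Sum>i\<in>q. Sup (snd i) - Inf (snd i)) \<le> measure lebesgue U"
        proof (rule sum_lengths_disjoint_intervals_le)
          fix i assume i: "i \<in> q"
          then show "Inf (snd i) \<le> Sup (snd i)"
            using K[of "fst i" "snd i"] by (auto simp: q_def)
          have "snd i \<subseteq> ?\<gamma> (fst i)" using fine i unfolding fine_def q_def by force
          then show "{Inf (snd i)<..<Sup (snd i)} \<subseteq> U"
            using K[of "fst i" "snd i"] i by (auto simp: q_def)
        qed (use U int fin q_def in auto)
        with U show ?thesis by simp
      qed
      have B1: "(\<Sum>i\<in>q. norm (f (Sup (snd i)) - f (Inf (snd i)))) < e / 2"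
      proof (rule ac')
        show "finite q" using fin q_def by auto
        show "a \<le> Inf (snd i) \<and> Inf (snd i) \<le> Sup (snd i) \<and> Sup (snd i) \<le> b" if "i \<in> q" for i
          using K[of "fst i" "snd i"] that by (auto simp: q_def)
      qed (use int qlen q_def in auto)
      let ?h = "\<lambda>(x,k). measure lborel k *\<^sub>R g x - (f (Sup k) - f (Inf k))"
      \<comment> \<open>Straddle estimate: the tag lies between the endpoints, so the linearisation
        errors on its two sides add up to \<open>\<eta>\<close> times the full length
        \<open>v - u\<close>.\<close>
      have pt: "norm (measure lborel k *\<^sub>R g x - (f (Sup k) - f (Inf k))) \<le> \<eta> * (Sup k - Inf k)" if xk: "(x,k) \<in> p - q" for x k
      proof -
        obtain u v where k: "k = {u..v}" "a \<le> u" "u \<le> x" "x \<le> v" "v \<le> b" "Inf k = u" "Sup k = v"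
          using K[of x k] xk by auto
        have xN: "x \<notin> N" using xk by (auto simp: q_def)
        have "k \<subseteq> ?\<gamma> x" using fine xk unfolding fine_def by force
        moreover have "u \<in> k" "v \<in> k" using k by auto
        ultimately have "u \<in> ball x (d x)" "v \<in> ball x (d x)" using xN by auto
        then have uv: "norm (u - x) < d x" "norm (v - x) < d x" by (auto simp: dist_norm norm_minus_commute)
        have "norm ((v - u) *\<^sub>R f' x - (f v - f u)) = norm (f u - f x - (u - x) *\<^sub>R f' x - (f v - f x - (v - x) *\<^sub>R f' x))"
          by (auto simp: algebra_simps)
        also have "\<dots> \<le> norm (f u - f x - (u - x) *\<^sub>R f' x) + norm (f v - f x - (v - x) *\<^sub>R f' x)"
          by (rule norm_triangle_ineq4)
        also have "\<dots> \<le> \<eta> * norm (u - x) + \<eta> * norm (v - x)"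
          using k xN uv by (intro add_mono d) auto
        also have "\<dots> = \<eta> * (v - u)" using k by (simp add: algebra_simps)
        finally show ?thesis using k xN by (simp add: g_def)
      qed
      have "norm ((\<Sum>(x,k)\<in>p. measure lborel k *\<^sub>R g x) - (f b - f a)) = norm (sum ?h p)"
      proof -
        have "f b - f a = (\<Sum>(x,K)\<in>p. f(Sup K) - f(Inf K))"
          using additive_tagged_division_1[where f= f] \<open>a \<le> b\<close> p by auto
        then show ?thesis by (simp add: sum_subtractf case_prod_unfold)
      qed
      also have "\<dots> = norm (sum ?h (p - q) + sum ?h q)"
        using sum.subset_diff[of q p ?h] fin by (auto simp: q_def)
      also have "\<dots> \<le> norm (sum ?h (p - q)) + norm (sum ?h q)" by (rule norm_triangle_ineq)
      also have "norm (sum ?h q) \<le> (\<Sum>i\<in>q. norm (f (Sup (snd i)) - f (Inf (snd i))))"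
        by (rule sum_norm_le) (auto simp: q_def g_def norm_minus_commute)
      also have "norm (sum ?h (p - q)) \<le> (\<Sum>(x,k)\<in>p - q. \<eta> * (Sup k - Inf k))"
        using pt by (intro sum_norm_le) auto
      also have "\<dots> \<le> (\<Sum>(x,k)\<in>p. \<eta> * (Sup k - Inf k))"
      proof (rule sum_mono2[OF fin])
        fix i assume i: "i \<in> p - (p - q)"
        have "Inf (snd i) \<le> Sup (snd i)" using K[of "fst i" "snd i"] i by auto
        then show "0 \<le> (case i of (x, k) \<Rightarrow> \<eta> * (Sup k - Inf k))" using \<eta> by (auto simp: case_prod_unfold)
      qed auto
      also have "\<dots> = \<eta> * (\<Sum>(x,k)\<in>p. Sup k - Inf k)" by (simp add: sum_distrib_left case_prod_unfold)
      also have "(\<Sum>(x,k)\<in>p. Sup k - Inf k) = b - a"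
        using additive_tagged_division_1[where f= "\<lambda>x. x"] \<open>a \<le> b\<close> p by auto
      finally show "norm ((\<Sum>(x,k)\<in>p. measure lborel k *\<^sub>R g x) - (f b - f a)) < e"
        using B1 \<open>\<eta> * (b - a) \<le> e / 2\<close> by linarith
    qed
  qed
  then show ?thesis
    by (intro has_integral_spike[OF N, of _ f' g]) (auto simp: g_def)
qed

text \<open>Extend \<open>k\<close> by zero from each open interval: at every point at most one
  extension is nonzero, so their sum stays below \<open>k\<close>. Open intervals make shared
  endpoints harmless.\<close>

lemma sum_integral_disjoint_intervals_le:
  fixes k :: "real \<Rightarrow> real"
  assumes "finite I" and k: "k integrable_on {a..b}" "\<And>x. x \<in> {a..b} \<Longrightarrow> 0 \<le> k x"
    and uv: "\<And>i. i \<in> I \<Longrightarrow> a \<le> u i \<and> u i \<le> v i \<and> v i \<le> b"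
    and disj: "\<And>i j. i \<in> I \<Longrightarrow> j \<in> I \<Longrightarrow> i \<noteq> j \<Longrightarrow> {u i<..<v i} \<inter> {u j<..<v j} = {}"
  shows "(\<Sum>i\<in>I. integral {u i..v i} k) \<le> integral {a..b} k"
proof -
  define h where "h i x = (if x \<in> {u i<..<v i} then k x else 0)" for i x
  have h: "(h i has_integral integral {u i..v i} k) {a..b}" if "i \<in> I" for i
  proof -
    have "k integrable_on {u i..v i}"
      using k(1) by (rule integrable_subinterval_real) (use uv that in auto)
    then have "(k has_integral integral {u i..v i} k) {u i<..<v i}"
      using has_integral_open_interval[of k _ "u i" "v i"] by (simp add: integrable_integral)
    then show ?thesis
      unfolding h_def by (subst has_integral_restrict) (use uv[OF that] in auto)
  qed
  have "((\<lambda>x. \<Sum>i\<in>I. h i x) has_integral (\<Sum>i\<in>I. integral {u i..v i} k)) {a..b}"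
    by (rule has_integral_sum[OF \<open>finite I\<close> h])
  then show ?thesis
  proof (rule has_integral_le[OF _ integrable_integral[OF k(1)]])
    fix x assume x: "x \<in> {a..b}"
    show "(\<Sum>i\<in>I. h i x) \<le> k x"
    proof (cases "\<exists>i\<in>I. x \<in> {u i<..<v i}")
      case True
      then obtain i where i: "i \<in> I" "x \<in> {u i<..<v i}" by auto
      have "h j x = 0" if "j \<in> I - {i}" for j
      proof -
        have "{u i<..<v i} \<inter> {u j<..<v j} = {}" using disj[of i j] i that by blast
        then have "x \<notin> {u j<..<v j}" using i by blast
        then show ?thesis unfolding h_def by (rule if_not_P)
      qed
      then have "(\<Sum>j\<in>I. h j x) = h i x"
        using i \<open>finite I\<close> by (simp add: sum.remove[of I i])
      then show ?thesis using k(2)[OF x] by (auto simp: h_def)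
    next
      case False
      then have "(\<Sum>j\<in>I. h j x) = 0" by (intro sum.neutral) (auto simp: h_def)
      then show ?thesis using k(2)[OF x] by simp
    qed
  qed
qed

text \<open>Truncation: \<open>norm (f x)\<close> is split into a part bounded by \<open>n\<close>,
  which contributes at most \<open>n\<close> times the total length, and a rest \<open>k\<close>
  whose integral over the whole interval is below half of the tolerance.\<close>

lemma abs_continuous_on_indefinite_integral:
  fixes f :: "real \<Rightarrow> 'a::euclidean_space"
  assumes f: "f absolutely_integrable_on {a..b}"
  shows "abs_continuous_on a b (\<lambda>x. integral {a..x} f)"
  unfolding abs_continuous_on_def
proof (intro allI impI)
  fix \<epsilon> :: real assume "\<epsilon> > 0"
  define h where "h n x = min (norm (f x)) (real n)" for n x
  have nf: "(\<lambda>x. norm (f x)) integrable_on {a..b}"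
    using f unfolding absolutely_integrable_on_def by blast
  have hi: "h n integrable_on {a..b}" for n
  proof -
    have "(\<lambda>x. norm (f x)) absolutely_integrable_on {a..b}"
      using absolutely_integrable_norm[OF f] by (simp add: o_def)
    moreover have "(\<lambda>x::real. real n) absolutely_integrable_on {a..b}"
      by (intro nonnegative_absolutely_integrable_1) auto
    ultimately have "(\<lambda>x. min (norm (f x)) (real n)) absolutely_integrable_on {a..b}"
      by (rule absolutely_integrable_min_1)
    then show ?thesis unfolding h_def using set_lebesgue_integral_eq_integral(1) by blast
  qed
  have lim: "(\<lambda>n. integral {a..b} (h n)) \<longlonglongrightarrow> integral {a..b} (\<lambda>x. norm (f x))"
  proof (rule dominated_convergence(2)[OF hi nf])
    show "norm (h n x) \<le> norm (f x)" for n x by (simp add: h_def)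
    fix x
    have "\<forall>\<^sub>F n in sequentially. h n x = norm (f x)"
      using eventually_ge_at_top[of "nat \<lceil>norm (f x)\<rceil>"]
      by eventually_elim (auto simp: h_def min_def; linarith)
    then show "(\<lambda>n. h n x) \<longlonglongrightarrow> norm (f x)" by (rule tendsto_eventually)
  qed
  then obtain n where n: "integral {a..b} (\<lambda>x. norm (f x)) - integral {a..b} (h n) < \<epsilon> / 2"
  proof -
    have "\<forall>\<^sub>F n in sequentially. integral {a..b} (h n) > integral {a..b} (\<lambda>x. norm (f x)) - \<epsilon>/2"
      by (rule order_tendstoD[OF lim]) (use \<open>\<epsilon> > 0\<close> in auto)
    then obtain n where "integral {a..b} (h n) > integral {a..b} (\<lambda>x. norm (f x)) - \<epsilon>/2"
      unfolding eventually_sequentially by blast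
    then show ?thesis using that[of n] by linarith
  qed
  define k where "k x = norm (f x) - h n x" for x
  have ki: "k integrable_on {a..b}" unfolding k_def by (intro integrable_diff nf hi)
  have kint: "integral {a..b} k < \<epsilon> / 2" unfolding k_def using n by (simp add: integral_diff nf hi)
  define \<delta> where "\<delta> = \<epsilon> / (2 * (real n + 1))"
  have \<delta>: "\<delta> > 0" using \<open>\<epsilon> > 0\<close> by (simp add: \<delta>_def)
  show "\<exists>\<delta>>0. \<forall>(m::nat) (u::nat \<Rightarrow> real) v.
        (\<forall>i<m. a \<le> u i \<and> u i \<le> v i \<and> v i \<le> b) \<longrightarrow>
        (\<forall>i<m. \<forall>j<m. i \<noteq> j \<longrightarrow> {u i<..<v i} \<inter> {u j<..<v j} = {}) \<longrightarrow>
        (\<Sum>i<m. v i - u i) < \<delta> \<longrightarrow>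
        (\<Sum>i<m. norm (integral {a..v i} f - integral {a..u i} f)) < \<epsilon>"
  proof (intro exI[of _ \<delta>] conjI allI impI \<delta>)
    fix m :: nat and u v :: "nat \<Rightarrow> real"
    assume uv: "\<forall>i<m. a \<le> u i \<and> u i \<le> v i \<and> v i \<le> b"
      and disj: "\<forall>i<m. \<forall>j<m. i \<noteq> j \<longrightarrow> {u i<..<v i} \<inter> {u j<..<v j} = {}"
      and len: "(\<Sum>i<m. v i - u i) < \<delta>"
    have fi: "f integrable_on {a..b}" using f set_lebesgue_integral_eq_integral(1) by blast
    have "norm (integral {a..v i} f - integral {a..u i} f) \<le> integral {u i..v i} k + real n * (v i - u i)" if "i < m" for i
    proof -
      have *: "a \<le> u i" "u i \<le> v i" "v i \<le> b" using uv that by auto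
      have sub: "g integrable_on {u i..v i}" if "g integrable_on {a..b}" for g :: "real \<Rightarrow> 'c::euclidean_space"
        using that by (rule integrable_subinterval_real) (use * in auto)
      have "integral {a..u i} f + integral {u i..v i} f = integral {a..v i} f"
        by (rule Henstock_Kurzweil_Integration.integral_combine) (use * integrable_subinterval_real[OF fi, of a "v i"] in auto)
      then have "norm (integral {a..v i} f - integral {a..u i} f) = norm (integral {u i..v i} f)"
        by (metis add_diff_cancel_left')
      also have "\<dots> \<le> integral {u i..v i} (\<lambda>x. k x + real n)"
        by (rule integral_norm_bound_integral)
          (use sub[OF fi] integrable_add[OF sub[OF ki] integrable_const_ivl] in \<open>auto simp: k_def h_def\<close>)
      also have "\<dots> = integral {u i..v i} k + real n * (v i - u i)"
        using sub[OF ki] * by (subst integral_add) auto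
      finally show ?thesis .
    qed
    then have "(\<Sum>i<m. norm (integral {a..v i} f - integral {a..u i} f)) \<le> (\<Sum>i<m. integral {u i..v i} k + real n * (v i - u i))"
      by (intro sum_mono) auto
    also have "\<dots> = (\<Sum>i<m. integral {u i..v i} k) + real n * (\<Sum>i<m. v i - u i)"
      by (simp add: sum.distrib sum_distrib_left)
    also have "(\<Sum>i<m. integral {u i..v i} k) \<le> integral {a..b} k"
      by (rule sum_integral_disjoint_intervals_le[OF _ ki]) (use uv disj in \<open>auto simp: k_def h_def\<close>)
    also have "real n * (\<Sum>i<m. v i - u i) \<le> real n * \<delta>"
      using len by (intro mult_left_mono) auto
    also have "real n * \<delta> \<le> \<epsilon> / 2"
      using \<open>\<epsilon> > 0\<close> by (simp add: \<delta>_def field_simps)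
    finally show "(\<Sum>i<m. norm (integral {a..v i} f - integral {a..u i} f)) < \<epsilon>"
      using kint by linarith
  qed
qed

text \<open>Henstock's lemma bounds the total length of any disjoint family of intervals on which the
  difference quotient is off by a fixed amount; Vitali's covering lemma then bounds the set of bad points.\<close>

lemma Lebesgue_differentiation:
  fixes f :: "real \<Rightarrow> 'a::euclidean_space"
  assumes f: "f integrable_on {a..b}"
  obtains N where "negligible N"
    "\<And>x. x \<in> {a<..<b} - N \<Longrightarrow> ((\<lambda>x. integral {a..x} f) has_vector_derivative f x) (at x)"
proof -
  define F where "F x = integral {a..x} f" for x
  \<comment> \<open>\<open>bad n\<close> fixes the error level 1/(n+1), and \<open>E n\<close>
    collects the points with bad partners arbitrarily close. Outside all \<open>E n\<close> the
    difference quotients converge to \<open>f x\<close>.\<close>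
  define bad where "bad n x y \<longleftrightarrow> norm (F y - F x - (y - x) *\<^sub>R f x) > \<bar>y - x\<bar> / real (Suc n)" for n x y
  define E where "E n = {x\<in>{a<..<b}. \<forall>\<delta>>0. \<exists>y\<in>{a..b}. y \<noteq> x \<and> \<bar>y - x\<bar> < \<delta> \<and> bad n x y}" for n
  have Fdiff: "integral {u..v} f = F v - F u" if "a \<le> u" "u \<le> v" "v \<le> b" for u v
  proof -
    have "F u + integral {u..v} f = F v"
      unfolding F_def by (rule Henstock_Kurzweil_Integration.integral_combine) (use that integrable_subinterval_real[OF f, of a v] in auto)
    then show ?thesis by (metis add_diff_cancel_left')
  qed
  have negE: "negligible (E n)" for n
    unfolding negligible_outer_le
  proof (intro allI impI)
    fix e :: real assume "e > 0"
    \<comment> \<open>The 5 pays for the Vitali enlargement of balls; \<open>Suc n\<close> pays for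
      passing from the Henstock error of a bad segment to its length.\<close>
    define e' where "e' = e / (5 * real (Suc n))"
    have e': "e' > 0" using \<open>e > 0\<close> by (simp add: e'_def)
    obtain \<gamma> where \<gamma>: "gauge \<gamma>"
      and H: "\<And>p. \<lbrakk>p tagged_partial_division_of (cbox a b); \<gamma> fine p\<rbrakk> \<Longrightarrow>
             (\<Sum>(x,k)\<in>p. norm (measure lborel k *\<^sub>R f x - integral k f)) < e'"
      by (rule Henstock_lemma[of f a b e']) (use f e' in simp_all)
    \<comment> \<open>A pair \<open>(x, y)\<close> stands for the segment from a point to its bad
      partner. Vitali's lemma sees it as a ball about the midpoint, Henstock's lemma as an interval
      tagged at its endpoint \<open>x\<close>.\<close>
    define c where "c = (\<lambda>(x::real,y). (x + y) / 2)"
    define r where "r = (\<lambda>(x::real,y). \<bar>y - x\<bar> / 2)"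
    define seg where "seg i = cball (c i) (r i)" for i
    have seg_eq: "seg (x,y) = {min x y..max x y}" for x y
      unfolding seg_def c_def r_def cball_eq_atLeastAtMost by (auto simp: min_def max_def field_simps)
    define K where "K = {(x,y). x \<in> E n \<and> y \<in> {a..b} \<and> y \<noteq> x \<and> bad n x y \<and> seg (x,y) \<subseteq> \<gamma> x}"
    have Kpos: "0 < r i \<and> r i \<le> (b - a) / 2" if "i \<in> K" for i
      using that by (auto simp: K_def r_def E_def)
    obtain C where C: "countable C" "C \<subseteq> K"
     "pairwise (\<lambda>i j. disjnt (cball (c i) (r i)) (cball (c j) (r j))) C"
     "\<And>i. i \<in> K \<Longrightarrow> \<exists>j. j \<in> C \<and> \<not> disjnt (cball (c i) (r i)) (cball (c j) (r j)) \<and>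
                        cball (c i) (r i) \<subseteq> ball (c j) (5 * r j)"
      using Vitali_covering_lemma_cballs_balls[of K r "(b-a)/2" c] Kpos by blast
    define T where "T = (\<Union>j\<in>C. ball (c j) (5 * r j))"
    have sumr: "(\<Sum>j\<in>C'. 2 * r j) \<le> real (Suc n) * e'" if C': "C' \<subseteq> C" "finite C'" for C'
    proof -
      have inK: "i \<in> K" if "i \<in> C'" for i using C C' that by auto
      have disj: "seg i \<inter> seg j = {}" if "i \<in> C'" "j \<in> C'" "i \<noteq> j" for i j
        using pairwiseD[OF C(3), of i j] C' that by (auto simp: disjnt_def seg_def)
      have ne: "seg i \<noteq> {}" for i by (cases i) (auto simp: seg_eq)
      have inj: "inj_on (\<lambda>i. (fst i, seg i)) C'"
      proof (rule inj_onI)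
        fix i j assume ij: "i \<in> C'" "j \<in> C'" "(fst i, seg i) = (fst j, seg j)"
        show "i = j"
        proof (rule ccontr)
          assume "i \<noteq> j"
          with disj[OF ij(1,2)] ij(3) ne[of i] show False by simp
        qed
      qed
      let ?p = "(\<lambda>i. (fst i, seg i)) ` C'"
      have "?p tagged_partial_division_of cbox a b"
        unfolding tagged_partial_division_of_def
      proof (intro conjI allI impI)
        show "finite ?p" using C' by simp
        fix x k assume xk: "(x,k) \<in> ?p"
        then obtain y where y: "(x,y) \<in> C'" "k = seg (x,y)" by auto
        then have "a \<le> x" "x \<le> b" "a \<le> y" "y \<le> b" using inK[OF y(1)] by (auto simp: K_def E_def)
        then show "x \<in> k" "k \<subseteq> cbox a b" "\<exists>a b. k = cbox a b" using y by (auto simp: seg_eq)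
      next
        fix x k x' k' assume xk: "(x,k) \<in> ?p \<and> (x',k') \<in> ?p \<and> (x,k) \<noteq> (x',k')"
        then have "(x,k) \<in> ?p" by blast
        then obtain y where y: "(x,y) \<in> C'" "k = seg (x,y)" by auto
        from xk have "(x',k') \<in> ?p" by blast
        then obtain y' where y': "(x',y') \<in> C'" "k' = seg (x',y')" by auto
        then have "k \<inter> k' = {}" using disj[OF y(1) y'(1)] xk y by auto
        then show "interior k \<inter> interior k' = {}" using interior_subset by blast
      qed
      moreover have "\<gamma> fine ?p"
        unfolding fine_def
      proof (intro ballI)
        fix xk assume "xk \<in> ?p"
        then obtain x y where xy: "(x,y) \<in> C'" "xk = (x, seg (x,y))" by auto
        then show "case xk of (x, k) \<Rightarrow> k \<subseteq> \<gamma> x" using inK[OF xy(1)] by (simp add: K_def)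
      qed
      ultimately have "(\<Sum>(x,k)\<in>?p. norm (measure lborel k *\<^sub>R f x - integral k f)) < e'" by (rule H)
      then have sm: "(\<Sum>i\<in>C'. norm (measure lborel (seg i) *\<^sub>R f (fst i) - integral (seg i) f)) < e'"
        by (simp add: sum.reindex[OF inj] o_def)
      have "2 * r i \<le> real (Suc n) * norm (measure lborel (seg i) *\<^sub>R f (fst i) - integral (seg i) f)" if "i \<in> C'" for i
      proof -
        obtain x y where i: "i = (x,y)" by (cases i)
        have *: "a \<le> x" "x \<le> b" "a \<le> y" "y \<le> b" "bad n x y" using inK[OF that] i by (auto simp: K_def E_def)
        have "norm (measure lborel (seg i) *\<^sub>R f x - integral (seg i) f) = norm (F y - F x - (y - x) *\<^sub>R f x)"
        proof (cases "x \<le> y")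
          case True
          then show ?thesis using * Fdiff[of x y] by (simp add: i seg_eq norm_minus_commute)
        next
          case False
          then have "norm (measure lborel (seg i) *\<^sub>R f x - integral (seg i) f) = norm ((x - y) *\<^sub>R f x - (F x - F y))"
            using * Fdiff[of y x] by (simp add: i seg_eq min_def max_def)
          also have "(x - y) *\<^sub>R f x - (F x - F y) = F y - F x - (y - x) *\<^sub>R f x" by (simp add: algebra_simps)
          finally show ?thesis .
        qed
        moreover have "2 * r i = \<bar>y - x\<bar>" by (simp add: i r_def)
        ultimately show ?thesis using *(5) by (simp add: bad_def i field_simps)
      qed
      then have "(\<Sum>j\<in>C'. 2 * r j) \<le> (\<Sum>i\<in>C'. real (Suc n) * norm (measure lborel (seg i) *\<^sub>R f (fst i) - integral (seg i) f))"
        by (rule sum_mono)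
      also have "\<dots> = real (Suc n) * (\<Sum>i\<in>C'. norm (measure lborel (seg i) *\<^sub>R f (fst i) - integral (seg i) f))"
        by (rule sum_distrib_left[symmetric])
      also have "\<dots> \<le> real (Suc n) * e'" using sm by (intro mult_left_mono) auto
      finally show ?thesis .
    qed
    have mT: "measure lebesgue (\<Union>j\<in>C'. ball (c j) (5 * r j)) \<le> e" if C': "C' \<subseteq> C" "finite C'" for C'
    proof -
      have "measure lebesgue (\<Union>j\<in>C'. ball (c j) (5 * r j)) \<le> (\<Sum>j\<in>C'. measure lebesgue (ball (c j) (5 * r j)))"
        by (rule measure_UNION_le[OF that(2)]) simp
      also have "\<dots> = (\<Sum>j\<in>C'. 5 * (2 * r j))"
      proof (rule sum.cong[OF refl])
        fix j assume "j \<in> C'"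
        then have "r j > 0" using C C' Kpos by blast
        then show "measure lebesgue (ball (c j) (5 * r j)) = 5 * (2 * r j)"
          by (simp add: ball_eq_greaterThanLessThan)
      qed
      also have "\<dots> \<le> 5 * (real (Suc n) * e')"
        unfolding sum_distrib_left[of 5, symmetric] by (rule mult_left_mono[OF sumr[OF that]]) simp
      also have "\<dots> = e" by (simp add: e'_def del: of_nat_Suc)
      finally show ?thesis .
    qed
    show "\<exists>T. E n \<subseteq> T \<and> T \<in> lmeasurable \<and> measure lebesgue T \<le> e"
    proof (intro exI[of _ T] conjI)
      show "T \<in> lmeasurable" unfolding T_def
        by (rule fmeasurable_UN_bound[OF C(1) _ mT]) auto
      show "measure lebesgue T \<le> e" unfolding T_def
        by (rule measure_UN_bound[OF C(1) _ mT]) auto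
      show "E n \<subseteq> T"
      proof
        fix x assume x: "x \<in> E n"
        obtain d where d: "d > 0" "ball x d \<subseteq> \<gamma> x"
          using \<gamma> by (meson gauge_def openE)
        obtain y where y: "y \<in> {a..b}" "y \<noteq> x" "\<bar>y - x\<bar> < d" "bad n x y"
          using x d unfolding E_def by blast
        have "seg (x,y) \<subseteq> ball x d" using y by (auto simp: seg_eq dist_real_def)
        then have "(x,y) \<in> K" using x y d by (auto simp: K_def)
        from C(4)[OF this] obtain j where "j \<in> C" "seg (x,y) \<subseteq> ball (c j) (5 * r j)"
          by (auto simp: seg_def)
        moreover have "x \<in> seg (x,y)" by (auto simp: seg_eq)
        ultimately show "x \<in> T" unfolding T_def by blast
      qed
    qed
  qed
  show thesis
  proof (rule that)
    show "negligible (\<Union>n. E n)" using negE by (intro negligible_countable_Union) auto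
    fix x assume x: "x \<in> {a<..<b} - (\<Union>n. E n)"
    have "(F has_vector_derivative f x) (at x)"
      unfolding has_vector_derivative_def has_derivative_at_alt
    proof (intro conjI allI impI)
      show "bounded_linear (\<lambda>y. y *\<^sub>R f x)" by (rule bounded_linear_scaleR_left)
      fix e :: real assume "e > 0"
      obtain n where n: "inverse (real (Suc n)) < e" using reals_Archimedean[OF \<open>e > 0\<close>] by auto
      have "x \<notin> E n" "x \<in> {a<..<b}" using x by auto
      then obtain \<delta> where \<delta>: "\<delta> > 0" "\<And>y. y \<in> {a..b} \<Longrightarrow> y \<noteq> x \<Longrightarrow> \<bar>y - x\<bar> < \<delta> \<Longrightarrow> \<not> bad n x y"
        unfolding E_def by blast
      show "\<exists>d>0. \<forall>y. norm (y - x) < d \<longrightarrow> norm (F y - F x - (y - x) *\<^sub>R f x) \<le> e * norm (y - x)"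
      proof (intro exI[of _ "min \<delta> (min (x - a) (b - x))"] conjI allI impI)
        fix y assume y: "norm (y - x) < min \<delta> (min (x - a) (b - x))"
        show "norm (F y - F x - (y - x) *\<^sub>R f x) \<le> e * norm (y - x)"
        proof (cases "y = x")
          case False
          have "y \<in> {a..b}" using y by auto
          then have "\<not> bad n x y" using \<delta>(2)[of y] False y by auto
          then have "norm (F y - F x - (y - x) *\<^sub>R f x) \<le> inverse (real (Suc n)) * \<bar>y - x\<bar>"
            by (simp add: bad_def field_simps)
          also have "\<dots> \<le> e * \<bar>y - x\<bar>" using n by (intro mult_right_mono) auto
          finally show ?thesis by simp
        qed simp
      qed (use \<delta> x in auto)
    qed
    then show "((\<lambda>x. integral {a..x} f) has_vector_derivative f x) (at x)" by (simp add: F_def[abs_def])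
  qed
qed

section \<open>Functions with an integrable derivative\<close>

text \<open>Absolute continuity in integral form. Differential equations, products and reflections
  can then be handled by calculus rules whose statements carry no exceptional null sets.\<close>

definition L1_deriv :: "real \<Rightarrow> real \<Rightarrow> (real \<Rightarrow> 'a::euclidean_space) \<Rightarrow> (real \<Rightarrow> 'a) \<Rightarrow> bool" where
  "L1_deriv a b f f' \<longleftrightarrow> f' absolutely_integrable_on {a..b} \<and> (\<forall>x\<in>{a..b}. f x = f a + integral {a..x} f')"

lemma L1_deriv_integrable: "L1_deriv a b f f' \<Longrightarrow> f' integrable_on {a..b}"
  unfolding L1_deriv_def using set_lebesgue_integral_eq_integral(1) by blast

lemma L1_deriv_abs_integrable: "L1_deriv a b f f' \<Longrightarrow> f' absolutely_integrable_on {a..b}"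
  unfolding L1_deriv_def by blast

lemma L1_derivD: "L1_deriv a b f f' \<Longrightarrow> x \<in> {a..b} \<Longrightarrow> f x = f a + integral {a..x} f'"
  unfolding L1_deriv_def by blast

lemma L1_deriv_cong:
  assumes "L1_deriv a b f f'" "\<And>x. x \<in> {a..b} \<Longrightarrow> f x = g x" "negligible N"
    and f': "\<And>x. x \<in> {a..b} - N \<Longrightarrow> f' x = g' x"
  shows "L1_deriv a b g g'"
proof -
  have "g' absolutely_integrable_on {a..b}"
    using L1_deriv_abs_integrable[OF assms(1)] assms(3)
    by (rule absolutely_integrable_spike) (use f' in auto)
  moreover have eqI: "integral {a..x} f' = integral {a..x} g'" if "x \<in> {a..b}" for x
    by (rule integral_spike[OF assms(3)]) (use f' that in auto)
  moreover have "g x = g a + integral {a..x} g'" if "x \<in> {a..b}" for x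
  proof -
    have "a \<in> {a..b}" using that by simp
    from assms(2)[OF this] assms(2)[OF that] show ?thesis using L1_derivD[OF assms(1) that] eqI[OF that] by metis
  qed
  ultimately show ?thesis unfolding L1_deriv_def by (intro conjI ballI)
qed

lemma L1_deriv_cong': 
  assumes "L1_deriv a b f f'" "\<And>x. x \<in> {a..b} \<Longrightarrow> f x = g x" "\<And>x. x \<in> {a..b} \<Longrightarrow> f' x = g' x"
  shows "L1_deriv a b g g'"
  by (rule L1_deriv_cong[OF assms(1,2), of "{}"]) (use assms(3) in auto)

lemma L1_deriv_diff_eq_integral:
  assumes "L1_deriv a b f f'" "a \<le> u" "u \<le> v" "v \<le> b"
  shows "f v - f u = integral {u..v} f'"
proof -
  have "integral {a..u} f' + integral {u..v} f' = integral {a..v} f'"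
    by (rule Henstock_Kurzweil_Integration.integral_combine)
      (use assms integrable_subinterval_real[OF L1_deriv_integrable[OF assms(1)], of a v] in auto)
  moreover have "f u = f a + integral {a..u} f'" "f v = f a + integral {a..v} f'"
    using L1_derivD[OF assms(1), of u] L1_derivD[OF assms(1), of v] assms by auto
  ultimately show ?thesis by (simp add: algebra_simps)
qed

lemma L1_deriv_continuous:
  assumes "L1_deriv a b f f'"
  shows "continuous_on {a..b} f"
proof -
  have "continuous_on {a..b} (\<lambda>x. f a + integral {a..x} f')"
    by (intro continuous_intros indefinite_integral_continuous_1 L1_deriv_integrable[OF assms])
  then show ?thesis
    by (rule continuous_on_eq) (rule L1_derivD[OF assms, symmetric])
qed

text \<open>One comparison principle for several uses: restriction to a subinterval, adding a
  constant, products of bounded functions, and composition with a function that is Lipschitz on the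
  range.\<close>

lemma abs_continuous_on_dominated:
  fixes f :: "real \<Rightarrow> 'a::euclidean_space" and g :: "real \<Rightarrow> 'b::euclidean_space"
    and h :: "real \<Rightarrow> 'c::real_normed_vector"
  assumes f: "abs_continuous_on a b f" and g: "abs_continuous_on a b g" and K: "K \<ge> 0"
    and cd: "a \<le> c" "d \<le> b"
    and le: "\<And>u v. c \<le> u \<Longrightarrow> u \<le> v \<Longrightarrow> v \<le> d \<Longrightarrow> norm (h v - h u) \<le> K * (norm (f v - f u) + norm (g v - g u))"
  shows "abs_continuous_on c d h"
  unfolding abs_continuous_on_def
proof (intro allI impI)
  fix \<epsilon> :: real assume "\<epsilon> > 0"
  define e where "e = \<epsilon> / 2 / (K + 1)"
  have e: "e > 0" using \<open>\<epsilon> > 0\<close> K by (simp add: e_def)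
  obtain \<delta>1 where \<delta>1: "\<delta>1 > 0" and f': "\<And>(I::nat set) u v. finite I \<Longrightarrow> (\<And>i. i \<in> I \<Longrightarrow> a \<le> u i \<and> u i \<le> v i \<and> v i \<le> b) \<Longrightarrow>
       (\<And>i j. i \<in> I \<Longrightarrow> j \<in> I \<Longrightarrow> i \<noteq> j \<Longrightarrow> {u i<..<v i} \<inter> {u j<..<v j} = {}) \<Longrightarrow>
       (\<Sum>i\<in>I. v i - u i) < \<delta>1 \<Longrightarrow> (\<Sum>i\<in>I. norm (f (v i) - f (u i))) < e"
    by (rule abs_continuous_on_finite_family[OF f e, where 'i=nat]) blast
  obtain \<delta>2 where \<delta>2: "\<delta>2 > 0" and g': "\<And>(I::nat set) u v. finite I \<Longrightarrow> (\<And>i. i \<in> I \<Longrightarrow> a \<le> u i \<and> u i \<le> v i \<and> v i \<le> b) \<Longrightarrow>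
       (\<And>i j. i \<in> I \<Longrightarrow> j \<in> I \<Longrightarrow> i \<noteq> j \<Longrightarrow> {u i<..<v i} \<inter> {u j<..<v j} = {}) \<Longrightarrow>
       (\<Sum>i\<in>I. v i - u i) < \<delta>2 \<Longrightarrow> (\<Sum>i\<in>I. norm (g (v i) - g (u i))) < e"
    by (rule abs_continuous_on_finite_family[OF g e, where 'i=nat]) blast
  show "\<exists>\<delta>>0. \<forall>n (u::nat \<Rightarrow> real) v.
      (\<forall>i<n. c \<le> u i \<and> u i \<le> v i \<and> v i \<le> d) \<longrightarrow>
      (\<forall>i<n. \<forall>j<n. i \<noteq> j \<longrightarrow> {u i<..<v i} \<inter> {u j<..<v j} = {}) \<longrightarrow>
      (\<Sum>i<n. v i - u i) < \<delta> \<longrightarrow> (\<Sum>i<n. norm (h (v i) - h (u i))) < \<epsilon>"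
  proof (intro exI[of _ "min \<delta>1 \<delta>2"] conjI allI impI)
    fix n and u v :: "nat \<Rightarrow> real"
    assume 1: "\<forall>i<n. c \<le> u i \<and> u i \<le> v i \<and> v i \<le> d"
      and 2: "\<forall>i<n. \<forall>j<n. i \<noteq> j \<longrightarrow> {u i<..<v i} \<inter> {u j<..<v j} = {}" and 3: "(\<Sum>i<n. v i - u i) < min \<delta>1 \<delta>2"
    have b1: "a \<le> u i \<and> u i \<le> v i \<and> v i \<le> b" if "i \<in> {..<n}" for i
      using 1[rule_format, of i] cd that by auto
    have b2: "{u i<..<v i} \<inter> {u j<..<v j} = {}" if "i \<in> {..<n}" "j \<in> {..<n}" "i \<noteq> j" for i j
      using 2 that by blast
    have sf: "(\<Sum>i<n. norm (f (v i) - f (u i))) < e"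
      by (rule f'[OF _ b1 b2]) (use 3 in auto)
    have sg: "(\<Sum>i<n. norm (g (v i) - g (u i))) < e"
      by (rule g'[OF _ b1 b2]) (use 3 in auto)
    have "(\<Sum>i<n. norm (h (v i) - h (u i))) \<le> (\<Sum>i<n. K * (norm (f (v i) - f (u i)) + norm (g (v i) - g (u i))))"
      using 1 by (intro sum_mono le) auto
    also have "\<dots> = K * ((\<Sum>i<n. norm (f (v i) - f (u i))) + (\<Sum>i<n. norm (g (v i) - g (u i))))"
      by (simp add: sum_distrib_left sum.distrib distrib_left)
    also have "\<dots> \<le> K * (e + e)" using sf sg K by (intro mult_left_mono) auto
    also have "\<dots> < (K + 1) * (e + e)" using e by simp
    also have "\<dots> = (K + 1) * e + (K + 1) * e" by (rule distrib_left)
    also have "(K + 1) * e = \<epsilon> / 2"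
    proof -
      have "K + 1 \<noteq> 0" using K by linarith
      then show ?thesis unfolding e_def using nonzero_mult_div_cancel_left[OF \<open>K + 1 \<noteq> 0\<close>, of "\<epsilon> / 2"]
        by (simp only: times_divide_eq_right)
    qed
    also have "\<epsilon> / 2 + \<epsilon> / 2 = \<epsilon>" by simp
    finally show "(\<Sum>i<n. norm (h (v i) - h (u i))) < \<epsilon>" .
  qed (use \<delta>1 \<delta>2 in auto)
qed

lemma L1_deriv_abs_continuous:
  assumes "L1_deriv a b f f'"
  shows "abs_continuous_on a b f"
proof -
  have *: "abs_continuous_on a b (\<lambda>x. integral {a..x} f')"
    by (rule abs_continuous_on_indefinite_integral[OF L1_deriv_abs_integrable[OF assms]])
  show ?thesis
  proof (rule abs_continuous_on_dominated[OF * *, of 1])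
    fix u v assume uv: "a \<le> u" "u \<le> v" "v \<le> b"
    then have "f v - f u = integral {a..v} f' - integral {a..u} f'"
      using L1_derivD[OF assms, of u] L1_derivD[OF assms, of v] by auto
    then show "norm (f v - f u) \<le> 1 * (norm (integral {a..v} f' - integral {a..u} f') + norm (integral {a..v} f' - integral {a..u} f'))"
      by simp
  qed auto
qed

lemma L1_deriv_has_vector_derivative:
  assumes "L1_deriv a b f f'"
  obtains N where "negligible N" "\<And>x. x \<in> {a<..<b} - N \<Longrightarrow> (f has_vector_derivative f' x) (at x)"
proof -
  obtain N where N: "negligible N"
    "\<And>x. x \<in> {a<..<b} - N \<Longrightarrow> ((\<lambda>x. integral {a..x} f') has_vector_derivative f' x) (at x)"
    using Lebesgue_differentiation[OF L1_deriv_integrable[OF assms]] by blast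
  show ?thesis
  proof (rule that[OF N(1)])
    fix x assume x: "x \<in> {a<..<b} - N"
    have "((\<lambda>x. f a + integral {a..x} f') has_vector_derivative 0 + f' x) (at x)"
      using N(2)[OF x] by (intro has_vector_derivative_add) auto
    then have "((\<lambda>x. f a + integral {a..x} f') has_vector_derivative f' x) (at x)" by simp
    then show "(f has_vector_derivative f' x) (at x)"
      by (rule has_vector_derivative_transform_within_open[of _ _ _ "{a<..<b}"])
        (use x L1_derivD[OF assms, symmetric] in auto)
  qed
qed

text \<open>An integrable derivative almost everywhere does not determine a function up to a
  constant, as Cantor's function shows; absolute continuity excludes such singular parts through the
  fundamental theorem above.\<close>

lemma L1_derivI:
  fixes f :: "real \<Rightarrow> 'a::euclidean_space"
  assumes ac: "abs_continuous_on a b f" and f': "f' absolutely_integrable_on {a..b}" and N: "negligible N"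
    and d: "\<And>x. x \<in> {a<..<b} - N \<Longrightarrow> (f has_vector_derivative f' x) (at x)"
  shows "L1_deriv a b f f'"
  unfolding L1_deriv_def
proof (intro conjI ballI f')
  fix x assume x: "x \<in> {a..b}"
  have "(f' has_integral (f x - f a)) {a..x}"
  proof (rule FTC_abs_continuous)
    show "abs_continuous_on a x f" by (rule abs_continuous_on_dominated[OF ac ac, of 1]) (use x in auto)
    show "negligible (N \<union> {a,b})" using N by (simp add: negligible_Un)
    fix y assume "y \<in> {a..x} - (N \<union> {a,b})"
    then show "(f has_vector_derivative f' y) (at y within {a..x})"
      using has_vector_derivative_at_within[OF d[of y]] x by auto
  qed (use x in auto)
  then show "f x = f a + integral {a..x} f'" by (simp add: integral_unique)
qed

lemma L1_deriv_C1:
  fixes f :: "real \<Rightarrow> 'a::euclidean_space"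
  assumes "\<And>x. x \<in> {a..b} \<Longrightarrow> (f has_vector_derivative f' x) (at x within {a..b})" "continuous_on {a..b} f'"
  shows "L1_deriv a b f f'"
  unfolding L1_deriv_def
proof (intro conjI ballI)
  show "f' absolutely_integrable_on {a..b}" using assms(2) by (rule absolutely_integrable_continuous_real)
  fix x assume x: "x \<in> {a..b}"
  have "(f' has_integral (f x - f a)) {a..x}"
  proof (rule fundamental_theorem_of_calculus)
    fix y assume "y \<in> {a..x}"
    then show "(f has_vector_derivative f' y) (at y within {a..x})"
      using has_vector_derivative_within_subset[OF assms(1), of y "{a..x}"] x by auto
  qed (use x in auto)
  then show "f x = f a + integral {a..x} f'" by (simp add: integral_unique)
qed

lemma L1_deriv_indefinite_integral:
  assumes "f absolutely_integrable_on {a..b}"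
  shows "L1_deriv a b (\<lambda>x. c + integral {a..x} f) f"
  using assms by (simp add: L1_deriv_def)

lemma L1_deriv_linear:
  assumes "L1_deriv a b f f'" "bounded_linear h"
  shows "L1_deriv a b (\<lambda>x. h (f x)) (\<lambda>x. h (f' x))"
  unfolding L1_deriv_def
proof (intro conjI ballI)
  show "(\<lambda>x. h (f' x)) absolutely_integrable_on {a..b}"
    using absolutely_integrable_linear[OF L1_deriv_abs_integrable[OF assms(1)] assms(2)] by (simp add: o_def)
  fix x assume x: "x \<in> {a..b}"
  have "f' integrable_on {a..x}"
    using integrable_subinterval_real[OF L1_deriv_integrable[OF assms(1)], of a x] x by auto
  then have "integral {a..x} (\<lambda>x. h (f' x)) = h (integral {a..x} f')"
    using integral_linear[of f' "{a..x}" h] assms(2) by (simp add: o_def)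
  moreover have "f x = f a + integral {a..x} f'" using L1_derivD[OF assms(1) x] .
  ultimately show "h (f x) = h (f a) + integral {a..x} (\<lambda>x. h (f' x))"
    using linear_add[OF bounded_linear.linear[OF assms(2)]] by metis
qed

lemma L1_deriv_add:
  assumes f: "L1_deriv a b f f'" and g: "L1_deriv a b g g'"
  shows "L1_deriv a b (\<lambda>x. f x + g x) (\<lambda>x. f' x + g' x)"
  unfolding L1_deriv_def
proof (intro conjI ballI)
  show "(\<lambda>x. f' x + g' x) absolutely_integrable_on {a..b}"
    using L1_deriv_abs_integrable[OF f] L1_deriv_abs_integrable[OF g] by (rule set_integral_add)
  fix x assume x: "x \<in> {a..b}"
  have "f' integrable_on {a..x}" "g' integrable_on {a..x}"
    using integrable_subinterval_real[OF L1_deriv_integrable, of a b _ _ a x] f g x by auto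
  then have "integral {a..x} (\<lambda>x. f' x + g' x) = integral {a..x} f' + integral {a..x} g'"
    by (rule integral_add)
  moreover have "f x = f a + integral {a..x} f'" "g x = g a + integral {a..x} g'"
    using L1_derivD[OF f x] L1_derivD[OF g x] .
  ultimately show "f x + g x = f a + g a + integral {a..x} (\<lambda>x. f' x + g' x)" by simp
qed

lemma L1_deriv_minus: "L1_deriv a b f f' \<Longrightarrow> L1_deriv a b (\<lambda>x. - f x) (\<lambda>x. - f' x)"
  using L1_deriv_linear[of a b f f' uminus] bounded_linear_minus[OF bounded_linear_ident] by auto

lemma L1_deriv_diff:
  assumes f: "L1_deriv a b f f'" and g: "L1_deriv a b g g'"
  shows "L1_deriv a b (\<lambda>x. f x - g x) (\<lambda>x. f' x - g' x)"
  using L1_deriv_add[OF f L1_deriv_minus[OF g]] by simp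

lemma L1_deriv_Pair:
  fixes f :: "real \<Rightarrow> 'a::euclidean_space" and g :: "real \<Rightarrow> 'b::euclidean_space"
  assumes f: "L1_deriv a b f f'" and g: "L1_deriv a b g g'"
  shows "L1_deriv a b (\<lambda>x. (f x, g x)) (\<lambda>x. (f' x, g' x))"
proof -
  have "L1_deriv a b (\<lambda>x. (f x, 0::'b)) (\<lambda>x. (f' x, 0))"
    by (rule L1_deriv_linear[OF f]) (intro bounded_linear_Pair bounded_linear_ident bounded_linear_zero)
  moreover have "L1_deriv a b (\<lambda>x. (0::'a, g x)) (\<lambda>x. (0, g' x))"
    by (rule L1_deriv_linear[OF g]) (intro bounded_linear_Pair bounded_linear_ident bounded_linear_zero)
  ultimately show ?thesis using L1_deriv_add by force
qed

lemma L1_deriv_fst: "L1_deriv a b u u' \<Longrightarrow> L1_deriv a b (\<lambda>x. fst (u x)) (\<lambda>x. fst (u' x))"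
  by (erule L1_deriv_linear[OF _ bounded_linear_fst])

lemma L1_deriv_snd: "L1_deriv a b u u' \<Longrightarrow> L1_deriv a b (\<lambda>x. snd (u x)) (\<lambda>x. snd (u' x))"
  by (erule L1_deriv_linear[OF _ bounded_linear_snd])

lemma absolutely_integrable_continuous_bilinear:
  fixes a b :: real and prod :: "'a::euclidean_space \<Rightarrow> 'b::euclidean_space \<Rightarrow> 'c::euclidean_space"
  assumes "bounded_bilinear prod" "continuous_on {a..b} f" "g absolutely_integrable_on {a..b}"
  shows "(\<lambda>x. prod (f x) (g x)) absolutely_integrable_on {a..b}"
proof (rule absolutely_integrable_bounded_measurable_product[where h=prod])
  have lb: "{a..b} \<in> sets lebesgue" using fmeasurableD[OF lmeasurable_cbox[of a b]] by simp
  show "bilinear prod" using assms(1) by (simp add: bilinear_conv_bounded_bilinear)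
  show "f \<in> borel_measurable (lebesgue_on {a..b})"
    using assms(2) lb by (rule continuous_imp_measurable_on_sets_lebesgue)
  show "{a..b} \<in> sets lebesgue" by (rule lb)
  show "bounded (f ` {a..b})"
    using assms(2) by (intro compact_imp_bounded compact_continuous_image) auto
qed (use assms in auto)

text \<open>Both factors are bounded, so an increment of the product is controlled by the increments
  of the factors, which gives absolute continuity. The ordinary product rule holds off the union of
  the two null sets.\<close>

lemma L1_deriv_bilinear:
  fixes prod :: "'a::euclidean_space \<Rightarrow> 'b::euclidean_space \<Rightarrow> 'c::euclidean_space"
  assumes bb: "bounded_bilinear prod" and f: "L1_deriv a b f f'" and g: "L1_deriv a b g g'"
  shows "L1_deriv a b (\<lambda>x. prod (f x) (g x)) (\<lambda>x. prod (f x) (g' x) + prod (f' x) (g x))"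
proof -
  interpret bounded_bilinear prod by (rule bb)
  obtain K where K: "K > 0" "\<And>x y. norm (prod x y) \<le> norm x * norm y * K" using pos_bounded by blast
  have cf: "continuous_on {a..b} f" and cg: "continuous_on {a..b} g"
    using f g by (auto intro: L1_deriv_continuous)
  obtain F where F: "F > 0" "\<And>x. x \<in> {a..b} \<Longrightarrow> norm (f x) \<le> F"
    using compact_imp_bounded[OF compact_continuous_image[OF cf]] by (auto simp: bounded_pos)
  obtain G where G: "G > 0" "\<And>x. x \<in> {a..b} \<Longrightarrow> norm (g x) \<le> G"
    using compact_imp_bounded[OF compact_continuous_image[OF cg]] by (auto simp: bounded_pos)
  obtain N1 where N1: "negligible N1" "\<And>x. x \<in> {a<..<b} - N1 \<Longrightarrow> (f has_vector_derivative f' x) (at x)"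
    using L1_deriv_has_vector_derivative[OF f] by blast
  obtain N2 where N2: "negligible N2" "\<And>x. x \<in> {a<..<b} - N2 \<Longrightarrow> (g has_vector_derivative g' x) (at x)"
    using L1_deriv_has_vector_derivative[OF g] by blast
  show ?thesis
  proof (rule L1_derivI)
    show "negligible (N1 \<union> N2)" using N1 N2 by (simp add: negligible_Un)
    show "((\<lambda>x. prod (f x) (g x)) has_vector_derivative prod (f x) (g' x) + prod (f' x) (g x)) (at x)"
      if "x \<in> {a<..<b} - (N1 \<union> N2)" for x
      using N1(2)[of x] N2(2)[of x] that by (intro has_vector_derivative) auto
    have f': "f' absolutely_integrable_on {a..b}" and g': "g' absolutely_integrable_on {a..b}"
      using f g by (auto intro: L1_deriv_abs_integrable)
    have "(\<lambda>x. prod (f' x) (g x)) absolutely_integrable_on {a..b}"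
      using absolutely_integrable_continuous_bilinear[OF flip cg f'] .
    then show "(\<lambda>x. prod (f x) (g' x) + prod (f' x) (g x)) absolutely_integrable_on {a..b}"
      using absolutely_integrable_continuous_bilinear[OF bb cf g'] by (intro set_integral_add) auto
    show "abs_continuous_on a b (\<lambda>x. prod (f x) (g x))"
    proof (rule abs_continuous_on_dominated[OF L1_deriv_abs_continuous[OF f] L1_deriv_abs_continuous[OF g]])
      show "0 \<le> K * (F + G)" using K F G by simp
      fix u v assume uv: "a \<le> u" "u \<le> v" "v \<le> b"
      have "prod (f v) (g v) - prod (f u) (g u) = prod (f v - f u) (g v) + prod (f u) (g v - g u)"
        by (simp add: diff_left diff_right)
      also have "norm \<dots> \<le> norm (f v - f u) * norm (g v) * K + norm (f u) * norm (g v - g u) * K"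
        by (rule norm_triangle_mono[OF K(2) K(2)])
      also have "\<dots> \<le> norm (f v - f u) * G * K + F * norm (g v - g u) * K"
        using uv K(1) F G by (intro add_mono mult_right_mono mult_left_mono) auto
      also have "\<dots> \<le> norm (f v - f u) * (F + G) * K + (F + G) * norm (g v - g u) * K"
        using K(1) F G by (intro add_mono mult_right_mono mult_left_mono) auto
      also have "\<dots> = K * (F + G) * (norm (f v - f u) + norm (g v - g u))" by (simp add: algebra_simps)
      finally show "norm (prod (f v) (g v) - prod (f u) (g u)) \<le> K * (F + G) * (norm (f v - f u) + norm (g v - g u))" .
    qed auto
  qed
qed

lemma L1_deriv_exp:
  fixes f :: "real \<Rightarrow> real"
  assumes f: "L1_deriv a b f f'"
  shows "L1_deriv a b (\<lambda>x. exp (f x)) (\<lambda>x. exp (f x) * f' x)"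
proof -
  have cf: "continuous_on {a..b} f" using f by (rule L1_deriv_continuous)
  obtain F where F: "F > 0" "\<And>x. x \<in> {a..b} \<Longrightarrow> norm (f x) \<le> F"
    using compact_imp_bounded[OF compact_continuous_image[OF cf]] by (auto simp: bounded_pos)
  obtain N1 where N1: "negligible N1" "\<And>x. x \<in> {a<..<b} - N1 \<Longrightarrow> (f has_vector_derivative f' x) (at x)"
    using L1_deriv_has_vector_derivative[OF f] by blast
  have Lip: "\<bar>exp s - exp t\<bar> \<le> exp F * \<bar>s - t\<bar>" if "\<bar>s\<bar> \<le> F" "\<bar>t\<bar> \<le> F" for s t :: real
  proof -
    have "norm (exp s - exp t) \<le> exp F * norm (s - t)"
    proof (rule field_differentiable_bound)
      show "convex {-F..F}" by simp
      show "(exp has_field_derivative exp z) (at z within {-F..F})" if "z \<in> {-F..F}" for z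
        by (rule DERIV_subset[OF DERIV_exp]) auto
    qed (use that in auto)
    then show ?thesis by simp
  qed
  show ?thesis
  proof (rule L1_derivI[OF _ _ N1(1)])
    show "((\<lambda>x. exp (f x)) has_vector_derivative exp (f x) * f' x) (at x)" if "x \<in> {a<..<b} - N1" for x
      using N1(2)[OF that] unfolding has_real_derivative_iff_has_vector_derivative[symmetric]
      by (auto intro!: derivative_eq_intros)
    show "(\<lambda>x. exp (f x) * f' x) absolutely_integrable_on {a..b}"
      by (rule absolutely_integrable_continuous_bilinear[OF bounded_bilinear_mult])
        (use L1_deriv_abs_integrable[OF f] cf in \<open>auto intro!: continuous_intros\<close>)
    show "abs_continuous_on a b (\<lambda>x. exp (f x))"
    proof (rule abs_continuous_on_dominated[OF L1_deriv_abs_continuous[OF f] L1_deriv_abs_continuous[OF f], of "exp F"])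
      fix u v assume uv: "a \<le> u" "u \<le> v" "v \<le> b"
      have "norm (exp (f v) - exp (f u)) \<le> exp F * \<bar>f v - f u\<bar>"
        using Lip[of "f v" "f u"] F uv by auto
      also have "\<dots> \<le> exp F * (norm (f v - f u) + norm (f v - f u))" by simp
      finally show "norm (exp (f v) - exp (f u)) \<le> exp F * (norm (f v - f u) + norm (f v - f u))" .
    qed auto
  qed
qed

lemma L1_deriv_mono:
  fixes f :: "real \<Rightarrow> real"
  assumes f: "L1_deriv a b f f'" and "\<And>x. x \<in> {a..b} \<Longrightarrow> f' x \<le> 0" "x \<in> {a..b}"
  shows "f x \<le> f a"
proof -
  have "f' integrable_on {a..x}"
    using integrable_subinterval_real[OF L1_deriv_integrable[OF f], of a x] assms by auto
  then have "integral {a..x} f' \<le> integral {a..x} (\<lambda>_. 0)"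
    by (rule integral_le) (use assms in auto)
  then show ?thesis using L1_derivD[OF f assms(3)] by auto
qed

text \<open>Integrating factor: let \<open>R\<close> be the right-hand side of the assumed
  inequality and \<open>G\<close> the primitive of \<open>g\<close>. Then
  \<open>R * exp (- G)\<close> has derivative \<open>exp (- G) * g * (u - R)\<close>, which is
  nonpositive, and the product rule above covers merely integrable \<open>g\<close>.\<close>

lemma Gronwall:
  fixes u g :: "real \<Rightarrow> real"
  assumes u: "continuous_on {a..b} u" and g: "g absolutely_integrable_on {a..b}" "\<And>x. x \<in> {a..b} \<Longrightarrow> 0 \<le> g x"
    and le: "\<And>x. x \<in> {a..b} \<Longrightarrow> u x \<le> c + integral {a..x} (\<lambda>t. g t * u t)"
    and x: "x \<in> {a..b}"
  shows "u x \<le> c * exp (integral {a..x} g)"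
proof -
  define R where "R x = c + integral {a..x} (\<lambda>t. g t * u t)" for x
  define G where "G x = 0 + integral {a..x} g" for x
  have "(\<lambda>t. g t * u t) absolutely_integrable_on {a..b}"
    using absolutely_integrable_continuous_bilinear[OF bounded_bilinear_mult u g(1)] by (simp add: mult.commute)
  then have R: "L1_deriv a b R (\<lambda>t. g t * u t)"
    unfolding R_def by (rule L1_deriv_indefinite_integral)
  have G: "L1_deriv a b G g" unfolding G_def by (rule L1_deriv_indefinite_integral[OF g(1)])
  have "L1_deriv a b (\<lambda>x. R x * exp (- G x)) (\<lambda>x. R x * (exp (- G x) * - g x) + g x * u x * exp (- G x))"
    by (rule L1_deriv_bilinear[OF bounded_bilinear_mult R L1_deriv_exp[OF L1_deriv_minus[OF G]]])
  then have "R x * exp (- G x) \<le> R a * exp (- G a)"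
  proof (rule L1_deriv_mono[OF _ _ x])
    fix x assume x: "x \<in> {a..b}"
    have "R x * (exp (- G x) * - g x) + g x * u x * exp (- G x) = exp (- G x) * g x * (u x - R x)"
      by (simp add: algebra_simps)
    also have "\<dots> \<le> 0" using le[OF x] g(2)[OF x] by (intro mult_nonneg_nonpos) (auto simp: R_def)
    finally show "R x * (exp (- G x) * - g x) + g x * u x * exp (- G x) \<le> 0" .
  qed
  then have "R x \<le> c * exp (G x)" by (simp add: R_def G_def exp_minus field_simps)
  moreover have "u x \<le> R x" using le[OF x] by (simp add: R_def)
  ultimately show ?thesis by (simp add: G_def)
qed

section \<open>Linear differential equations with integrable coefficients\<close>

lemma has_integral_reflect_interval:
  fixes f :: "real \<Rightarrow> 'a::euclidean_space"
  assumes "(f has_integral i) {u..v}"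
  shows "((\<lambda>s. f (c - s)) has_integral i) {c - v..c - u}"
proof -
  have "((\<lambda>x. f ((-1) *\<^sub>R x + c)) has_integral (1 / \<bar>-1\<bar> ^ DIM(real)) *\<^sub>R i)
          ((\<lambda>x. (1 / (-1)) *\<^sub>R x + - ((1 / (-1)) *\<^sub>R c)) ` cbox u v)"
    by (rule has_integral_affinity) (use assms in auto)
  moreover have "(\<lambda>x. (1 / (-1)) *\<^sub>R x + - ((1 / (-1)) *\<^sub>R c)) ` cbox u v = {c - v..c - u}"
  proof -
    have "(\<lambda>x. (1 / (-1)) *\<^sub>R x + - ((1 / (-1)) *\<^sub>R c)) = (\<lambda>x. c - x)" by auto
    then show ?thesis by simp
  qed
  ultimately show ?thesis by simp
qed

lemma L1_deriv_reflect:
  assumes f: "L1_deriv 0 c f f'"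
  shows "L1_deriv 0 c (\<lambda>s. f (c - s)) (\<lambda>s. - f' (c - s))"
proof -
  have int: "(\<lambda>s. h (c - s)) integrable_on {0..c}" if "h integrable_on {0..c}" for h :: "real \<Rightarrow> 'b::euclidean_space"
    using has_integral_reflect_interval[OF integrable_integral[OF that], of c] by (auto simp: integrable_on_def)
  have "(\<lambda>s. f' (c - s)) absolutely_integrable_on {0..c}"
    using L1_deriv_abs_integrable[OF f] int[of f'] int[of "\<lambda>x. norm (f' x)"]
    unfolding absolutely_integrable_on_def by auto
  then have "(\<lambda>s. - f' (c - s)) absolutely_integrable_on {0..c}"
    unfolding absolutely_integrable_on_def by (auto simp: integrable_neg)
  moreover have "f (c - x) = f (c - 0) + integral {0..x} (\<lambda>s. - f' (c - s))" if x: "x \<in> {0..c}" for x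
  proof -
    have "f' integrable_on {c-x..c}"
      using integrable_subinterval_real[OF L1_deriv_integrable[OF f], of "c - x" c] x by auto
    from has_integral_reflect_interval[OF integrable_integral[OF this], of c]
    have "integral {0..x} (\<lambda>s. f' (c - s)) = integral {c-x..c} f'" by (simp add: integral_unique)
    moreover have "f c - f (c - x) = integral {c-x..c} f'"
      by (rule L1_deriv_diff_eq_integral[OF f]) (use x in auto)
    ultimately show ?thesis by (simp add: algebra_simps)
  qed
  ultimately show ?thesis unfolding L1_deriv_def by (intro conjI ballI)
qed

text \<open>Caratheodory conditions for a linear system. Measurability is asked for constant vectors
  only; expansion in a basis extends it to continuous functions inserted for the vector.\<close>

definition L1_linear_field ::
  "real \<Rightarrow> real \<Rightarrow> (real \<Rightarrow> 'a::euclidean_space \<Rightarrow> 'a) \<Rightarrow> (real \<Rightarrow> real) \<Rightarrow> bool" where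
  "L1_linear_field a b A g \<longleftrightarrow> g absolutely_integrable_on {a..b} \<and>
     (\<forall>t\<in>{a..b}. linear (A t) \<and> (\<forall>v. norm (A t v) \<le> g t * norm v)) \<and>
     (\<forall>v. (\<lambda>t. A t v) \<in> borel_measurable (lebesgue_on {a..b}))"

context
  fixes a b :: real and A :: "real \<Rightarrow> 'a::euclidean_space \<Rightarrow> 'a" and g :: "real \<Rightarrow> real"
  assumes A: "L1_linear_field a b A g"
begin

lemma L1_linear_fieldD:
  shows "g absolutely_integrable_on {a..b}"
    and "t \<in> {a..b} \<Longrightarrow> linear (A t)"
    and "t \<in> {a..b} \<Longrightarrow> norm (A t v) \<le> g t * norm v"
    and "(\<lambda>t. A t v) \<in> borel_measurable (lebesgue_on {a..b})"
  using A unfolding L1_linear_field_def by blast+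

lemma L1_linear_field_nonneg: "t \<in> {a..b} \<Longrightarrow> 0 \<le> g t"
proof -
  assume t: "t \<in> {a..b}"
  obtain e :: 'a where e: "e \<in> Basis" using nonempty_Basis by blast
  have "0 \<le> norm (A t e)" by simp
  also have "\<dots> \<le> g t * norm e" using L1_linear_fieldD(3)[OF t] .
  also have "\<dots> = g t" using e by simp
  finally show ?thesis .
qed

lemma L1_linear_field_integrable:
  assumes u: "continuous_on {a..b} u"
  shows "(\<lambda>t. A t (u t)) absolutely_integrable_on {a..b}"
proof -
  have lb: "{a..b} \<in> sets lebesgue" using fmeasurableD[OF lmeasurable_cbox[of a b]] by simp
  have "(\<lambda>t. A t i) absolutely_integrable_on {a..b}" if "i \<in> Basis" for i
  proof (rule measurable_bounded_by_integrable_imp_absolutely_integrable[OF L1_linear_fieldD(4) lb])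
    show "g integrable_on {a..b}" using L1_linear_fieldD(1) set_lebesgue_integral_eq_integral(1) by blast
    show "norm (A t i) \<le> g t" if "t \<in> {a..b}" for t
      using L1_linear_fieldD(3)[OF that, of i] \<open>i \<in> Basis\<close> by simp
  qed
  then have "(\<lambda>t. (u t \<bullet> i) *\<^sub>R A t i) absolutely_integrable_on {a..b}" if "i \<in> Basis" for i
    using that u by (intro absolutely_integrable_continuous_bilinear[OF bounded_bilinear_scaleR] continuous_intros) auto
  then have *: "(\<lambda>t. \<Sum>i\<in>Basis. (u t \<bullet> i) *\<^sub>R A t i) absolutely_integrable_on {a..b}"
    by (intro absolutely_integrable_sum) auto
  show ?thesis
  proof (rule absolutely_integrable_spike[OF * negligible_empty])
    fix t assume "t \<in> {a..b} - {}"
    then have lin: "linear (A t)" using L1_linear_fieldD(2) by auto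
    have "A t (u t) = A t (\<Sum>i\<in>Basis. (u t \<bullet> i) *\<^sub>R i)" by (simp add: euclidean_representation)
    also have "\<dots> = (\<Sum>i\<in>Basis. (u t \<bullet> i) *\<^sub>R A t i)" by (simp add: linear_sum[OF lin] linear_scale[OF lin])
    finally show "A t (u t) = (\<Sum>i\<in>Basis. (u t \<bullet> i) *\<^sub>R A t i)" .
  qed
qed

lemma L1_linear_field_norm_integral:
  assumes u: "continuous_on {a..b} u" and x: "x \<in> {a..b}"
    and w: "continuous_on {a..b} w" and le: "\<And>t. t \<in> {a..x} \<Longrightarrow> norm (u t) \<le> w t"
  shows "norm (integral {a..x} (\<lambda>t. A t (u t))) \<le> integral {a..x} (\<lambda>t. g t * w t)"
proof (rule integral_norm_bound_integral)
  have "(\<lambda>t. A t (u t)) integrable_on {a..b}"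
    using L1_linear_field_integrable[OF u] set_lebesgue_integral_eq_integral(1) by blast
  then show "(\<lambda>t. A t (u t)) integrable_on {a..x}"
    by (rule integrable_subinterval_real) (use x in auto)
  have "(\<lambda>t. w t * g t) absolutely_integrable_on {a..b}"
    using absolutely_integrable_continuous_bilinear[OF bounded_bilinear_mult w L1_linear_fieldD(1)] .
  then have "(\<lambda>t. g t * w t) integrable_on {a..b}"
    using set_lebesgue_integral_eq_integral(1) by (simp add: mult.commute) blast
  then show "(\<lambda>t. g t * w t) integrable_on {a..x}"
    by (rule integrable_subinterval_real) (use x in auto)
  fix t assume t: "t \<in> {a..x}"
  then have "norm (A t (u t)) \<le> g t * norm (u t)" using L1_linear_fieldD(3) x by auto
  also have "\<dots> \<le> g t * w t" using L1_linear_field_nonneg[of t] t x le by (intro mult_left_mono) auto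
  finally show "norm (A t (u t)) \<le> g t * w t" .
qed

lemma linear_ode_bound:
  assumes u: "continuous_on {a..b} u"
    and eq: "\<And>x. x \<in> {a..b} \<Longrightarrow> u x = h x + integral {a..x} (\<lambda>t. A t (u t))"
    and h: "\<And>x. x \<in> {a..b} \<Longrightarrow> norm (h x) \<le> c" and x: "x \<in> {a..b}"
  shows "norm (u x) \<le> c * exp (integral {a..x} g)"
proof (rule Gronwall[of a b "\<lambda>x. norm (u x)" g c x])
  show "continuous_on {a..b} (\<lambda>x. norm (u x))" using u by (intro continuous_intros)
  fix x assume x: "x \<in> {a..b}"
  have "norm (u x) \<le> norm (h x) + norm (integral {a..x} (\<lambda>t. A t (u t)))"
    using eq[OF x] norm_triangle_ineq by metis
  also have "\<dots> \<le> c + integral {a..x} (\<lambda>t. g t * norm (u t))"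
    using h[OF x] by (intro add_mono L1_linear_field_norm_integral u x continuous_intros) auto
  finally show "norm (u x) \<le> c + integral {a..x} (\<lambda>t. g t * norm (u t))" .
qed (use x L1_linear_fieldD(1) L1_linear_field_nonneg in auto)

text \<open>Picard iteration. The weight \<open>E\<close> is the exponential of twice the primitive
  of \<open>g\<close>, and the integral of \<open>g * E\<close> is \<open>(E - 1) / 2\<close>. So
  each step halves the weighted difference of iterates, and convergence is uniform on the whole
  interval without subdividing it.\<close>

lemma linear_ode_exists:
  assumes h: "continuous_on {a..b} h"
  obtains u where "continuous_on {a..b} u"
    "\<And>x. x \<in> {a..b} \<Longrightarrow> u x = h x + integral {a..x} (\<lambda>t. A t (u t))"
proof -
  define U where "U = rec_nat h (\<lambda>n u x. h x + integral {a..x} (\<lambda>t. A t (u t)))"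
  have U0: "U 0 = h" and US: "U (Suc n) = (\<lambda>x. h x + integral {a..x} (\<lambda>t. A t (U n t)))" for n
    by (auto simp: U_def)
  have intb: "(\<lambda>t. A t (v t)) integrable_on {a..b}" if "continuous_on {a..b} v" for v
    using L1_linear_field_integrable[OF that] set_lebesgue_integral_eq_integral(1) by blast
  have intx: "(\<lambda>t. A t (v t)) integrable_on {a..x}" if "continuous_on {a..b} v" "x \<in> {a..b}" for v x
    by (rule integrable_subinterval_real[OF intb[OF that(1)]]) (use that in auto)
  have contU: "continuous_on {a..b} (U n)" for n
  proof (induction n)
    case 0 then show ?case using h by (simp add: U0)
  next
    case (Suc n) then show ?case unfolding US
      by (intro continuous_intros h indefinite_integral_continuous_1 intb)
  qed
  define D where "D n x = U (Suc n) x - U n x" for n x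
  have contD: "continuous_on {a..b} (D n)" for n
    unfolding D_def by (intro continuous_intros contU)
  have DS: "D (Suc n) x = integral {a..x} (\<lambda>t. A t (D n t))" if x: "x \<in> {a..b}" for n x
  proof -
    have "D (Suc n) x = integral {a..x} (\<lambda>t. A t (U (Suc n) t)) - integral {a..x} (\<lambda>t. A t (U n t))"
      by (simp add: D_def US[of "Suc n"] US[of n])
    also have "\<dots> = integral {a..x} (\<lambda>t. A t (U (Suc n) t) - A t (U n t))"
      by (rule integral_diff[symmetric]) (intro intx contU x)+
    also have "\<dots> = integral {a..x} (\<lambda>t. A t (D n t))"
      by (rule integral_cong) (use x linear_diff[OF L1_linear_fieldD(2)] in \<open>auto simp: D_def\<close>)
    finally show ?thesis .
  qed
  define G where "G x = 2 * (0 + integral {a..x} g)" for x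
  define E where "E x = exp (G x)" for x
  have G: "L1_deriv a b G (\<lambda>x. 2 * g x)"
    unfolding G_def by (rule L1_deriv_linear[OF L1_deriv_indefinite_integral[OF L1_linear_fieldD(1)] bounded_linear_mult_right])
  have E: "L1_deriv a b E (\<lambda>x. E x * (2 * g x))"
    using L1_deriv_exp[OF G] unfolding E_def .
  have contE: "continuous_on {a..b} E" using E by (rule L1_deriv_continuous)
  have gE: "integral {a..x} (\<lambda>t. g t * E t) = (E x - 1) / 2" if x: "x \<in> {a..b}" for x
  proof -
    have "E x = E a + integral {a..x} (\<lambda>x. E x * (2 * g x))" using L1_derivD[OF E x] .
    also have "(\<lambda>x. E x * (2 * g x)) = (\<lambda>x. 2 * (g x * E x))" by (auto simp: algebra_simps)
    also have "E a = 1" by (simp add: E_def G_def)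
    finally show ?thesis by simp
  qed
  have E1: "1 \<le> E x" if x: "x \<in> {a..b}" for x
  proof -
    have "0 \<le> integral {a..x} g"
    proof (rule integral_nonneg)
      show "g integrable_on {a..x}"
        using integrable_subinterval_real[of g a b a x] L1_linear_fieldD(1) set_lebesgue_integral_eq_integral(1) x by auto
    qed (use L1_linear_field_nonneg x in auto)
    then show ?thesis by (simp add: E_def G_def)
  qed
  obtain K where K: "K > 0" "\<And>x. x \<in> {a..b} \<Longrightarrow> norm (D 0 x) \<le> K"
    using compact_imp_bounded[OF compact_continuous_image[OF contD[of 0]]] by (auto simp: bounded_pos)
  have Dn: "norm (D n x) \<le> K * (1/2) ^ n * E x" if "x \<in> {a..b}" for n x
    using that
  proof (induction n arbitrary: x)
    case 0
    have "norm (D 0 x) \<le> K * 1" using K(2)[OF 0] by simp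
    also have "\<dots> \<le> K * E x" using K E1[OF 0] by (intro mult_left_mono) auto
    finally show ?case by simp
  next
    case (Suc n)
    have "norm (D (Suc n) x) \<le> integral {a..x} (\<lambda>t. g t * (K * (1/2) ^ n * E t))"
      unfolding DS[OF Suc.prems]
      by (rule L1_linear_field_norm_integral[OF contD Suc.prems]) (use Suc contE in \<open>auto intro!: continuous_intros\<close>)
    also have "(\<lambda>t. g t * (K * (1/2) ^ n * E t)) = (\<lambda>t. (K * (1/2) ^ n) * (g t * E t))" by (auto simp: algebra_simps)
    also have "integral {a..x} \<dots> = (K * (1/2) ^ n) * ((E x - 1) / 2)"
      using gE[OF Suc.prems] by simp
    also have "\<dots> \<le> (K * (1/2) ^ n) * (E x / 2)" using K by (intro mult_left_mono) auto
    finally show ?case by simp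
  qed
  obtain B where B: "\<And>x. x \<in> {a..b} \<Longrightarrow> norm (E x) \<le> B"
    using compact_imp_bounded[OF compact_continuous_image[OF contE]] unfolding bounded_iff by blast
  have DB: "norm (D n x) \<le> (K * B) * (1/2) ^ n" if "x \<in> {a..b}" for n x
  proof -
    have "norm (D n x) \<le> K * (1/2) ^ n * E x" using Dn[OF that] .
    also have "E x \<le> B" using B[OF that] by simp
    then have "K * (1/2) ^ n * E x \<le> K * (1/2) ^ n * B" using K by (intro mult_left_mono) auto
    finally show ?thesis by (simp add: mult_ac)
  qed
  define u where "u x = h x + (\<Sum>i. D i x)" for x
  have "uniform_limit {a..b} (\<lambda>n x. \<Sum>i<n. D i x) (\<lambda>x. \<Sum>i. D i x) sequentially"
    by (rule Weierstrass_m_test[OF DB]) (auto intro!: summable_mult summable_geometric)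
  then have "uniform_limit {a..b} (\<lambda>n x. h x + (\<Sum>i<n. D i x)) u sequentially"
    unfolding u_def by (intro uniform_limit_add uniform_limit_const)
  moreover have "h x + (\<Sum>i<n. D i x) = U n x" for n x
    unfolding D_def by (subst sum_lessThan_telescope) (simp add: U0)
  ultimately have lim: "uniform_limit {a..b} U u sequentially" by simp
  have contu: "continuous_on {a..b} u"
    by (rule uniform_limit_theorem[OF _ lim]) (use contU in auto)
  have "u x = h x + integral {a..x} (\<lambda>t. A t (u t))" if x: "x \<in> {a..b}" for x
  proof -
    have "(\<lambda>n. U (Suc n) x) \<longlonglongrightarrow> h x + integral {a..x} (\<lambda>t. A t (u t))"
      unfolding US
    proof (intro tendsto_add tendsto_const)
      show "(\<lambda>n. integral {a..x} (\<lambda>t. A t (U n t))) \<longlonglongrightarrow> integral {a..x} (\<lambda>t. A t (u t))"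
      proof (rule tendstoI)
        fix e :: real assume "e > 0"
        define I where "I = integral {a..x} g"
        have I: "I \<ge> 0" unfolding I_def using E1[OF x] by (simp add: E_def G_def)
        define e' where "e' = e / (I + 1)"
        have e': "e' > 0" using \<open>e > 0\<close> I by (simp add: e'_def)
        have "\<forall>\<^sub>F n in sequentially. \<forall>t\<in>{a..b}. dist (U n t) (u t) < e'"
          using uniform_limitD[OF lim e'] .
        then show "\<forall>\<^sub>F n in sequentially. dist (integral {a..x} (\<lambda>t. A t (U n t))) (integral {a..x} (\<lambda>t. A t (u t))) < e"
        proof eventually_elim
          case (elim n)
          have "integral {a..x} (\<lambda>t. A t (U n t)) - integral {a..x} (\<lambda>t. A t (u t)) = integral {a..x} (\<lambda>t. A t (U n t) - A t (u t))"
            by (rule integral_diff[symmetric]) (intro intx contU contu x)+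
          also have "\<dots> = integral {a..x} (\<lambda>t. A t (U n t - u t))"
            by (rule integral_cong) (use x linear_diff[OF L1_linear_fieldD(2)] in auto)
          also have "norm \<dots> \<le> integral {a..x} (\<lambda>t. g t * e')"
            by (rule L1_linear_field_norm_integral[OF _ x])
              (use x elim contU contu in \<open>auto intro!: continuous_intros simp: dist_norm less_imp_le\<close>)
          also have "\<dots> = I * e'" by (simp add: I_def)
          also have "\<dots> < (I + 1) * e'" using e' by simp
          also have "\<dots> = e" using I by (simp add: e'_def)
          finally show ?case by (simp add: dist_norm)
        qed
      qed
    qed
    moreover have "(\<lambda>n. U (Suc n) x) \<longlonglongrightarrow> u x"
      using tendsto_uniform_limitI[OF lim x] by (rule LIMSEQ_Suc)
    ultimately show ?thesis by (rule LIMSEQ_unique[symmetric])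
  qed
  then show thesis using that contu by blast
qed

lemma linear_ode_L1_exists:
  assumes r: "r absolutely_integrable_on {a..b}"
  obtains u where "u a = u0" "L1_deriv a b u (\<lambda>t. A t (u t) + r t)"
proof (cases "a \<le> b")
  case False
  then have "L1_deriv a b (\<lambda>_. u0) (\<lambda>t. A t u0 + r t)" by (simp add: L1_deriv_def)
  then show ?thesis using that[of "\<lambda>_. u0"] by simp
next
  case True
  have "L1_deriv a b (\<lambda>x. u0 + integral {a..x} r) r" by (rule L1_deriv_indefinite_integral[OF r])
  then have "continuous_on {a..b} (\<lambda>x. u0 + integral {a..x} r)" by (rule L1_deriv_continuous)
  then obtain u where u: "continuous_on {a..b} u"
    and eq: "\<And>x. x \<in> {a..b} \<Longrightarrow> u x = (u0 + integral {a..x} r) + integral {a..x} (\<lambda>t. A t (u t))"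
    using linear_ode_exists by blast
  have ua: "u a = u0" using eq[of a] True by simp
  have Au: "(\<lambda>t. A t (u t)) absolutely_integrable_on {a..b}" by (rule L1_linear_field_integrable[OF u])
  show ?thesis
  proof (rule that[where u=u])
    show "u a = u0" by (rule ua)
    show "L1_deriv a b u (\<lambda>t. A t (u t) + r t)"
      unfolding L1_deriv_def
    proof (intro conjI ballI)
      show "(\<lambda>t. A t (u t) + r t) absolutely_integrable_on {a..b}" using Au r by (rule set_integral_add)
      fix x assume x: "x \<in> {a..b}"
      have "(\<lambda>t. A t (u t)) integrable_on {a..x}" "r integrable_on {a..x}"
        using Au r set_lebesgue_integral_eq_integral(1) x
        by (auto intro!: integrable_subinterval_real[of _ a b a x])
      then have "integral {a..x} (\<lambda>t. A t (u t) + r t) = integral {a..x} (\<lambda>t. A t (u t)) + integral {a..x} r"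
        by (rule integral_add)
      then show "u x = u a + integral {a..x} (\<lambda>t. A t (u t) + r t)"
        using eq[OF x] ua by simp
    qed
  qed
qed

lemma linear_ode_L1_bound:
  assumes u: "L1_deriv a b u (\<lambda>t. A t (u t) + r t)" and r: "r absolutely_integrable_on {a..b}"
    and R: "\<And>x. x \<in> {a..b} \<Longrightarrow> norm (integral {a..x} r) \<le> R" and x: "x \<in> {a..b}"
  shows "norm (u x) \<le> (norm (u a) + R) * exp (integral {a..x} g)"
proof (rule linear_ode_bound[OF L1_deriv_continuous[OF u] _ _ x])
  fix x assume x: "x \<in> {a..b}"
  have Au: "(\<lambda>t. A t (u t)) absolutely_integrable_on {a..b}"
    by (rule L1_linear_field_integrable[OF L1_deriv_continuous[OF u]])
  have "(\<lambda>t. A t (u t)) integrable_on {a..x}" "r integrable_on {a..x}"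
    using Au r set_lebesgue_integral_eq_integral(1) x
    by (auto intro!: integrable_subinterval_real[of _ a b a x])
  then have "integral {a..x} (\<lambda>t. A t (u t) + r t) = integral {a..x} (\<lambda>t. A t (u t)) + integral {a..x} r"
    by (rule integral_add)
  then show "u x = (u a + integral {a..x} r) + integral {a..x} (\<lambda>t. A t (u t))"
    using L1_derivD[OF u x] by (simp add: add_ac)
  show "norm (u a + integral {a..x} r) \<le> norm (u a) + R"
    using R[OF x] by (rule norm_triangle_le[OF add_left_mono])
qed

lemma linear_ode_L1_unique:
  assumes u: "L1_deriv a b u (\<lambda>t. A t (u t))" and v: "L1_deriv a b v (\<lambda>t. A t (v t))"
    and "u a = v a" and x: "x \<in> {a..b}"
  shows "u x = v x"
proof -
  have "L1_deriv a b (\<lambda>x. u x - v x) (\<lambda>t. A t (u t) - A t (v t))" by (rule L1_deriv_diff[OF u v])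
  then have d: "L1_deriv a b (\<lambda>x. u x - v x) (\<lambda>t. A t (u t - v t) + 0)"
    by (rule L1_deriv_cong') (use linear_diff[OF L1_linear_fieldD(2)] in auto)
  have "norm (u x - v x) \<le> (norm (u a - v a) + 0) * exp (integral {a..x} g)"
    by (rule linear_ode_L1_bound[OF d _ _ x]) auto
  then show ?thesis using assms(3) by simp
qed

end

section \<open>Complex matrices\<close>

lemma norm_power2_vec: "(norm (x :: 'a::real_normed_vector ^ 'n))\<^sup>2 = (\<Sum>i\<in>UNIV. (norm (x $ i))\<^sup>2)"
  by (simp add: norm_vec_def L2_set_def sum_nonneg)

lemma norm_power2_matrix:
  "(norm (A :: complex ^ 'n ^ 'm))\<^sup>2 = (\<Sum>i\<in>UNIV. \<Sum>j\<in>UNIV. (cmod (A $ i $ j))\<^sup>2)"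
  by (simp add: norm_power2_vec)

lemma norm_sum_mult_power2_le:
  fixes f g :: "'k \<Rightarrow> complex"
  shows "(cmod (\<Sum>k\<in>I. f k * g k))\<^sup>2 \<le> (\<Sum>k\<in>I. (cmod (f k))\<^sup>2) * (\<Sum>k\<in>I. (cmod (g k))\<^sup>2)"
proof -
  have "cmod (\<Sum>k\<in>I. f k * g k) \<le> (\<Sum>k\<in>I. cmod (f k) * cmod (g k))"
    by (rule sum_norm_le) (simp add: norm_mult)
  then have "(cmod (\<Sum>k\<in>I. f k * g k))\<^sup>2 \<le> (\<Sum>k\<in>I. cmod (f k) * cmod (g k))\<^sup>2"
    by (intro power_mono) auto
  also have "\<dots> \<le> (\<Sum>k\<in>I. (cmod (f k))\<^sup>2) * (\<Sum>k\<in>I. (cmod (g k))\<^sup>2)"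
    by (rule Cauchy_Schwarz_ineq_sum)
  finally show ?thesis .
qed

lemma norm_matrix_mult_le:
  fixes A :: "complex ^ 'n ^ 'm" and B :: "complex ^ 'p ^ 'n"
  shows "norm (A ** B) \<le> norm A * norm B"
proof (rule power2_le_imp_le)
  have "(norm (A ** B))\<^sup>2 = (\<Sum>i\<in>UNIV. \<Sum>j\<in>UNIV. (cmod (\<Sum>k\<in>UNIV. A $ i $ k * B $ k $ j))\<^sup>2)"
    unfolding norm_power2_matrix by (simp add: matrix_matrix_mult_def)
  also have "\<dots> \<le> (\<Sum>i\<in>UNIV. \<Sum>j\<in>UNIV. (\<Sum>k\<in>UNIV. (cmod (A $ i $ k))\<^sup>2) * (\<Sum>k\<in>UNIV. (cmod (B $ k $ j))\<^sup>2))"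
    by (intro sum_mono norm_sum_mult_power2_le)
  also have "\<dots> = (\<Sum>i\<in>UNIV. \<Sum>k\<in>UNIV. (cmod (A $ i $ k))\<^sup>2) * (\<Sum>j\<in>UNIV. \<Sum>k\<in>UNIV. (cmod (B $ k $ j))\<^sup>2)"
    by (simp add: sum_product)
  also have "(\<Sum>j\<in>UNIV. \<Sum>k\<in>UNIV. (cmod (B $ k $ j))\<^sup>2) = (norm B)\<^sup>2"
    unfolding norm_power2_matrix by (rule sum.swap)
  finally show "(norm (A ** B))\<^sup>2 \<le> (norm A * norm B)\<^sup>2"
    by (simp add: norm_power2_matrix power_mult_distrib)
qed simp

lemma norm_matrix_vector_mult_le:
  fixes A :: "complex ^ 'n ^ 'm"
  shows "norm (A *v x) \<le> norm A * norm x"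
proof (rule power2_le_imp_le)
  have "(norm (A *v x))\<^sup>2 = (\<Sum>i\<in>UNIV. (cmod (\<Sum>k\<in>UNIV. A $ i $ k * x $ k))\<^sup>2)"
    unfolding norm_power2_vec by (simp add: matrix_vector_mult_def)
  also have "\<dots> \<le> (\<Sum>i\<in>UNIV. (\<Sum>k\<in>UNIV. (cmod (A $ i $ k))\<^sup>2) * (\<Sum>k\<in>UNIV. (cmod (x $ k))\<^sup>2))"
    by (intro sum_mono norm_sum_mult_power2_le)
  finally show "(norm (A *v x))\<^sup>2 \<le> (norm A * norm x)\<^sup>2"
    by (simp add: norm_power2_matrix norm_power2_vec power_mult_distrib sum_distrib_right)
qed simp

lemma bounded_bilinear_matrix_mult:
  "bounded_bilinear ((**) :: complex ^ 'n ^ 'm \<Rightarrow> complex ^ 'p ^ 'n \<Rightarrow> complex ^ 'p ^ 'm)"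
proof (unfold_locales)
  fix A A' :: "complex ^ 'n ^ 'm" and B B' :: "complex ^ 'p ^ 'n" and r :: real
  show "(A + A') ** B = A ** B + A' ** B" 
    by (simp add: vec_eq_iff matrix_matrix_mult_def distrib_right sum.distrib)
  show "A ** (B + B') = A ** B + A ** B'" 
    by (simp add: vec_eq_iff matrix_matrix_mult_def distrib_left sum.distrib)
  show "(r *\<^sub>R A) ** B = r *\<^sub>R (A ** B)" 
    by (simp add: vec_eq_iff matrix_matrix_mult_def scaleR_sum_right)
  show "A ** (r *\<^sub>R B) = r *\<^sub>R (A ** B)"
    by (simp add: vec_eq_iff matrix_matrix_mult_def scaleR_sum_right)
  show "\<exists>K. \<forall>(A :: complex ^ 'n ^ 'm) (B :: complex ^ 'p ^ 'n). norm (A ** B) \<le> norm A * norm B * K"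
    by (intro exI[of _ 1]) (simp add: norm_matrix_mult_le)
qed

interpretation mm: bounded_bilinear "(**) :: complex ^ 'n ^ 'm \<Rightarrow> complex ^ 'p ^ 'n \<Rightarrow> complex ^ 'p ^ 'm"
  by (rule bounded_bilinear_matrix_mult)

lemma mat_mult_nth [simp]: "(mat c ** (A :: complex ^ 'n ^ 'm)) $ i $ j = c * A $ i $ j"
proof -
  have "(mat c ** A) $ i $ j = (\<Sum>k\<in>UNIV. (if i = k then c * A $ k $ j else 0))"
    unfolding matrix_matrix_mult_def mat_def by (simp add: if_distrib[of "\<lambda>x. x * _"] cong: if_cong)
  then show ?thesis by simp
qed

lemma mult_mat_nth [simp]: "((A :: complex ^ 'n ^ 'm) ** mat c) $ i $ j = c * A $ i $ j"
proof -
  have "(A ** mat c) $ i $ j = (\<Sum>k\<in>UNIV. (if k = j then c * A $ i $ k else 0))"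
    unfolding matrix_matrix_mult_def mat_def by (simp add: if_distrib[of "\<lambda>x. _ * x"] mult.commute cong: if_cong)
  then show ?thesis by simp
qed

lemma mult_mat_commute: "(A :: complex ^ 'n ^ 'm) ** mat c = mat c ** A"
  by (simp add: vec_eq_iff)

lemma mult_mat_left_commute:
  "(A :: complex ^ 'n ^ 'm) ** (mat c ** (B :: complex ^ 'p ^ 'n)) = mat c ** (A ** B)"
  by (simp add: matrix_mul_assoc mult_mat_commute)

lemma mat_mult_mat: "mat c ** (mat d ** (A :: complex ^ 'n ^ 'm)) = mat (c * d) ** A"
  by (simp add: vec_eq_iff)

lemma norm_mat_mult: "norm (mat c ** (A :: complex ^ 'n ^ 'm)) = cmod c * norm A"
proof (rule power2_eq_imp_eq)
  show "(norm (mat c ** A))\<^sup>2 = (cmod c * norm A)\<^sup>2"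
    by (simp add: norm_power2_matrix power_mult_distrib norm_mult sum_distrib_left)
qed auto

lemma norm_dagger [simp]: "norm (dagger (A :: complex ^ 'n ^ 'm)) = norm A"
proof (rule power2_eq_imp_eq)
  show "(norm (dagger A))\<^sup>2 = (norm A)\<^sup>2"
    unfolding norm_power2_matrix by (simp add: dagger_def) (rule sum.swap)
qed auto

lemma bounded_linear_dagger: "bounded_linear (dagger :: complex ^ 'n ^ 'm \<Rightarrow> complex ^ 'm ^ 'n)"
proof (rule bounded_linear_intro[of _ 1])
  fix A B :: "complex ^ 'n ^ 'm" and r :: real
  show "dagger (A + B) = dagger A + dagger B" by (simp add: dagger_def vec_eq_iff)
  show "dagger (r *\<^sub>R A) = r *\<^sub>R dagger A" by (simp add: dagger_def vec_eq_iff)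
  show "norm (dagger A) \<le> norm A * 1" by simp
qed

lemma dagger_dagger [simp]: "dagger (dagger A) = A"
  by (simp add: dagger_def vec_eq_iff)

lemma dagger_mult: "dagger ((A :: complex ^ 'n ^ 'm) ** (B :: complex ^ 'p ^ 'n)) = dagger B ** dagger A"
  by (simp add: dagger_def vec_eq_iff matrix_matrix_mult_def mult.commute)

lemma dagger_mat [simp]: "dagger (mat c) = mat (cnj c)"
  by (auto simp: dagger_def vec_eq_iff mat_def)

lemma dagger_add: "dagger (A + B) = dagger A + dagger B" by (simp add: dagger_def vec_eq_iff)
lemma dagger_diff: "dagger (A - B) = dagger A - dagger B" by (simp add: dagger_def vec_eq_iff)
lemma dagger_minus: "dagger (- A) = - dagger A" by (simp add: dagger_def vec_eq_iff)
lemma dagger_zero [simp]: "dagger 0 = 0" by (simp add: dagger_def vec_eq_iff)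

text \<open>A kernel vector satisfies \<open>x = - (E *v x)\<close> and must vanish, which suffices
  for a square matrix. The bound comes from \<open>X = mat 1 - E ** X\<close>; the Frobenius norm of
  the identity is not 1 in general and stays in it.\<close>

lemma one_plus_small_invertible:
  fixes E :: "complex ^ 'm ^ 'm"
  assumes E: "norm E < 1"
  obtains X where "(mat 1 + E) ** X = mat 1" "X ** (mat 1 + E) = mat 1"
    "norm X \<le> norm (mat 1 :: complex ^ 'm ^ 'm) / (1 - norm E)"
proof -
  have "x = 0" if "(mat 1 + E) *v x = 0" for x
  proof -
    have "x = - (E *v x)" using that by (simp add: matrix_vector_mult_add_rdistrib eq_neg_iff_add_eq_0)
    then have "norm x \<le> norm E * norm x" using norm_matrix_vector_mult_le[of E x] by (metis norm_minus_cancel)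
    then have "(1 - norm E) * norm x \<le> 0" by (simp add: algebra_simps)
    then show ?thesis using E by (simp add: mult_le_0_iff)
  qed
  then obtain X where X: "X ** (mat 1 + E) = mat 1"
    using matrix_left_invertible_ker[of "mat 1 + E"] by auto
  then have X': "(mat 1 + E) ** X = mat 1" using matrix_left_right_inverse by blast
  then have "X = mat 1 - E ** X" by (simp add: mm.add_left algebra_simps)
  then have "norm X \<le> norm (mat 1 :: complex ^ 'm ^ 'm) + norm (E ** X)" by (metis norm_triangle_ineq4)
  also have "\<dots> \<le> norm (mat 1 :: complex ^ 'm ^ 'm) + norm E * norm X" using norm_matrix_mult_le by (intro add_left_mono)
  finally have "norm X * (1 - norm E) \<le> norm (mat 1 :: complex ^ 'm ^ 'm)" by (simp add: algebra_simps)
  then show ?thesis using that X X' E by (simp add: pos_le_divide_eq)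
qed

section \<open>The quasi-differential equation as a linear system\<close>

lemma AE_lebesgue_on_iff_negligible:
  assumes "S \<in> sets lebesgue"
  shows "(AE x in lebesgue_on S. P x) \<longleftrightarrow> (\<exists>N. negligible N \<and> (\<forall>x\<in>S - N. P x))"
proof -
  have "(AE x in lebesgue_on S. P x) \<longleftrightarrow> (AE x in lebesgue. x \<in> S \<longrightarrow> P x)"
    by (rule AE_restrict_space_iff) (use assms in auto)
  also have "\<dots> \<longleftrightarrow> (\<exists>N. negligible N \<and> (\<forall>x\<in>S - N. P x))"
  proof
    assume "AE x in lebesgue. x \<in> S \<longrightarrow> P x"
    then obtain N where "N \<in> null_sets lebesgue" "{x \<in> space lebesgue. \<not> (x \<in> S \<longrightarrow> P x)} \<subseteq> N"
      unfolding eventually_ae_filter by blast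
    then show "\<exists>N. negligible N \<and> (\<forall>x\<in>S - N. P x)"
      by (intro exI[of _ N]) (auto simp: negligible_iff_null_sets)
  next
    assume "\<exists>N. negligible N \<and> (\<forall>x\<in>S - N. P x)"
    then obtain N where "N \<in> null_sets lebesgue" "\<forall>x\<in>S - N. P x" by (auto simp: negligible_iff_null_sets)
    then show "AE x in lebesgue. x \<in> S \<longrightarrow> P x" by (intro AE_I'[of N]) auto
  qed
  finally show ?thesis .
qed

lemma sets_lebesgue_Ioo [simp]: "{a<..<b::real} \<in> sets lebesgue"
  using fmeasurableD[OF lmeasurable_box[of a b]] by simp

lemma sets_lebesgue_Icc [simp]: "{a..b::real} \<in> sets lebesgue"
  using fmeasurableD[OF lmeasurable_cbox[of a b]] by simp

lemma AE_Ioo_imp_negligible: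
  assumes "AE x in lebesgue_on {a<..<b::real}. P x"
  obtains N where "negligible N" "\<And>x. x \<in> {a..b} - N \<Longrightarrow> P x"
proof -
  obtain N where N: "negligible N" "\<forall>x\<in>{a<..<b} - N. P x"
    using assms unfolding AE_lebesgue_on_iff_negligible[OF sets_lebesgue_Ioo] by blast
  show ?thesis
    by (rule that[of "N \<union> {a,b}"]) (use N in \<open>auto simp: negligible_Un\<close>)
qed

lemma abs_continuous_on_imp_continuous_on:
  fixes f :: "real \<Rightarrow> 'a::real_normed_vector"
  assumes "abs_continuous_on a b f"
  shows "continuous_on {a..b} f"
proof (rule uniformly_continuous_imp_continuous)
  show "uniformly_continuous_on {a..b} f"
    unfolding uniformly_continuous_on_def
  proof (intro allI impI)
    fix e :: real assume "e > 0"
    obtain \<delta> where \<delta>: "\<delta> > 0" and *: "\<And>(I::unit set) u v. finite I \<Longrightarrow> (\<And>i. i \<in> I \<Longrightarrow> a \<le> u i \<and> u i \<le> v i \<and> v i \<le> b) \<Longrightarrow>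
       (\<And>i j. i \<in> I \<Longrightarrow> j \<in> I \<Longrightarrow> i \<noteq> j \<Longrightarrow> {u i<..<v i} \<inter> {u j<..<v j} = {}) \<Longrightarrow>
       (\<Sum>i\<in>I. v i - u i) < \<delta> \<Longrightarrow> (\<Sum>i\<in>I. norm (f (v i) - f (u i))) < e"
      by (rule abs_continuous_on_finite_family[OF assms \<open>e > 0\<close>, where 'i=unit]) blast
    have **: "norm (f v - f u) < e" if "a \<le> u" "u \<le> v" "v \<le> b" "v - u < \<delta>" for u v
      using *[of "{()}" "\<lambda>_. u" "\<lambda>_. v"] that by auto
    show "\<exists>d>0. \<forall>x\<in>{a..b}. \<forall>x'\<in>{a..b}. dist x' x < d \<longrightarrow> dist (f x') (f x) < e"
    proof (intro exI[of _ \<delta>] conjI \<delta> ballI impI)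
      fix x x' assume x: "x \<in> {a..b}" "x' \<in> {a..b}" "dist x' x < \<delta>"
      show "dist (f x') (f x) < e"
      proof (cases "x \<le> x'")
        case True
        then show ?thesis using **[of x x'] x by (auto simp: dist_norm)
      next
        case False
        then show ?thesis using **[of x' x] x by (auto simp: dist_norm norm_minus_commute)
      qed
    qed
  qed
qed

text \<open>A good representative of the potential: Hermitian at every point and integrable on the
  closed interval, so that adjoint identities become pointwise algebra.\<close>

definition herm_L2 :: "(real \<Rightarrow> complex^'m^'m) \<Rightarrow> bool" where
  "herm_L2 \<sigma> \<longleftrightarrow> \<sigma> \<in> borel_measurable (lebesgue_on {0..pi}) \<and>
     (\<lambda>t. (norm (\<sigma> t))\<^sup>2) absolutely_integrable_on {0..pi} \<and> (\<forall>t. dagger (\<sigma> t) = \<sigma> t)"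

text \<open>Extension by zero from the open interval, followed by averaging with the adjoint, alters
  the potential inside the interval only on a null set.\<close>

lemma L2_potential_obtain_herm_L2:
  fixes \<sigma> :: "real \<Rightarrow> complex^'m^'m"
  assumes "L2_potential \<sigma>"
  obtains \<sigma>0 where "herm_L2 \<sigma>0" "AE x in lebesgue_on {0<..<pi}. \<sigma> x = \<sigma>0 x"
proof -
  let ?S = "{0<..<pi}"
  define \<tau> where "\<tau> t = (if t \<in> ?S then \<sigma> t else 0)" for t
  define \<sigma>0 where "\<sigma>0 t = (1/2) *\<^sub>R (\<tau> t + dagger (\<tau> t))" for t
  have m: "\<sigma> \<in> borel_measurable (lebesgue_on ?S)" and i: "integrable (lebesgue_on ?S) (\<lambda>x. (norm (\<sigma> x))\<^sup>2)"
    and h: "AE x in lebesgue_on ?S. \<sigma> x = dagger (\<sigma> x)"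
    using assms by (auto simp: L2_potential_def)
  have ae: "AE x in lebesgue_on ?S. \<sigma> x = \<sigma>0 x"
  proof -
    obtain N where N: "negligible N" "\<forall>x\<in>?S - N. \<sigma> x = dagger (\<sigma> x)"
      using h unfolding AE_lebesgue_on_iff_negligible[OF sets_lebesgue_Ioo] by blast
    have "\<sigma> x = \<sigma>0 x" if "x \<in> ?S - N" for x
    proof -
      have "dagger (\<sigma> x) = \<sigma> x" "x \<in> ?S" using N that by auto
      then have "\<sigma>0 x = (1/2) *\<^sub>R (\<sigma> x + \<sigma> x)" by (simp add: \<sigma>0_def \<tau>_def)
      also have "\<dots> = \<sigma> x" by (simp add: scaleR_2[symmetric])
      finally show ?thesis by simp
    qed
    then show ?thesis unfolding AE_lebesgue_on_iff_negligible[OF sets_lebesgue_Ioo] using N(1) by blast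
  qed
  have "\<tau> \<in> borel_measurable lebesgue"
    unfolding \<tau>_def using m by (subst borel_measurable_if) auto
  then have \<tau>m: "\<tau> \<in> borel_measurable (lebesgue_on {0..pi})"
    by (rule measurable_restrict_space1)
  have "(\<lambda>t. dagger (\<tau> t)) \<in> borel_measurable (lebesgue_on {0..pi})"
  proof -
    have "(dagger :: complex^'m^'m \<Rightarrow> _) \<in> borel_measurable borel"
      by (intro borel_measurable_continuous_onI linear_continuous_on bounded_linear_dagger)
    then show ?thesis using \<tau>m by (rule measurable_compose_rev)
  qed
  then have \<sigma>0m: "\<sigma>0 \<in> borel_measurable (lebesgue_on {0..pi})"
    unfolding \<sigma>0_def by (intro borel_measurable_scaleR borel_measurable_add \<tau>m borel_measurable_const)
  have "(\<lambda>x. (norm (\<sigma> x))\<^sup>2) absolutely_integrable_on ?S"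
    using i by (subst (asm) integrable_restrict_space) (simp_all add: set_integrable_def)
  then have ai: "(\<lambda>x. (norm (\<sigma> x))\<^sup>2) absolutely_integrable_on {0..pi}"
    by (rule absolutely_integrable_spike_set) (rule negligible_subset[of "{0,pi}"]; auto)+
  obtain N where N: "negligible N" "\<And>x. x \<in> {0..pi} - N \<Longrightarrow> \<sigma> x = \<sigma>0 x"
    using AE_Ioo_imp_negligible[OF ae] by blast
  have ai0: "(\<lambda>x. (norm (\<sigma>0 x))\<^sup>2) absolutely_integrable_on {0..pi}"
    using ai N(1) by (rule absolutely_integrable_spike) (use N(2) in auto)
  have "dagger (\<sigma>0 t) = \<sigma>0 t" for t
    by (simp add: \<sigma>0_def linear_scale[OF bounded_linear.linear[OF bounded_linear_dagger]] dagger_add add.commute)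
  with \<sigma>0m ai0 have "herm_L2 \<sigma>0" unfolding herm_L2_def by blast
  then show ?thesis using that ae by blast
qed

text \<open>First-order system for \<open>Y\<close> and its quasi-derivative in integral form. The
  coefficients contain only the potential and its square, both integrable; no derivative of the
  potential occurs.\<close>

definition sol :: "(real \<Rightarrow> complex^'m^'m) \<Rightarrow> complex \<Rightarrow> (real \<Rightarrow> complex^'n^'m) \<Rightarrow> (real \<Rightarrow> complex^'n^'m) \<Rightarrow> bool" where
  "sol \<sigma> lam Y Z \<longleftrightarrow> L1_deriv 0 pi Y (\<lambda>t. \<sigma> t ** Y t + Z t) \<and>
     L1_deriv 0 pi Z (\<lambda>t. - (\<sigma> t ** Z t) - \<sigma> t ** \<sigma> t ** Y t - mat lam ** Y t)"

definition sol_bound :: "(real \<Rightarrow> complex^'m^'m) \<Rightarrow> real \<Rightarrow> real" where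
  "sol_bound \<sigma> t = 2 * norm (\<sigma> t) + (norm (\<sigma> t))\<^sup>2"

text \<open>The Gronwall factor due to the potential alone. The spectral parameter enters through
  the separate factor \<open>exp (pi * (k + cmod lam / k))\<close>.\<close>

definition sol_mass :: "(real \<Rightarrow> complex^'m^'m) \<Rightarrow> real" where
  "sol_mass \<sigma> = exp (integral {0..pi} (sol_bound \<sigma>))"

text \<open>The first component is \<open>k Y\<close>: with \<open>k\<close> the square root of the modulus of the spectral
  parameter, the coefficients have size \<open>k\<close>, which gives growth of order one half.\<close>

definition sol_field :: "(real \<Rightarrow> complex^'m^'m) \<Rightarrow> complex \<Rightarrow> real \<Rightarrow> real \<Rightarrow>
    (complex^'n^'m) \<times> (complex^'n^'m) \<Rightarrow> (complex^'n^'m) \<times> (complex^'n^'m)" where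
  "sol_field \<sigma> lam k t = (\<lambda>(P, Q). (\<sigma> t ** P + k *\<^sub>R Q,
      - (\<sigma> t ** Q) - (1/k) *\<^sub>R (\<sigma> t ** \<sigma> t ** P) - (1/k) *\<^sub>R (mat lam ** P)))"

context
  fixes \<sigma> :: "real \<Rightarrow> complex^'m^'m"
  assumes \<sigma>: "herm_L2 \<sigma>"
begin

lemma herm_L2_norm_integrable: "(\<lambda>t. norm (\<sigma> t)) absolutely_integrable_on {0..pi}"
proof (rule measurable_bounded_by_integrable_imp_absolutely_integrable)
  show "(\<lambda>t. norm (\<sigma> t)) \<in> borel_measurable (lebesgue_on {0..pi})"
    using \<sigma> unfolding herm_L2_def by (auto intro: borel_measurable_norm)
  have "(\<lambda>t. (norm (\<sigma> t))\<^sup>2) integrable_on {0..pi}"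
    using \<sigma> set_lebesgue_integral_eq_integral(1) unfolding herm_L2_def by blast
  then show "(\<lambda>t. 1 + (norm (\<sigma> t))\<^sup>2) integrable_on {0..pi}" by (intro integrable_add) auto
  fix t :: real
  have "0 \<le> (norm (\<sigma> t) - 1)\<^sup>2" by simp
  then have "2 * norm (\<sigma> t) \<le> 1 + (norm (\<sigma> t))\<^sup>2" by (simp add: power2_eq_square algebra_simps)
  then show "norm (norm (\<sigma> t)) \<le> 1 + (norm (\<sigma> t))\<^sup>2" using norm_ge_zero[of "\<sigma> t"] unfolding real_norm_def abs_norm_cancel by linarith
qed simp

lemma sol_bound_integrable: "sol_bound \<sigma> absolutely_integrable_on {0..pi}"
  using \<sigma> absolutely_integrable_scaleR_left[OF herm_L2_norm_integrable, of 2]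
  unfolding sol_bound_def[abs_def] herm_L2_def by (intro set_integral_add) auto

lemma sol_field_L1:
  assumes k: "k \<ge> 1"
  shows "L1_linear_field 0 pi (sol_field \<sigma> lam k :: real \<Rightarrow> (complex^'n^'m) \<times> (complex^'n^'m) \<Rightarrow> _)
    (\<lambda>t. (k + cmod lam / k) + sol_bound \<sigma> t)"
  unfolding L1_linear_field_def
proof (intro conjI ballI allI)
  show "(\<lambda>t. (k + cmod lam / k) + sol_bound \<sigma> t) absolutely_integrable_on {0..pi}"
    by (intro set_integral_add(1)[OF absolutely_integrable_continuous_real sol_bound_integrable] continuous_on_const)
  fix t :: real
  show "linear (sol_field \<sigma> lam k t :: (complex^'n^'m) \<times> (complex^'n^'m) \<Rightarrow> _)"
    by (rule linearI) (auto simp: sol_field_def mm.add_right mm.scaleR_right scaleR_add_right algebra_simps)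
  fix v :: "(complex^'n^'m) \<times> (complex^'n^'m)"
  obtain P Q where v: "v = (P, Q)" by (cases v)
  define s where "s = norm (\<sigma> t)"
  have P: "norm P \<le> norm v" and Q: "norm Q \<le> norm v" and n0: "0 \<le> norm v" using v by (auto simp: norm_Pair real_le_rsqrt)
  have s0: "0 \<le> s" by (simp add: s_def)
  have "norm (sol_field \<sigma> lam k t v) \<le> norm (\<sigma> t ** P + k *\<^sub>R Q) +
     norm (- (\<sigma> t ** Q) - (1/k) *\<^sub>R (\<sigma> t ** \<sigma> t ** P) - (1/k) *\<^sub>R (mat lam ** P))"
    unfolding v sol_field_def by (simp add: norm_Pair) (rule sqrt_sum_squares_le_sum; simp)
  also have "\<dots> \<le> (norm (\<sigma> t ** P) + norm (k *\<^sub>R Q)) + (norm (\<sigma> t ** Q) + norm ((1/k) *\<^sub>R (\<sigma> t ** \<sigma> t ** P)) + norm ((1/k) *\<^sub>R (mat lam ** P)))"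
  proof (rule add_mono[OF norm_triangle_ineq])
    have "norm (- (\<sigma> t ** Q) - (1/k) *\<^sub>R (\<sigma> t ** \<sigma> t ** P) - (1/k) *\<^sub>R (mat lam ** P)) \<le>
      norm (- (\<sigma> t ** Q) - (1/k) *\<^sub>R (\<sigma> t ** \<sigma> t ** P)) + norm ((1/k) *\<^sub>R (mat lam ** P))" by (rule norm_triangle_ineq4)
    also have "norm (- (\<sigma> t ** Q) - (1/k) *\<^sub>R (\<sigma> t ** \<sigma> t ** P)) \<le> norm (- (\<sigma> t ** Q)) + norm ((1/k) *\<^sub>R (\<sigma> t ** \<sigma> t ** P))"
      by (rule norm_triangle_ineq4)
    finally show "norm (- (\<sigma> t ** Q) - (1/k) *\<^sub>R (\<sigma> t ** \<sigma> t ** P) - (1/k) *\<^sub>R (mat lam ** P)) \<le>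
      norm (\<sigma> t ** Q) + norm ((1/k) *\<^sub>R (\<sigma> t ** \<sigma> t ** P)) + norm ((1/k) *\<^sub>R (mat lam ** P))" by simp
  qed
  also have "\<dots> \<le> (s * norm v + k * norm v) + (s * norm v + s\<^sup>2 * norm v + (cmod lam / k) * norm v)"
  proof (intro add_mono)
    show "norm (\<sigma> t ** P) \<le> s * norm v"
      using norm_matrix_mult_le[of "\<sigma> t" P] mult_left_mono[OF P s0] unfolding s_def by linarith
    show "norm (\<sigma> t ** Q) \<le> s * norm v"
      using norm_matrix_mult_le[of "\<sigma> t" Q] mult_left_mono[OF Q s0] unfolding s_def by linarith
    show "norm (k *\<^sub>R Q) \<le> k * norm v" using k mult_left_mono[OF Q, of k] by simp
    have "norm (\<sigma> t ** \<sigma> t ** P) \<le> norm (\<sigma> t ** \<sigma> t) * norm P" by (rule norm_matrix_mult_le)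
    also have "\<dots> \<le> (s * s) * norm v"
      using norm_matrix_mult_le[of "\<sigma> t" "\<sigma> t"] P unfolding s_def by (intro mult_mono) auto
    finally have "norm (\<sigma> t ** \<sigma> t ** P) \<le> s\<^sup>2 * norm v" by (simp add: power2_eq_square)
    moreover have "norm ((1/k) *\<^sub>R (\<sigma> t ** \<sigma> t ** P)) \<le> norm (\<sigma> t ** \<sigma> t ** P)"
      using k by (simp add: divide_le_eq mult_le_cancel_left1)
    ultimately show "norm ((1/k) *\<^sub>R (\<sigma> t ** \<sigma> t ** P)) \<le> s\<^sup>2 * norm v" by linarith
    show "norm ((1/k) *\<^sub>R (mat lam ** P)) \<le> (cmod lam / k) * norm v"
      using k mult_left_mono[OF P, of "cmod lam"] by (simp add: norm_mat_mult divide_right_mono)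
  qed
  also have "\<dots> = ((k + cmod lam / k) + sol_bound \<sigma> t) * norm v"
    by (simp add: sol_bound_def s_def algebra_simps)
  finally show "norm (sol_field \<sigma> lam k t v) \<le> ((k + cmod lam / k) + sol_bound \<sigma> t) * norm v" .
next
  fix v :: "(complex^'n^'m) \<times> (complex^'n^'m)"
  obtain P Q where v: "v = (P, Q)" by (cases v)
  have c: "continuous_on UNIV (\<lambda>s :: complex^'m^'m. (s ** P + k *\<^sub>R Q,
      - (s ** Q) - (1/k) *\<^sub>R (s ** s ** P) - (1/k) *\<^sub>R (mat lam ** P)))"
    by (intro continuous_intros mm.continuous_on)
  have "\<sigma> \<in> borel_measurable (lebesgue_on {0..pi})" using \<sigma> by (simp add: herm_L2_def)
  then show "(\<lambda>t. sol_field \<sigma> lam k t v) \<in> borel_measurable (lebesgue_on {0..pi})"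
    using borel_measurable_continuous_onI[OF c] unfolding v sol_field_def prod.case
    by (rule measurable_compose)
qed

lemma sol_iff_field:
  assumes k: "k \<ge> 1"
  shows "sol \<sigma> lam Y Z \<longleftrightarrow> L1_deriv 0 pi (\<lambda>t. (k *\<^sub>R Y t, Z t)) (\<lambda>t. sol_field \<sigma> lam k t (k *\<^sub>R Y t, Z t))"
proof
  assume s: "sol \<sigma> lam Y Z"
  then have "L1_deriv 0 pi (\<lambda>t. k *\<^sub>R Y t) (\<lambda>t. k *\<^sub>R (\<sigma> t ** Y t + Z t))"
    unfolding sol_def using L1_deriv_linear[OF _ bounded_linear_scaleR_right[of k]] by blast
  then have "L1_deriv 0 pi (\<lambda>t. (k *\<^sub>R Y t, Z t)) (\<lambda>t. (k *\<^sub>R (\<sigma> t ** Y t + Z t), - (\<sigma> t ** Z t) - \<sigma> t ** \<sigma> t ** Y t - mat lam ** Y t))"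
    by (rule L1_deriv_Pair[OF _ s[unfolded sol_def, THEN conjunct2]])
  then show "L1_deriv 0 pi (\<lambda>t. (k *\<^sub>R Y t, Z t)) (\<lambda>t. sol_field \<sigma> lam k t (k *\<^sub>R Y t, Z t))"
    by (rule L1_deriv_cong') (use k in \<open>auto simp: sol_field_def mm.scaleR_right scaleR_add_right\<close>)
next
  assume L: "L1_deriv 0 pi (\<lambda>t. (k *\<^sub>R Y t, Z t)) (\<lambda>t. sol_field \<sigma> lam k t (k *\<^sub>R Y t, Z t))"
  have "L1_deriv 0 pi (\<lambda>t. (1/k) *\<^sub>R (k *\<^sub>R Y t)) (\<lambda>t. (1/k) *\<^sub>R fst (sol_field \<sigma> lam k t (k *\<^sub>R Y t, Z t)))"
    using L1_deriv_linear[OF L1_deriv_fst[OF L] bounded_linear_scaleR_right[of "1/k"]] by simp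
  then have "L1_deriv 0 pi Y (\<lambda>t. \<sigma> t ** Y t + Z t)"
    by (rule L1_deriv_cong') (use k in \<open>auto simp: sol_field_def mm.scaleR_right scaleR_add_right\<close>)
  moreover have "L1_deriv 0 pi Z (\<lambda>t. - (\<sigma> t ** Z t) - \<sigma> t ** \<sigma> t ** Y t - mat lam ** Y t)"
    using L1_deriv_snd[OF L]
    by (rule L1_deriv_cong') (use k in \<open>auto simp: sol_field_def mm.scaleR_right\<close>)
  ultimately show "sol \<sigma> lam Y Z" by (simp add: sol_def)
qed

lemma sol_exists:
  obtains Y Z where "sol \<sigma> lam Y Z" "Y 0 = y0" "Z 0 = z0"
proof -
  obtain u where u: "u 0 = (y0, z0)" "L1_deriv 0 pi u (\<lambda>t. sol_field \<sigma> lam 1 t (u t) + 0)"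
    using linear_ode_L1_exists[OF sol_field_L1[OF order_refl, of lam], of "\<lambda>_. 0" "(y0, z0)"] by auto
  have "sol \<sigma> lam (\<lambda>t. fst (u t)) (\<lambda>t. snd (u t))"
    using u(2) by (simp add: sol_iff_field[OF order_refl])
  then show ?thesis using that u(1) by force
qed

lemma sol_unique:
  assumes s: "sol \<sigma> lam Y Z" and s': "sol \<sigma> lam Y' Z'" and init: "Y 0 = Y' 0" "Z 0 = Z' 0" and x: "x \<in> {0..pi}"
  shows "Y x = Y' x" "Z x = Z' x"
proof -
  have "(1 *\<^sub>R Y x, Z x) = (1 *\<^sub>R Y' x, Z' x)"
    by (rule linear_ode_L1_unique[OF sol_field_L1[OF order_refl] s[unfolded sol_iff_field[OF order_refl]]
          s'[unfolded sol_iff_field[OF order_refl]] _ x]) (simp add: init)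
  then show "Y x = Y' x" "Z x = Z' x" by auto
qed

lemma sol_growth_exponent:
  assumes k: "k \<ge> 1" and x: "x \<in> {0..pi}"
  shows "exp (integral {0..x} (\<lambda>t. (k + cmod lam / k) + sol_bound \<sigma> t)) \<le> sol_mass \<sigma> * exp (pi * (k + cmod lam / k))"
proof -
  have i: "sol_bound \<sigma> integrable_on {0..pi}"
    using sol_bound_integrable set_lebesgue_integral_eq_integral(1) by blast
  then have i': "sol_bound \<sigma> integrable_on {0..x}" by (rule integrable_subinterval_real) (use x in auto)
  have "integral {0..x} (\<lambda>t. (k + cmod lam / k) + sol_bound \<sigma> t) = x * (k + cmod lam / k) + integral {0..x} (sol_bound \<sigma>)"
    using i' x by (subst integral_add) auto
  also have "\<dots> \<le> pi * (k + cmod lam / k) + integral {0..pi} (sol_bound \<sigma>)"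
    using i i' x k by (intro add_mono mult_right_mono integral_subset_le) (auto simp: sol_bound_def)
  finally show ?thesis by (simp add: sol_mass_def exp_add[symmetric] add.commute)
qed

lemma sol_growth:
  assumes s: "sol \<sigma> lam Y Z" and k: "k \<ge> 1" and x: "x \<in> {0..pi}"
  shows "norm (Y x) \<le> (k * norm (Y 0) + norm (Z 0)) * (sol_mass \<sigma> * exp (pi * (k + cmod lam / k)))"
proof -
  let ?g = "\<lambda>t. (k + cmod lam / k) + sol_bound \<sigma> t"
  have "L1_deriv 0 pi (\<lambda>t. (k *\<^sub>R Y t, Z t)) (\<lambda>t. sol_field \<sigma> lam k t (k *\<^sub>R Y t, Z t) + 0)"
    using s k by (simp add: sol_iff_field)
  from linear_ode_L1_bound[OF sol_field_L1[OF k] this _ _ x, of 0]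
  have "norm (k *\<^sub>R Y x, Z x) \<le> norm (k *\<^sub>R Y 0, Z 0) * exp (integral {0..x} ?g)" by simp
  also have "\<dots> \<le> (k * norm (Y 0) + norm (Z 0)) * (sol_mass \<sigma> * exp (pi * (k + cmod lam / k)))"
  proof (rule mult_mono[OF _ sol_growth_exponent[OF k x]])
    show "norm (k *\<^sub>R Y 0, Z 0) \<le> k * norm (Y 0) + norm (Z 0)"
      using k by (simp add: norm_Pair) (rule sqrt_sum_squares_le_sum[THEN order_trans]; simp)
  qed (use k in auto)
  finally have "norm (k *\<^sub>R Y x, Z x) \<le> \<dots>" .
  moreover have "norm (Y x) \<le> norm (k *\<^sub>R Y x)" using k by (simp add: mult_le_cancel_right1)
  moreover have "norm (k *\<^sub>R Y x) \<le> norm (k *\<^sub>R Y x, Z x)" by (simp add: norm_Pair real_le_rsqrt)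
  ultimately show ?thesis by linarith
qed

text \<open>Differentiating the system in \<open>lam\<close> gives an inhomogeneous system for the
  candidate derivative \<open>V\<close>. Gronwall is applied twice: the difference of solutions is
  O(|mu - lam|), and with this as inhomogeneity the Taylor remainder is O(|mu - lam|^2). The point
  is fixed, so the scaling \<open>k = 1\<close> is good enough.\<close>

lemma sol_entry_has_field_derivative:
  fixes Y Z :: "complex \<Rightarrow> real \<Rightarrow> complex^'n^'m"
  assumes s: "\<And>lam. sol \<sigma> lam (Y lam) (Z lam)" and init: "\<And>lam. Y lam 0 = y0" "\<And>lam. Z lam 0 = z0"
    and x: "x \<in> {0..pi}"
  shows "\<exists>D. ((\<lambda>lam. Y lam x $ i $ j) has_field_derivative D) (at lam)"
proof -
  let ?F = "sol_field \<sigma> lam 1 :: real \<Rightarrow> (complex^'n^'m) \<times> (complex^'n^'m) \<Rightarrow> _"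
  let ?g = "\<lambda>t. (1 + cmod lam / 1) + sol_bound \<sigma> t"
  note F = sol_field_L1[OF order_refl[of 1], of lam, where 'n='n]
  define G where "G = sol_mass \<sigma> * exp (pi * (1 + cmod lam))"
  have Ge: "exp (integral {0..x} ?g) \<le> G" if "x \<in> {0..pi}" for x
    using sol_growth_exponent[OF order_refl that, of lam] by (simp add: G_def)
  have Gpos: "0 < G" by (simp add: G_def sol_mass_def)
  have Yc: "continuous_on {0..pi} (Y \<mu>)" for \<mu>
    using s[of \<mu>] L1_deriv_continuous unfolding sol_def by blast
  have Yu: "L1_deriv 0 pi (\<lambda>t. (Y \<mu> t, Z \<mu> t)) (\<lambda>t. sol_field \<sigma> \<mu> 1 t (Y \<mu> t, Z \<mu> t))" for \<mu>
    using s[of \<mu>] sol_iff_field[OF order_refl] by fastforce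
  have ri: "(\<lambda>t. (0 :: complex^'n^'m, w t)) absolutely_integrable_on {0..pi}" if "continuous_on {0..pi} w" for w :: "real \<Rightarrow> complex^'n^'m"
    using that by (intro absolutely_integrable_continuous_real continuous_intros)
  have bnd: "norm (u x) \<le> (norm (u 0) + pi * W) * G"
    if u: "L1_deriv 0 pi u (\<lambda>t. ?F t (u t) + (0, w t))" and w: "continuous_on {0..pi} w"
      and W: "\<And>t. t \<in> {0..pi} \<Longrightarrow> norm (w t) \<le> W" and x: "x \<in> {0..pi}"
    for u w x and W :: real
  proof -
    have W0: "0 \<le> W" by (rule order_trans[OF norm_ge_zero W[of 0]]) simp
    have "norm (integral {0..x} (\<lambda>t. (0 :: complex^'n^'m, w t))) \<le> pi * W" if x: "x \<in> {0..pi}" for x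
    proof -
      have "norm (integral {0..x} (\<lambda>t. (0 :: complex^'n^'m, w t))) \<le> integral {0..x} (\<lambda>t. W)"
      proof (rule integral_norm_bound_integral)
        show "(\<lambda>t. (0 :: complex^'n^'m, w t)) integrable_on {0..x}"
          by (rule integrable_subinterval_real[OF set_lebesgue_integral_eq_integral(1)[OF ri[OF w]]]) (use x in auto)
      qed (use W x in \<open>auto simp: norm_Pair\<close>)
      also have "\<dots> \<le> pi * W" using x W0 by (simp add: mult_right_mono)
      finally show ?thesis .
    qed
    from linear_ode_L1_bound[OF F u ri[OF w] this x]
    have "norm (u x) \<le> (norm (u 0) + pi * W) * exp (integral {0..x} ?g)" by simp
    also have "\<dots> \<le> (norm (u 0) + pi * W) * G"
      using Ge[OF x] W0 by (intro mult_left_mono) auto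
    finally show ?thesis .
  qed
  define B where "B = (norm y0 + norm z0) * (sol_mass \<sigma> * exp (pi * (1 + (cmod lam + 1))))"
  have B0: "0 \<le> B" by (simp add: B_def sol_mass_def)
  have Yb: "norm (Y \<mu> t) \<le> B" if "cmod (\<mu> - lam) \<le> 1" "t \<in> {0..pi}" for \<mu> t
  proof -
    have "norm (Y \<mu> t) \<le> (1 * norm (Y \<mu> 0) + norm (Z \<mu> 0)) * (sol_mass \<sigma> * exp (pi * (1 + cmod \<mu> / 1)))"
      by (rule sol_growth[OF s order_refl that(2)])
    also have "cmod \<mu> \<le> cmod lam + 1" using that(1) norm_triangle_ineq2[of \<mu> lam] by simp
    then have "(1 * norm (Y \<mu> 0) + norm (Z \<mu> 0)) * (sol_mass \<sigma> * exp (pi * (1 + cmod \<mu> / 1))) \<le> B"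
      unfolding B_def init by (intro mult_mono) (auto simp: sol_mass_def)
    finally show ?thesis .
  qed
  \<comment> \<open>The source \<open>- Y lam\<close> is the derivative of the term
    \<open>- (mat lam ** Y)\<close> with respect to the explicit \<open>lam\<close>. The initial
    value is zero because the initial data are the same for all parameters.\<close>
  obtain V where V0: "V 0 = (0, 0)" and V: "L1_deriv 0 pi V (\<lambda>t. ?F t (V t) + (0, - Y lam t))"
    using linear_ode_L1_exists[OF F ri[of "\<lambda>t. - Y lam t"], of "(0,0)"] Yc[of lam] by (auto intro: continuous_intros)
  have Fdiff: "sol_field \<sigma> \<mu> 1 t (P, Q) = ?F t (P, Q) + (0, - (mat (\<mu> - lam) ** P))" for \<mu> t and P Q :: "complex^'n^'m"
    by (simp add: sol_field_def vec_eq_iff algebra_simps)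
  have d1: "norm (Y \<mu> t - Y lam t) \<le> cmod (\<mu> - lam) * (pi * B * G)" if \<mu>: "cmod (\<mu> - lam) \<le> 1" and t: "t \<in> {0..pi}" for \<mu> t
  proof -
    have "L1_deriv 0 pi (\<lambda>t. (Y \<mu> t, Z \<mu> t) - (Y lam t, Z lam t))
      (\<lambda>t. sol_field \<sigma> \<mu> 1 t (Y \<mu> t, Z \<mu> t) - ?F t (Y lam t, Z lam t))" by (rule L1_deriv_diff[OF Yu Yu])
    then have "L1_deriv 0 pi (\<lambda>t. (Y \<mu> t, Z \<mu> t) - (Y lam t, Z lam t))
      (\<lambda>t. ?F t ((Y \<mu> t, Z \<mu> t) - (Y lam t, Z lam t)) + (0, - (mat (\<mu> - lam) ** Y \<mu> t)))"
    proof (rule L1_deriv_cong')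
      fix t assume t: "t \<in> {0..pi}"
      show "sol_field \<sigma> \<mu> 1 t (Y \<mu> t, Z \<mu> t) - ?F t (Y lam t, Z lam t) =
        ?F t ((Y \<mu> t, Z \<mu> t) - (Y lam t, Z lam t)) + (0, - (mat (\<mu> - lam) ** Y \<mu> t))"
        unfolding Fdiff[of \<mu>] linear_diff[OF L1_linear_fieldD(2)[OF F t]] by simp
    qed simp
    note L = this
    have c: "continuous_on {0..pi} (\<lambda>t. - (mat (\<mu> - lam) ** Y \<mu> t))"
      by (intro continuous_intros mm.continuous_on Yc)
    have "norm (- (mat (\<mu> - lam) ** Y \<mu> t)) \<le> cmod (\<mu> - lam) * B" if "t \<in> {0..pi}" for t
      using Yb[OF \<mu> that] by (simp add: norm_mat_mult mult_left_mono)
    from bnd[OF L c this t]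
    have "norm ((Y \<mu> t, Z \<mu> t) - (Y lam t, Z lam t)) \<le> (pi * (cmod (\<mu> - lam) * B)) * G"
      by (simp add: init zero_prod_def[symmetric])
    moreover have "norm (Y \<mu> t - Y lam t) \<le> norm ((Y \<mu> t, Z \<mu> t) - (Y lam t, Z lam t))"
      by (simp add: norm_Pair real_le_rsqrt)
    ultimately show ?thesis by (simp add: algebra_simps)
  qed
  define C where "C = pi * (pi * B * G) * G"
  have d2: "norm (Y \<mu> x - Y lam x - mat (\<mu> - lam) ** fst (V x)) \<le> (cmod (\<mu> - lam))\<^sup>2 * C" if \<mu>: "cmod (\<mu> - lam) \<le> 1" for \<mu>
  proof -
    let ?c = "\<mu> - lam"
    let ?d = "\<lambda>t. (Y \<mu> t, Z \<mu> t) - (Y lam t, Z lam t)"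
    let ?m = "\<lambda>v :: (complex^'n^'m) \<times> (complex^'n^'m). (mat ?c ** fst v, mat ?c ** snd v)"
    have blm: "bounded_linear ?m"
      by (intro bounded_linear_Pair bounded_linear_compose[OF mm.bounded_linear_right] bounded_linear_fst bounded_linear_snd)
    \<comment> \<open>Linearity of the field is over the reals only, so commutation with the complex
      scalar \<open>\<mu> - lam\<close> is checked separately.\<close>
    have mF: "?m (?F t v) = ?F t (?m v)" for t v
      by (cases v) (simp add: sol_field_def mm.add_right mm.diff_right mm.minus_right mm.scaleR_right
        mult_mat_left_commute[of "\<sigma> t"] mult_mat_left_commute[of "\<sigma> t ** \<sigma> t"] mult_mat_left_commute[of "mat lam" ?c])
    have "L1_deriv 0 pi (\<lambda>t. ?d t - ?m (V t))
      (\<lambda>t. (sol_field \<sigma> \<mu> 1 t (Y \<mu> t, Z \<mu> t) - ?F t (Y lam t, Z lam t)) - ?m (?F t (V t) + (0, - Y lam t)))"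
      by (rule L1_deriv_diff[OF L1_deriv_diff[OF Yu Yu] L1_deriv_linear[OF V blm]])
    then have "L1_deriv 0 pi (\<lambda>t. ?d t - ?m (V t))
      (\<lambda>t. ?F t (?d t - ?m (V t)) + (0, - (mat ?c ** (Y \<mu> t - Y lam t))))"
    proof (rule L1_deriv_cong')
      fix t assume t: "t \<in> {0..pi}"
      note lin = L1_linear_fieldD(2)[OF F t]
      have 1: "sol_field \<sigma> \<mu> 1 t (Y \<mu> t, Z \<mu> t) - ?F t (Y lam t, Z lam t) = ?F t (?d t) + (0, - (mat ?c ** Y \<mu> t))"
        unfolding Fdiff[of \<mu>] linear_diff[OF lin] by simp
      have 2: "?m (?F t (V t) + (0, - Y lam t)) = ?F t (?m (V t)) + (0, - (mat ?c ** Y lam t))"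
        unfolding linear_add[OF bounded_linear.linear[OF blm]] mF by (simp add: mm.minus_right)
      show "(sol_field \<sigma> \<mu> 1 t (Y \<mu> t, Z \<mu> t) - ?F t (Y lam t, Z lam t)) - ?m (?F t (V t) + (0, - Y lam t)) =
        ?F t (?d t - ?m (V t)) + (0, - (mat ?c ** (Y \<mu> t - Y lam t)))"
        unfolding 1 2 linear_diff[OF lin, of "?d t"] by (simp add: mm.diff_right)
    qed simp
    note L = this
    have c: "continuous_on {0..pi} (\<lambda>t. - (mat ?c ** (Y \<mu> t - Y lam t)))"
      by (intro continuous_intros mm.continuous_on Yc)
    have "norm (- (mat ?c ** (Y \<mu> t - Y lam t))) \<le> cmod ?c * (cmod ?c * (pi * B * G))" if "t \<in> {0..pi}" for t
      using d1[OF \<mu> that] by (simp add: norm_mat_mult mult_left_mono)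
    from bnd[OF L c this x]
    have "norm (?d x - ?m (V x)) \<le> (pi * (cmod ?c * (cmod ?c * (pi * B * G)))) * G"
      by (simp add: init V0 zero_prod_def[symmetric])
    moreover have "norm (Y \<mu> x - Y lam x - mat ?c ** fst (V x)) \<le> norm (?d x - ?m (V x))"
      by (simp add: norm_Pair real_le_rsqrt)
    ultimately show ?thesis by (simp add: C_def power2_eq_square algebra_simps)
  qed
  have "((\<lambda>\<mu>. Y \<mu> x $ i $ j) has_field_derivative fst (V x) $ i $ j) (at lam)"
    unfolding has_field_derivative_iff
  proof (rule LIM_zero_cancel, rule Lim_null_comparison)
    show "\<forall>\<^sub>F \<mu> in at lam. norm ((Y \<mu> x $ i $ j - Y lam x $ i $ j) / (\<mu> - lam) - fst (V x) $ i $ j) \<le> cmod (\<mu> - lam) * C"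
      unfolding eventually_at
    proof (intro exI[of _ 1] conjI ballI impI)
      fix \<mu> :: complex assume \<mu>: "\<mu> \<noteq> lam \<and> dist \<mu> lam < 1"
      let ?E = "Y \<mu> x - Y lam x - mat (\<mu> - lam) ** fst (V x)"
      have "cmod (?E $ i $ j) \<le> norm ?E"
        using Finite_Cartesian_Product.norm_nth_le[of ?E i] Finite_Cartesian_Product.norm_nth_le[of "?E $ i" j] by linarith
      also have "\<dots> \<le> (cmod (\<mu> - lam))\<^sup>2 * C" using d2[of \<mu>] \<mu> by (simp add: dist_norm)
      finally have "cmod (?E $ i $ j) / cmod (\<mu> - lam) \<le> (cmod (\<mu> - lam))\<^sup>2 * C / cmod (\<mu> - lam)"
        by (intro divide_right_mono) auto
      also have "(cmod (\<mu> - lam))\<^sup>2 * C / cmod (\<mu> - lam) = cmod (\<mu> - lam) * C"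
        using \<mu> by (simp add: power2_eq_square)
      finally have "cmod (?E $ i $ j) / cmod (\<mu> - lam) \<le> cmod (\<mu> - lam) * C" .
      moreover have "(Y \<mu> x $ i $ j - Y lam x $ i $ j) / (\<mu> - lam) - fst (V x) $ i $ j = (?E $ i $ j) / (\<mu> - lam)"
        using \<mu> by (simp add: diff_divide_distrib)
      ultimately show "norm ((Y \<mu> x $ i $ j - Y lam x $ i $ j) / (\<mu> - lam) - fst (V x) $ i $ j) \<le> cmod (\<mu> - lam) * C"
        by (simp only: norm_divide)
    qed simp
    show "((\<lambda>\<mu>. cmod (\<mu> - lam) * C) \<longlongrightarrow> 0) (at lam)"
      by (auto intro!: tendsto_eq_intros)
  qed
  then show ?thesis by blast
qed

end

section \<open>Reflection, Wronskian and superposition\<close>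

text \<open>Passes from derivatives almost everywhere to integral form and at the same time to the
  Hermitian representative. Integrability of the derivatives is not part of \<open>solution\<close>;
  it follows because the coefficients are integrable and \<open>Y\<close>, \<open>Z\<close>
  continuous.\<close>

lemma solution_iff_sol:
  fixes Y Z :: "real \<Rightarrow> complex^'n^'m"
  assumes \<sigma>0: "herm_L2 \<sigma>0" and ae: "AE x in lebesgue_on {0<..<pi}. \<sigma> x = \<sigma>0 x"
  shows "solution \<sigma> lam Y Z \<longleftrightarrow> sol \<sigma>0 lam Y Z"
proof
  assume s: "solution \<sigma> lam Y Z"
  then have ac: "abs_continuous_on 0 pi Y" "abs_continuous_on 0 pi Z" by (auto simp: solution_def)
  have s1: "AE x in lebesgue_on {0<..<pi}. Y differentiable (at x) \<and> Z x = vector_derivative Y (at x) - \<sigma> x ** Y x"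
    using s by (auto simp: solution_def quasi_derivative_def)
  have s2: "AE x in lebesgue_on {0<..<pi}. Z differentiable (at x) \<and>
        - vector_derivative Z (at x) - \<sigma> x ** Z x - \<sigma> x ** \<sigma> x ** Y x = mat lam ** Y x"
    using s by (simp add: solution_def)
  have "AE x in lebesgue_on {0<..<pi}. (Y has_vector_derivative (\<sigma>0 x ** Y x + Z x)) (at x) \<and>
    (Z has_vector_derivative (- (\<sigma>0 x ** Z x) - \<sigma>0 x ** \<sigma>0 x ** Y x - mat lam ** Y x)) (at x)"
    using ae s1 s2
  proof eventually_elim
    case (elim x)
    have "vector_derivative Y (at x) = \<sigma>0 x ** Y x + Z x" using elim by (simp add: algebra_simps)
    moreover have "vector_derivative Z (at x) = - (\<sigma>0 x ** Z x) - \<sigma>0 x ** \<sigma>0 x ** Y x - mat lam ** Y x"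
    proof -
      have "mat lam ** Y x = - vector_derivative Z (at x) - \<sigma>0 x ** Z x - \<sigma>0 x ** \<sigma>0 x ** Y x" using elim by simp
      then show ?thesis by simp
    qed
    ultimately show ?case using elim vector_derivative_works by metis
  qed
  then obtain N where N: "negligible N" "\<And>x. x \<in> {0..pi} - N \<Longrightarrow> (Y has_vector_derivative (\<sigma>0 x ** Y x + Z x)) (at x) \<and>
    (Z has_vector_derivative (- (\<sigma>0 x ** Z x) - \<sigma>0 x ** \<sigma>0 x ** Y x - mat lam ** Y x)) (at x)"
    by (rule AE_Ioo_imp_negligible) blast
  have "(\<lambda>t. sol_field \<sigma>0 lam 1 t (Y t, Z t)) absolutely_integrable_on {0..pi}"
    by (rule L1_linear_field_integrable[OF sol_field_L1[OF \<sigma>0 order_refl]])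
      (intro continuous_intros abs_continuous_on_imp_continuous_on ac)
  then have i: "(\<lambda>t. \<sigma>0 t ** Y t + Z t) absolutely_integrable_on {0..pi}"
    "(\<lambda>t. - (\<sigma>0 t ** Z t) - \<sigma>0 t ** \<sigma>0 t ** Y t - mat lam ** Y t) absolutely_integrable_on {0..pi}"
    using absolutely_integrable_linear[OF _ bounded_linear_fst] absolutely_integrable_linear[OF _ bounded_linear_snd]
    by (fastforce simp: sol_field_def o_def)+
  show "sol \<sigma>0 lam Y Z"
    unfolding sol_def by (intro conjI L1_derivI[OF ac(1) i(1) N(1)] L1_derivI[OF ac(2) i(2) N(1)]) (use N(2) in auto)
next
  assume s: "sol \<sigma>0 lam Y Z"
  then have LY: "L1_deriv 0 pi Y (\<lambda>t. \<sigma>0 t ** Y t + Z t)"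
    and LZ: "L1_deriv 0 pi Z (\<lambda>t. - (\<sigma>0 t ** Z t) - \<sigma>0 t ** \<sigma>0 t ** Y t - mat lam ** Y t)" by (auto simp: sol_def)
  obtain N1 where N1: "negligible N1" "\<And>x. x \<in> {0<..<pi} - N1 \<Longrightarrow> (Y has_vector_derivative (\<sigma>0 x ** Y x + Z x)) (at x)"
    using L1_deriv_has_vector_derivative[OF LY] by blast
  obtain N2 where N2: "negligible N2" "\<And>x. x \<in> {0<..<pi} - N2 \<Longrightarrow> (Z has_vector_derivative (- (\<sigma>0 x ** Z x) - \<sigma>0 x ** \<sigma>0 x ** Y x - mat lam ** Y x)) (at x)"
    using L1_deriv_has_vector_derivative[OF LZ] by blast
  have a1: "AE x in lebesgue_on {0<..<pi}. (Y has_vector_derivative (\<sigma>0 x ** Y x + Z x)) (at x)"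
    unfolding AE_lebesgue_on_iff_negligible[OF sets_lebesgue_Ioo] using N1 by blast
  have a2: "AE x in lebesgue_on {0<..<pi}. (Z has_vector_derivative (- (\<sigma>0 x ** Z x) - \<sigma>0 x ** \<sigma>0 x ** Y x - mat lam ** Y x)) (at x)"
    unfolding AE_lebesgue_on_iff_negligible[OF sets_lebesgue_Ioo] using N2 by blast
  show "solution \<sigma> lam Y Z"
    unfolding solution_def quasi_derivative_def
  proof (intro conjI L1_deriv_abs_continuous[OF LY] L1_deriv_abs_continuous[OF LZ])
    show "AE x in lebesgue_on {0<..<pi}. Y differentiable at x \<and> Z x = vector_derivative Y (at x) - \<sigma> x ** Y x"
      using ae a1 by eventually_elim (auto simp: vector_derivative_at intro: differentiableI_vector)
    show "AE x in lebesgue_on {0<..<pi}. Z differentiable at x \<and>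
      - vector_derivative Z (at x) - \<sigma> x ** Z x - \<sigma> x ** \<sigma> x ** Y x = mat lam ** Y x"
      using ae a2 by eventually_elim (auto simp: vector_derivative_at intro: differentiableI_vector)
  qed
qed

lemma herm_L2_abs_integrable:
  assumes \<sigma>: "herm_L2 \<sigma>" shows "\<sigma> absolutely_integrable_on {0..pi}"
  by (rule measurable_bounded_by_integrable_imp_absolutely_integrable[of _ _ "\<lambda>t. norm (\<sigma> t)"])
    (use \<sigma> set_lebesgue_integral_eq_integral(1)[OF herm_L2_norm_integrable[OF \<sigma>]] in \<open>auto simp: herm_L2_def\<close>)

lemma herm_L2_reflect:
  assumes \<sigma>: "herm_L2 \<sigma>" shows "herm_L2 (\<lambda>t. - \<sigma> (pi - t))"
  unfolding herm_L2_def
proof (intro conjI allI)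
  have "(\<lambda>t. - \<sigma> (pi - t)) absolutely_integrable_on {0..pi}"
    by (rule L1_deriv_abs_integrable[OF L1_deriv_reflect[OF L1_deriv_indefinite_integral[OF herm_L2_abs_integrable[OF \<sigma>]]]])
  then show "(\<lambda>t. - \<sigma> (pi - t)) \<in> borel_measurable (lebesgue_on {0..pi})"
    by (simp add: absolutely_integrable_measurable)
  have "(\<lambda>t. (norm (\<sigma> t))\<^sup>2) absolutely_integrable_on {0..pi}" using \<sigma> by (simp add: herm_L2_def)
  from L1_deriv_abs_integrable[OF L1_deriv_minus[OF L1_deriv_reflect[OF L1_deriv_indefinite_integral[OF this]]]]
  show "(\<lambda>t. (norm (- \<sigma> (pi - t)))\<^sup>2) absolutely_integrable_on {0..pi}" by simp
  show "dagger (- \<sigma> (pi - t)) = - \<sigma> (pi - t)" for t using \<sigma> by (simp add: herm_L2_def dagger_minus)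
qed

text \<open>Reversing the interval changes the sign of the derivative, hence of the potential and of
  the quasi-derivative, but not of the squared potential or \<open>lam\<close>. Initial value
  results thus carry over to the endpoint \<open>pi\<close>.\<close>

lemma sol_reflect:
  assumes s: "sol \<sigma> lam Y Z"
  shows "sol (\<lambda>t. - \<sigma> (pi - t)) lam (\<lambda>t. Y (pi - t)) (\<lambda>t. - Z (pi - t))"
  unfolding sol_def
proof (intro conjI)
  have "L1_deriv 0 pi (\<lambda>t. Y (pi - t)) (\<lambda>t. - (\<sigma> (pi - t) ** Y (pi - t) + Z (pi - t)))"
    using s unfolding sol_def by (intro L1_deriv_reflect) auto
  then show "L1_deriv 0 pi (\<lambda>t. Y (pi - t)) (\<lambda>t. - \<sigma> (pi - t) ** Y (pi - t) + - Z (pi - t))"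
    by (rule L1_deriv_cong') (auto simp: mm.minus_left)
  have "L1_deriv 0 pi (\<lambda>t. - Z (pi - t)) (\<lambda>t. - (- (- (\<sigma> (pi - t) ** Z (pi - t)) - \<sigma> (pi - t) ** \<sigma> (pi - t) ** Y (pi - t) - mat lam ** Y (pi - t))))"
    using s unfolding sol_def by (intro L1_deriv_minus L1_deriv_reflect[of pi Z]) auto
  then show "L1_deriv 0 pi (\<lambda>t. - Z (pi - t)) (\<lambda>t. - ((- \<sigma> (pi - t)) ** (- Z (pi - t))) - (- \<sigma> (pi - t)) ** (- \<sigma> (pi - t)) ** Y (pi - t) - mat lam ** Y (pi - t))"
    by (rule L1_deriv_cong') (auto simp: mm.minus_left mm.minus_right)
qed

lemma sol_unique_end:
  assumes \<sigma>: "herm_L2 \<sigma>" and s: "sol \<sigma> lam Y Z" "sol \<sigma> lam Y' Z'" and e: "Y pi = Y' pi" "Z pi = Z' pi" and x: "x \<in> {0..pi}"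
  shows "Y x = Y' x" "Z x = Z' x"
  using sol_unique[OF herm_L2_reflect[OF \<sigma>] sol_reflect[OF s(1)] sol_reflect[OF s(2)], of "pi - x"] e x by auto

lemma sol_mult_right:
  assumes s: "sol \<sigma> lam Y Z"
  shows "sol \<sigma> lam (\<lambda>t. Y t ** c) (\<lambda>t. Z t ** c)"
  unfolding sol_def
proof (intro conjI)
  have "L1_deriv 0 pi (\<lambda>t. Y t ** c) (\<lambda>t. (\<sigma> t ** Y t + Z t) ** c)"
    using s unfolding sol_def by (intro L1_deriv_linear[OF _ mm.bounded_linear_left]) auto
  then show "L1_deriv 0 pi (\<lambda>t. Y t ** c) (\<lambda>t. \<sigma> t ** (Y t ** c) + Z t ** c)"
    by (rule L1_deriv_cong') (auto simp: mm.add_left matrix_mul_assoc)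
  have "L1_deriv 0 pi (\<lambda>t. Z t ** c) (\<lambda>t. (- (\<sigma> t ** Z t) - \<sigma> t ** \<sigma> t ** Y t - mat lam ** Y t) ** c)"
    using s unfolding sol_def by (intro L1_deriv_linear[OF _ mm.bounded_linear_left]) auto
  then show "L1_deriv 0 pi (\<lambda>t. Z t ** c) (\<lambda>t. - (\<sigma> t ** (Z t ** c)) - \<sigma> t ** \<sigma> t ** (Y t ** c) - mat lam ** (Y t ** c))"
    by (rule L1_deriv_cong') (auto simp: mm.diff_left mm.minus_left matrix_mul_assoc)
qed

lemma sol_add:
  assumes s: "sol \<sigma> lam Y Z" "sol \<sigma> lam Y' Z'"
  shows "sol \<sigma> lam (\<lambda>t. Y t + Y' t) (\<lambda>t. Z t + Z' t)"
  unfolding sol_def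
proof (intro conjI)
  have "L1_deriv 0 pi (\<lambda>t. Y t + Y' t) (\<lambda>t. (\<sigma> t ** Y t + Z t) + (\<sigma> t ** Y' t + Z' t))"
    using s unfolding sol_def by (intro L1_deriv_add) auto
  then show "L1_deriv 0 pi (\<lambda>t. Y t + Y' t) (\<lambda>t. \<sigma> t ** (Y t + Y' t) + (Z t + Z' t))"
    by (rule L1_deriv_cong') (auto simp: mm.add_right)
  have "L1_deriv 0 pi (\<lambda>t. Z t + Z' t) (\<lambda>t. (- (\<sigma> t ** Z t) - \<sigma> t ** \<sigma> t ** Y t - mat lam ** Y t) + (- (\<sigma> t ** Z' t) - \<sigma> t ** \<sigma> t ** Y' t - mat lam ** Y' t))"
    using s unfolding sol_def by (intro L1_deriv_add) auto
  then show "L1_deriv 0 pi (\<lambda>t. Z t + Z' t) (\<lambda>t. - (\<sigma> t ** (Z t + Z' t)) - \<sigma> t ** \<sigma> t ** (Y t + Y' t) - mat lam ** (Y t + Y' t))"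
    by (rule L1_deriv_cong') (auto simp: mm.add_right)
qed

lemma L1_deriv_const_on:
  assumes "L1_deriv a b f f'" "\<And>x. x \<in> {a..b} \<Longrightarrow> f' x = 0" "x \<in> {a..b}"
  shows "f x = f a"
proof -
  have "integral {a..x} f' = integral {a..x} (\<lambda>_. 0)" by (rule integral_cong) (use assms in auto)
  then show ?thesis using L1_derivD[OF assms(1,3)] by simp
qed

lemma L1_deriv_dagger: "L1_deriv a b f f' \<Longrightarrow> L1_deriv a b (\<lambda>x. dagger (f x)) (\<lambda>x. dagger (f' x))"
  by (erule L1_deriv_linear[OF _ bounded_linear_dagger])

text \<open>In the derivative the terms with the potential cancel because it is Hermitian, and the
  spectral terms cancel because the solution under the adjoint belongs to
  \<open>cnj lam\<close>.\<close>

lemma Wronskian_const: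
  assumes \<sigma>: "herm_L2 \<sigma>" and s: "sol \<sigma> lam Y Z" "sol \<sigma> (cnj lam) Y' Z'" and x: "x \<in> {0..pi}"
  shows "dagger (Y' x) ** Z x - dagger (Z' x) ** Y x = dagger (Y' 0) ** Z 0 - dagger (Z' 0) ** Y 0"
proof -
  have h: "dagger (\<sigma> t) = \<sigma> t" for t using \<sigma> by (simp add: herm_L2_def)
  note L = s[unfolded sol_def]
  have "L1_deriv 0 pi (\<lambda>x. dagger (Y' x) ** Z x - dagger (Z' x) ** Y x)
    (\<lambda>t. (dagger (Y' t) ** (- (\<sigma> t ** Z t) - \<sigma> t ** \<sigma> t ** Y t - mat lam ** Y t) + dagger (\<sigma> t ** Y' t + Z' t) ** Z t) -
         (dagger (Z' t) ** (\<sigma> t ** Y t + Z t) + dagger (- (\<sigma> t ** Z' t) - \<sigma> t ** \<sigma> t ** Y' t - mat (cnj lam) ** Y' t) ** Y t))"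
    by (intro L1_deriv_diff L1_deriv_bilinear[OF bounded_bilinear_matrix_mult] L1_deriv_dagger conjunct1[OF L(1)] conjunct2[OF L(1)] conjunct1[OF L(2)] conjunct2[OF L(2)])
  then show ?thesis
  proof (rule L1_deriv_const_on[OF _ _ x])
    fix t
    show "(dagger (Y' t) ** (- (\<sigma> t ** Z t) - \<sigma> t ** \<sigma> t ** Y t - mat lam ** Y t) + dagger (\<sigma> t ** Y' t + Z' t) ** Z t) -
         (dagger (Z' t) ** (\<sigma> t ** Y t + Z t) + dagger (- (\<sigma> t ** Z' t) - \<sigma> t ** \<sigma> t ** Y' t - mat (cnj lam) ** Y' t) ** Y t) = 0"
      by (simp add: dagger_add dagger_diff dagger_minus dagger_mult h mm.add_left mm.add_right mm.diff_left mm.diff_right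
          mm.minus_left mm.minus_right matrix_mul_assoc)
  qed
qed

section \<open>Asymptotics of solutions for large spectral parameter\<close>

lemma L1_deriv_norm_diff_le:
  assumes L: "L1_deriv a b F f" and x: "x \<in> {a..b}" and h: "h integrable_on {a..b}"
    and le: "\<And>t. t \<in> {a..x} \<Longrightarrow> norm (f t) \<le> h t"
  shows "norm (F x - F a) \<le> integral {a..x} h"
proof -
  have "F x - F a = integral {a..x} f" using L1_deriv_diff_eq_integral[OF L, of a x] x by auto
  also have "norm \<dots> \<le> integral {a..x} h"
    using x le by (intro integral_norm_bound_integral integrable_subinterval_real[OF L1_deriv_integrable[OF L]]
        integrable_subinterval_real[OF h]) auto
  finally show ?thesis .
qed

lemma L1_deriv_mat_exp: "L1_deriv a b (\<lambda>t. mat (exp (c * of_real t)) :: complex^'m^'m) (\<lambda>t. mat (c * exp (c * of_real t)))"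
proof -
  have "bounded_linear (mat :: complex \<Rightarrow> complex^'m^'m)"
  proof (rule bounded_linear_intro[of _ "norm (mat 1 :: complex^'m^'m)"])
    fix x y :: complex and r :: real
    show "(mat (x + y) :: complex^'m^'m) = mat x + mat y" "(mat (r *\<^sub>R x) :: complex^'m^'m) = r *\<^sub>R mat x"
      by (auto simp: mat_def vec_eq_iff)
    show "norm (mat x :: complex^'m^'m) \<le> norm x * norm (mat 1 :: complex^'m^'m)"
      using norm_mat_mult[of x "mat 1 :: complex^'m^'m"] by simp
  qed
  moreover have "L1_deriv a b (\<lambda>t. exp (c * of_real t)) (\<lambda>t. c * exp (c * of_real t))"
  proof (rule L1_deriv_C1)
    fix x :: real
    have "((\<lambda>z. exp (c * z)) has_field_derivative (c * exp (c * of_real x))) (at (of_real x))"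
      by (auto intro!: derivative_eq_intros)
    then show "((\<lambda>t. exp (c * of_real t)) has_vector_derivative (c * exp (c * of_real x))) (at x within {a..b})"
      by (rule has_vector_derivative_real_field)
  qed (intro continuous_intros)
  ultimately show ?thesis using L1_deriv_linear by blast
qed

text \<open>The rate \<open>4 * k\<close> is that of the square of \<open>exp (- 2 * k * t)\<close>,
  the kernel linking the growing and the decaying component in the estimate below.\<close>

lemma integral_exp_le:
  fixes k x :: real
  assumes "k > 0" "x \<ge> 0"
  shows "integral {0..x} (\<lambda>t. exp (- 4 * k * t)) \<le> 1 / (4 * k)"
    and "integral {0..x} (\<lambda>t. exp (- 4 * k * (x - t))) \<le> 1 / (4 * k)"
proof -
  have "((\<lambda>t. exp (- 4 * k * t)) has_integral (- exp (- 4 * k * x) / (4 * k) - (- exp (- 4 * k * 0) / (4 * k)))) {0..x}"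
    by (rule fundamental_theorem_of_calculus[OF assms(2)])
      (use assms in \<open>auto intro!: derivative_eq_intros simp flip: has_real_derivative_iff_has_vector_derivative\<close>)
  then show "integral {0..x} (\<lambda>t. exp (- 4 * k * t)) \<le> 1 / (4 * k)"
    using assms by (simp add: integral_unique)
  have "((\<lambda>t. exp (- 4 * k * (x - t))) has_integral (exp (- 4 * k * (x - x)) / (4 * k) - exp (- 4 * k * (x - 0)) / (4 * k))) {0..x}"
    by (rule fundamental_theorem_of_calculus[OF assms(2)])
      (use assms in \<open>auto intro!: derivative_eq_intros simp flip: has_real_derivative_iff_has_vector_derivative\<close>)
  then show "integral {0..x} (\<lambda>t. exp (- 4 * k * (x - t))) \<le> 1 / (4 * k)"
    using assms by (simp add: integral_unique)
qed

text \<open>Square integrability makes the convolution with a decaying exponential of rate \<open>q\<close> as small as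
  \<open>1 / sqrt q\<close>; \<open>w\<close> is the arithmetic-geometric majorant of the integrand.\<close>

lemma kernel_bound:
  fixes s e :: "real \<Rightarrow> real"
  assumes q: "q \<ge> 1" and x: "x \<in> {0..pi}" and s2: "(\<lambda>t. (s t)\<^sup>2) integrable_on {0..pi}"
    and e: "continuous_on {0..pi} e" and e2: "integral {0..x} (\<lambda>t. (e t)\<^sup>2) \<le> 1 / (2 * q)"
  defines "w \<equiv> \<lambda>t. (sqrt q * (e t)\<^sup>2 + (s t)\<^sup>2 / sqrt q) / 2"
  shows "w integrable_on {0..pi}" "e t * s t \<le> w t"
    "integral {0..x} w \<le> (1 + integral {0..pi} (\<lambda>t. (s t)\<^sup>2)) / sqrt q"
proof -
  have e2i: "(\<lambda>t. (e t)\<^sup>2) integrable_on {0..pi}"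
    using e by (intro integrable_continuous_real continuous_intros)
  show "w integrable_on {0..pi}"
    unfolding w_def by (intro integrable_on_divide integrable_add integrable_on_mult_right e2i s2)
  define r where "r = sqrt q"
  have r: "r > 0" "r * r = q" using q by (auto simp: r_def)
  have "0 \<le> (r * e t - s t)\<^sup>2 / r" using r by simp
  also have "\<dots> = r * (e t)\<^sup>2 + (s t)\<^sup>2 / r - 2 * (e t * s t)"
    using r by (simp add: power2_eq_square field_simps)
  finally show "e t * s t \<le> w t" unfolding w_def r_def[symmetric] by simp
  have sub: "f integrable_on {0..x}" if "f integrable_on {0..pi}" for f :: "real \<Rightarrow> real"
    using that by (rule integrable_subinterval_real) (use x in auto)
  have "integral {0..x} w = (r * integral {0..x} (\<lambda>t. (e t)\<^sup>2) + integral {0..x} (\<lambda>t. (s t)\<^sup>2) / r) / 2"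
    unfolding w_def r_def[symmetric] using sub[OF e2i] sub[OF s2] by (simp add: integral_add integrable_on_divide integrable_on_mult_right)
  also have "\<dots> \<le> (r * (1 / (2 * q)) + integral {0..pi} (\<lambda>t. (s t)\<^sup>2) / r) / 2"
    using r e2 by (intro divide_right_mono add_mono mult_left_mono integral_subset_le sub s2) (use x in auto)
  also have "r * (1 / (2 * q)) = (1/2) / r" using r by (simp add: field_simps) (simp flip: r(2))
  also have "((1/2) / r + integral {0..pi} (\<lambda>t. (s t)\<^sup>2) / r) / 2 = (1/2 + integral {0..pi} (\<lambda>t. (s t)\<^sup>2)) / 2 / r"
    by (simp add: add_divide_distrib)
  also have "\<dots> \<le> (1 + integral {0..pi} (\<lambda>t. (s t)\<^sup>2)) / r"
    using r integral_nonneg[OF s2] by (intro divide_right_mono) auto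
  finally show "integral {0..x} w \<le> (1 + integral {0..pi} (\<lambda>t. (s t)\<^sup>2)) / sqrt q" by (simp add: r_def)
qed

text \<open>The system reads a' = kappa a + sigma b - sigma^2 Y and b' = - kappa b + sigma a +
  sigma^2 Y. Measured on the scale exp(kappa x), the coupling of \<open>b\<close> to
  \<open>a\<close> carries the kernel exp(-2 kappa (x - t)), and the coupling of \<open>a\<close> to
  \<open>b\<close> sees the transient exp(-2 kappa t) of \<open>b\<close>. Square integrability
  turns both into a factor 1/sqrt|kappa|. The suprema of the scaled components are then bounded by
  absorption.\<close>

lemma asymptotic_estimate:
  fixes \<sigma> :: "real \<Rightarrow> complex^'m^'m" and Y Z :: "real \<Rightarrow> complex^'n^'m"
  assumes \<sigma>: "herm_L2 \<sigma>" and sol: "sol \<sigma> (- (\<kappa>\<^sup>2)) Y Z"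
    and q1: "cmod \<kappa> \<ge> 1" and k: "Re \<kappa> \<ge> cmod \<kappa> / 2"
  defines "a \<equiv> \<lambda>t. mat \<kappa> ** Y t + Z t" and "b \<equiv> \<lambda>t. mat \<kappa> ** Y t - Z t"
    and "S1 \<equiv> integral {0..pi} (\<lambda>t. norm (\<sigma> t))" and "S2 \<equiv> integral {0..pi} (\<lambda>t. (norm (\<sigma> t))\<^sup>2)"
  defines "D \<equiv> (1 + 2 * S2) * (2 + S1)"
  assumes D: "4 * D \<le> sqrt (cmod \<kappa>)" and x: "x \<in> {0..pi}"
  shows "norm (mat (exp (- \<kappa> * x)) ** a x - a 0) \<le> 4 * D / sqrt (cmod \<kappa>) * (norm (a 0) + norm (b 0))"
    "norm (mat (exp (- \<kappa> * x)) ** b x - mat (exp (- 2 * \<kappa> * x)) ** b 0) \<le> 4 * D / sqrt (cmod \<kappa>) * (norm (a 0) + norm (b 0))"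
proof -
  define q where "q = cmod \<kappa>"
  define s where "s t = norm (\<sigma> t)" for t
  define r where "r = sqrt q"
  have q: "q \<ge> 1" and kq: "Re \<kappa> \<ge> q / 2" using q1 k by (auto simp: q_def)
  have k0: "Re \<kappa> > 0" using q kq by linarith
  have r: "r \<ge> 1" "r * r = q" "r > 0" using q by (auto simp: r_def)
  have rq: "1 / q \<le> 1 / r" using r q by (intro divide_left_mono) (auto simp: mult_le_cancel_left1 simp flip: r(2))
  have k4: "1 / (4 * Re \<kappa>) \<le> 1 / (2 * q)" using kq q by (intro divide_left_mono) auto
  have \<kappa>0: "\<kappa> \<noteq> 0" using q by (auto simp: q_def)
  have s0: "0 \<le> s t" for t by (simp add: s_def)
  have si: "s integrable_on {0..pi}" and s2i: "(\<lambda>t. (s t)\<^sup>2) integrable_on {0..pi}"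
    using herm_L2_norm_integrable[OF \<sigma>] \<sigma> set_lebesgue_integral_eq_integral(1) unfolding s_def herm_L2_def by blast+
  have S1: "S1 = integral {0..pi} s" and S2: "S2 = integral {0..pi} (\<lambda>t. (s t)\<^sup>2)" by (auto simp: S1_def S2_def s_def[abs_def])
  have S1p: "S1 \<ge> 0" and S2p: "S2 \<ge> 0" unfolding S1 S2 using s0 by (auto intro!: integral_nonneg si s2i)
  have LY: "L1_deriv 0 pi Y (\<lambda>t. \<sigma> t ** Y t + Z t)"
    and LZ: "L1_deriv 0 pi Z (\<lambda>t. - (\<sigma> t ** Z t) - \<sigma> t ** \<sigma> t ** Y t - mat (- (\<kappa>\<^sup>2)) ** Y t)" using sol by (auto simp: sol_def)
  have cc: "continuous_on {0..pi} a" "continuous_on {0..pi} b"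
    unfolding a_def b_def using L1_deriv_continuous[OF LY] L1_deriv_continuous[OF LZ]
    by (auto intro!: continuous_intros mm.continuous_on)
  have LkY: "L1_deriv 0 pi (\<lambda>t. mat \<kappa> ** Y t) (\<lambda>t. mat \<kappa> ** (\<sigma> t ** Y t + Z t))"
    by (rule L1_deriv_linear[OF LY mm.bounded_linear_right])
  have mm2: "mat (- (\<kappa>\<^sup>2)) ** P = - (mat \<kappa> ** (mat \<kappa> ** P))" for P :: "complex^'n^'m"
    by (simp add: vec_eq_iff power2_eq_square)
  have La: "L1_deriv 0 pi a (\<lambda>t. mat \<kappa> ** a t + (\<sigma> t ** b t - \<sigma> t ** \<sigma> t ** Y t))"
    unfolding a_def by (rule L1_deriv_cong'[OF L1_deriv_add[OF LkY LZ] refl])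
      (simp add: b_def mm2 mm.add_right mm.diff_right mult_mat_left_commute[of "\<sigma> _"])
  have Lb: "L1_deriv 0 pi b (\<lambda>t. - (mat \<kappa> ** b t) + (\<sigma> t ** a t + \<sigma> t ** \<sigma> t ** Y t))"
    unfolding b_def by (rule L1_deriv_cong'[OF L1_deriv_diff[OF LkY LZ] refl])
      (simp add: a_def mm2 mm.add_right mm.diff_right mult_mat_left_commute[of "\<sigma> _"])
  define \<alpha> where "\<alpha> t = mat (exp (- \<kappa> * of_real t)) ** a t" for t
  \<comment> \<open>\<open>\<beta>2\<close> removes the own exponential of \<open>b\<close>, so its
    derivative contains coupling terms only. \<open>\<beta>\<close> measures \<open>b\<close> on the
    scale of \<open>a\<close>; it is \<open>\<beta>2\<close> times exp(-2 kappa t), which creates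
    the kernel.\<close>
  define \<beta>2 where "\<beta>2 t = mat (exp (\<kappa> * of_real t)) ** b t" for t
  define \<beta> where "\<beta> t = mat (exp (- \<kappa> * of_real t)) ** b t" for t
  have n\<alpha>: "norm (\<alpha> t) = exp (- Re \<kappa> * t) * norm (a t)" and n\<beta>: "norm (\<beta> t) = exp (- Re \<kappa> * t) * norm (b t)" for t
    by (auto simp: \<alpha>_def \<beta>_def norm_mat_mult)
  have L\<alpha>: "L1_deriv 0 pi \<alpha> (\<lambda>t. mat (exp (- \<kappa> * of_real t)) ** (\<sigma> t ** b t - \<sigma> t ** \<sigma> t ** Y t))"
    unfolding \<alpha>_def
    by (rule L1_deriv_cong'[OF L1_deriv_bilinear[OF bounded_bilinear_matrix_mult L1_deriv_mat_exp La] refl])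
      (auto simp: mm.add_right mm.diff_right vec_eq_iff algebra_simps)
  have L\<beta>2: "L1_deriv 0 pi \<beta>2 (\<lambda>t. mat (exp (\<kappa> * of_real t)) ** (\<sigma> t ** a t + \<sigma> t ** \<sigma> t ** Y t))"
    unfolding \<beta>2_def
    by (rule L1_deriv_cong'[OF L1_deriv_bilinear[OF bounded_bilinear_matrix_mult L1_deriv_mat_exp Lb] refl])
      (auto simp: mm.add_right mm.minus_right vec_eq_iff algebra_simps)
  have cn: "continuous_on {0..pi} (\<lambda>t. norm (\<alpha> t))" "continuous_on {0..pi} (\<lambda>t. norm (\<beta> t))"
    unfolding n\<alpha> n\<beta> using cc by (auto intro!: continuous_intros)
  obtain xm where xm: "xm \<in> {0..pi}" "\<forall>y\<in>{0..pi}. norm (\<alpha> y) \<le> norm (\<alpha> xm)"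
    using continuous_attains_sup[OF _ _ cn(1)] by auto
  obtain xn where xn: "xn \<in> {0..pi}" "\<forall>y\<in>{0..pi}. norm (\<beta> y) \<le> norm (\<beta> xn)"
    using continuous_attains_sup[OF _ _ cn(2)] by auto
  define m where "m = norm (\<alpha> xm)"
  define n where "n = norm (\<beta> xn)"
  have m: "norm (\<alpha> y) \<le> m" and n: "norm (\<beta> y) \<le> n" if "y \<in> {0..pi}" for y using xm xn that by (auto simp: m_def n_def)
  have m0: "m \<ge> 0" and n0: "n \<ge> 0" by (auto simp: m_def n_def)
  define B0 where "B0 = norm (b 0)"
  have B0: "B0 \<ge> 0" by (simp add: B0_def)
  define T where "T = m + n + B0"
  have T0: "T \<ge> 0" using m0 n0 B0 by (simp add: T_def)
  \<comment> \<open>Since \<open>a + b\<close> is \<open>2 * \<kappa>\<close> times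
    \<open>Y\<close>, the quadratic term in the potential gains a full factor \<open>1 / q\<close>
    and needs no kernel.\<close>
  have nY: "exp (- Re \<kappa> * t) * norm (Y t) \<le> (m + n) / (2 * q)" if "t \<in> {0..pi}" for t
  proof -
    have "a t + b t = mat (2 * \<kappa>) ** Y t" by (simp add: a_def b_def vec_eq_iff)
    then have "2 * q * norm (Y t) = norm (a t + b t)" by (simp add: norm_mat_mult q_def norm_mult)
    also have "\<dots> \<le> norm (a t) + norm (b t)" by (rule norm_triangle_ineq)
    finally have "exp (- Re \<kappa> * t) * (2 * q * norm (Y t)) \<le> exp (- Re \<kappa> * t) * (norm (a t) + norm (b t))"
      by (rule mult_left_mono) simp
    also have "\<dots> = norm (\<alpha> t) + norm (\<beta> t)" by (simp add: n\<alpha> n\<beta> distrib_left)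
    also have "\<dots> \<le> m + n" using m[OF that] n[OF that] by simp
    finally show ?thesis using q by (simp add: field_simps)
  qed
  have n\<sigma>: "norm (\<sigma> t ** P) \<le> s t * norm P" for t and P :: "complex^'n^'m"
    unfolding s_def by (rule norm_matrix_mult_le)
  have n\<sigma>2: "norm (\<sigma> t ** \<sigma> t ** P) \<le> (s t)\<^sup>2 * norm P" for t and P :: "complex^'n^'m"
    using n\<sigma>[of t "\<sigma> t ** P"] mult_left_mono[OF n\<sigma>[of t P] s0[of t]]
    by (simp add: matrix_mul_assoc power2_eq_square mult.assoc)
  have qterm: "exp (- Re \<kappa> * t) * norm (\<sigma> t ** \<sigma> t ** Y t) \<le> (s t)\<^sup>2 * ((m + n) / (2 * q))" if "t \<in> {0..pi}" for t
  proof -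
    have "exp (- Re \<kappa> * t) * norm (\<sigma> t ** \<sigma> t ** Y t) \<le> exp (- Re \<kappa> * t) * ((s t)\<^sup>2 * norm (Y t))"
      by (intro mult_left_mono n\<sigma>2) simp
    also have "\<dots> = (s t)\<^sup>2 * (exp (- Re \<kappa> * t) * norm (Y t))" by simp
    also have "\<dots> \<le> (s t)\<^sup>2 * ((m + n) / (2 * q))" using nY[OF that] by (intro mult_left_mono) auto
    finally show ?thesis .
  qed
  have sub: "f integrable_on {0..x}" if "f integrable_on {0..pi}" "x \<in> {0..pi}" for f :: "real \<Rightarrow> real" and x
    using that(1) by (rule integrable_subinterval_real) (use that(2) in auto)
  have S2x: "integral {0..x} (\<lambda>t. (s t)\<^sup>2) \<le> S2" and S1x: "integral {0..x} s \<le> S1" if "x \<in> {0..pi}" for x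
    unfolding S1 S2 using that s0 by (auto intro!: integral_subset_le sub si s2i)
  have qq: "S2 * ((m + n) / (2 * q)) \<le> S2 / r * T"
  proof -
    have "S2 * ((m + n) / (2 * q)) = S2 * (1/q) * ((m + n) / 2)" by simp
    also have "\<dots> \<le> S2 * (1/r) * T" using rq S2p m0 n0 B0 r by (intro mult_mono) (auto simp: T_def)
    finally show ?thesis by simp
  qed
  have bet: "norm (\<beta> x - mat (exp (- 2 * \<kappa> * of_real x)) ** b 0) \<le> (1 + 2 * S2) / r * T" if x: "x \<in> {0..pi}" for x
  proof -
    let ?e = "\<lambda>t. exp (- 2 * Re \<kappa> * (x - t))"
    let ?w = "\<lambda>t. (sqrt q * (?e t)\<^sup>2 + (s t)\<^sup>2 / sqrt q) / 2"
    have "integral {0..x} (\<lambda>t. (?e t)\<^sup>2) \<le> 1 / (2 * q)"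
      using integral_exp_le(2)[OF k0, of x] k4 x by (simp add: exp_double[symmetric] mult.assoc)
    note kb = kernel_bound[OF q x s2i _ this]
    have w: "?w integrable_on {0..pi}" "\<And>t. ?e t * s t \<le> ?w t" "integral {0..x} ?w \<le> (1 + S2) / r"
      unfolding S2 r_def by (rule kb; intro continuous_intros)+
    let ?h = "\<lambda>t. exp (2 * Re \<kappa> * x) * (m * ?w t + (s t)\<^sup>2 * ((m + n) / (2 * q)))"
    have "norm (\<beta>2 x - \<beta>2 0) \<le> integral {0..x} ?h"
    proof (rule L1_deriv_norm_diff_le[OF L\<beta>2 x])
      show "?h integrable_on {0..pi}" by (intro integrable_on_mult_right integrable_add w s2i integrable_on_mult_left)
      fix t assume t: "t \<in> {0..x}"
      then have t': "t \<in> {0..pi}" using x by auto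
      have "norm (mat (exp (\<kappa> * of_real t)) ** (\<sigma> t ** a t + \<sigma> t ** \<sigma> t ** Y t)) =
        exp (Re \<kappa> * t) * norm (\<sigma> t ** a t + \<sigma> t ** \<sigma> t ** Y t)" by (simp add: norm_mat_mult)
      also have "\<dots> = exp (2 * Re \<kappa> * t) * (exp (- Re \<kappa> * t) * norm (\<sigma> t ** a t + \<sigma> t ** \<sigma> t ** Y t))"
        by (simp add: mult.assoc[symmetric] exp_add[symmetric])
      also have "\<dots> \<le> exp (2 * Re \<kappa> * t) * (exp (- Re \<kappa> * t) * (norm (\<sigma> t ** a t) + norm (\<sigma> t ** \<sigma> t ** Y t)))"
        by (intro mult_left_mono norm_triangle_ineq) auto
      also have "\<dots> = exp (2 * Re \<kappa> * t) * (exp (- Re \<kappa> * t) * norm (\<sigma> t ** a t) + exp (- Re \<kappa> * t) * norm (\<sigma> t ** \<sigma> t ** Y t))"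
        by (simp add: distrib_left)
      also have "\<dots> \<le> exp (2 * Re \<kappa> * t) * (s t * m + (s t)\<^sup>2 * ((m + n) / (2 * q)))"
      proof (intro mult_left_mono add_mono qterm t')
        have "exp (- Re \<kappa> * t) * norm (\<sigma> t ** a t) \<le> exp (- Re \<kappa> * t) * (s t * norm (a t))" by (intro mult_left_mono n\<sigma>) simp
        also have "\<dots> = s t * norm (\<alpha> t)" by (simp add: n\<alpha>)
        also have "\<dots> \<le> s t * m" using m[OF t'] s0 by (intro mult_left_mono) auto
        finally show "exp (- Re \<kappa> * t) * norm (\<sigma> t ** a t) \<le> s t * m" .
      qed simp
      also have "\<dots> = exp (2 * Re \<kappa> * x) * (m * (?e t * s t) + ?e t * ((s t)\<^sup>2 * ((m + n) / (2 * q))))"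
      proof -
        have "exp (2 * Re \<kappa> * t) = exp (2 * Re \<kappa> * x) * ?e t" by (simp add: exp_add[symmetric] algebra_simps)
        then show ?thesis by (simp only: distrib_left mult_ac)
      qed
      also have "\<dots> \<le> exp (2 * Re \<kappa> * x) * (m * ?w t + 1 * ((s t)\<^sup>2 * ((m + n) / (2 * q))))"
        using t k0 m0 n0 q by (intro mult_left_mono[OF add_mono] mult_left_mono[OF w(2)] mult_right_mono) auto
      finally show "norm (mat (exp (\<kappa> * of_real t)) ** (\<sigma> t ** a t + \<sigma> t ** \<sigma> t ** Y t)) \<le> ?h t" by simp
    qed
    also have "\<dots> = exp (2 * Re \<kappa> * x) * (m * integral {0..x} ?w + integral {0..x} (\<lambda>t. (s t)\<^sup>2) * ((m + n) / (2 * q)))"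
    proof -
      have "integral {0..x} (\<lambda>t. m * ?w t + (s t)\<^sup>2 * ((m + n) / (2 * q))) =
        integral {0..x} (\<lambda>t. m * ?w t) + integral {0..x} (\<lambda>t. (s t)\<^sup>2 * ((m + n) / (2 * q)))"
        by (intro integral_add integrable_on_mult_right integrable_on_mult_left sub[OF w(1) x] sub[OF s2i x])
      then show ?thesis by (simp only: integral_mult_right integral_mult_left)
    qed
    also have "\<dots> \<le> exp (2 * Re \<kappa> * x) * (m * ((1 + S2) / r) + S2 * ((m + n) / (2 * q)))"
      using w(3) S2x[OF x] m0 n0 q by (intro mult_left_mono add_mono mult_right_mono) auto
    also have "\<dots> \<le> exp (2 * Re \<kappa> * x) * ((1 + S2) / r * T + S2 / r * T)"
    proof (intro mult_left_mono add_mono qq)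
      have "m * ((1 + S2) / r) \<le> T * ((1 + S2) / r)" using m0 n0 B0 S2p r by (intro mult_right_mono) (auto simp: T_def)
      then show "m * ((1 + S2) / r) \<le> (1 + S2) / r * T" by (simp add: mult.commute)
    qed simp
    also have "(1 + S2) / r * T + S2 / r * T = (1 + 2 * S2) / r * T" by (simp add: add_divide_distrib distrib_right)
    finally have 1: "norm (\<beta>2 x - \<beta>2 0) \<le> exp (2 * Re \<kappa> * x) * ((1 + 2 * S2) / r * T)" .
    have "\<beta> x - mat (exp (- 2 * \<kappa> * of_real x)) ** b 0 = mat (exp (- 2 * \<kappa> * of_real x)) ** (\<beta>2 x - \<beta>2 0)"
    proof -
      have "exp (- 2 * \<kappa> * of_real x) * exp (\<kappa> * of_real x) = exp (- \<kappa> * of_real x)"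
        by (simp add: exp_add[symmetric])
      then show ?thesis by (simp add: \<beta>_def \<beta>2_def mm.diff_right mat_mult_mat)
    qed
    then have 2: "norm (\<beta> x - mat (exp (- 2 * \<kappa> * of_real x)) ** b 0) = exp (- (2 * Re \<kappa> * x)) * norm (\<beta>2 x - \<beta>2 0)"
      by (simp add: norm_mat_mult)
    have "norm (\<beta> x - mat (exp (- 2 * \<kappa> * of_real x)) ** b 0) \<le> exp (- (2 * Re \<kappa> * x)) * (exp (2 * Re \<kappa> * x) * ((1 + 2 * S2) / r * T))"
      unfolding 2 by (rule mult_left_mono[OF 1]) simp
    then show ?thesis by (simp add: mult.assoc[symmetric] exp_add[symmetric])
  qed
  have alp: "norm (\<alpha> x - a 0) \<le> (1 + 2 * S2) * (1 + S1) / r * T" if x: "x \<in> {0..pi}" for x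
  proof -
    let ?e = "\<lambda>t. exp (- 2 * Re \<kappa> * t)"
    let ?w = "\<lambda>t. (sqrt q * (?e t)\<^sup>2 + (s t)\<^sup>2 / sqrt q) / 2"
    have "integral {0..x} (\<lambda>t. (?e t)\<^sup>2) \<le> 1 / (2 * q)"
      using integral_exp_le(1)[OF k0, of x] k4 x by (simp add: exp_double[symmetric] mult.assoc)
    note kb = kernel_bound[OF q x s2i _ this]
    have w: "?w integrable_on {0..pi}" "\<And>t. ?e t * s t \<le> ?w t" "integral {0..x} ?w \<le> (1 + S2) / r"
      unfolding S2 r_def by (rule kb; intro continuous_intros)+
    \<comment> \<open>\<open>E\<close> is the error just proved for \<open>\<beta>\<close>. The
      transient of \<open>b\<close> is treated with the kernel bound, the remainder \<open>E\<close>
      only with the integral of the norm of the potential; hence the factor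
      \<open>1 + S1\<close>.\<close>
    define E where "E = (1 + 2 * S2) / r * T"
    have E0: "E \<ge> 0" unfolding E_def using S2p r T0 by simp
    let ?h = "\<lambda>t. B0 * ?w t + s t * E + (s t)\<^sup>2 * ((m + n) / (2 * q))"
    have "norm (\<alpha> x - \<alpha> 0) \<le> integral {0..x} ?h"
    proof (rule L1_deriv_norm_diff_le[OF L\<alpha> x])
      show "?h integrable_on {0..pi}" by (intro integrable_add integrable_on_mult_right w s2i si integrable_on_mult_left)
      fix t assume t: "t \<in> {0..x}"
      then have t': "t \<in> {0..pi}" using x by auto
      have "norm (mat (exp (- \<kappa> * of_real t)) ** (\<sigma> t ** b t - \<sigma> t ** \<sigma> t ** Y t)) =
        exp (- Re \<kappa> * t) * norm (\<sigma> t ** b t - \<sigma> t ** \<sigma> t ** Y t)" by (simp add: norm_mat_mult)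
      also have "\<dots> \<le> exp (- Re \<kappa> * t) * (norm (\<sigma> t ** b t) + norm (\<sigma> t ** \<sigma> t ** Y t))"
        by (intro mult_left_mono norm_triangle_ineq4) auto
      also have "\<dots> = exp (- Re \<kappa> * t) * norm (\<sigma> t ** b t) + exp (- Re \<kappa> * t) * norm (\<sigma> t ** \<sigma> t ** Y t)"
        by (simp add: distrib_left)
      also have "\<dots> \<le> (B0 * ?w t + s t * E) + (s t)\<^sup>2 * ((m + n) / (2 * q))"
      proof (intro add_mono[OF _ qterm] t')
        have "exp (- Re \<kappa> * t) * norm (\<sigma> t ** b t) \<le> exp (- Re \<kappa> * t) * (s t * norm (b t))" by (intro mult_left_mono n\<sigma>) simp
        also have "\<dots> = s t * norm (\<beta> t)" by (simp add: n\<beta>)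
        also have "\<dots> \<le> s t * (?e t * B0 + E)"
        proof (rule mult_left_mono[OF _ s0])
          have "norm (\<beta> t) \<le> norm (mat (exp (- 2 * \<kappa> * of_real t)) ** b 0) + norm (\<beta> t - mat (exp (- 2 * \<kappa> * of_real t)) ** b 0)"
            by (metis add_diff_cancel_left' diff_add_cancel norm_triangle_ineq add.commute)
          also have "norm (mat (exp (- 2 * \<kappa> * of_real t)) ** b 0) = ?e t * B0" by (simp add: norm_mat_mult B0_def)
          finally show "norm (\<beta> t) \<le> ?e t * B0 + E" using bet[OF t'] unfolding E_def by linarith
        qed
        also have "\<dots> = B0 * (?e t * s t) + s t * E" by (simp add: algebra_simps)
        also have "\<dots> \<le> B0 * ?w t + s t * E" using w(2)[of t] B0 by (intro add_right_mono mult_left_mono) auto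
        finally show "exp (- Re \<kappa> * t) * norm (\<sigma> t ** b t) \<le> B0 * ?w t + s t * E" .
      qed
      finally show "norm (mat (exp (- \<kappa> * of_real t)) ** (\<sigma> t ** b t - \<sigma> t ** \<sigma> t ** Y t)) \<le> ?h t" .
    qed
    also have "\<dots> = B0 * integral {0..x} ?w + integral {0..x} s * E + integral {0..x} (\<lambda>t. (s t)\<^sup>2) * ((m + n) / (2 * q))"
    proof -
      have "integral {0..x} ?h = integral {0..x} (\<lambda>t. B0 * ?w t + s t * E) + integral {0..x} (\<lambda>t. (s t)\<^sup>2 * ((m + n) / (2 * q)))"
        by (intro integral_add integrable_add integrable_on_mult_right integrable_on_mult_left sub[OF w(1) x] sub[OF s2i x] sub[OF si x])
      also have "integral {0..x} (\<lambda>t. B0 * ?w t + s t * E) = integral {0..x} (\<lambda>t. B0 * ?w t) + integral {0..x} (\<lambda>t. s t * E)"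
        by (intro integral_add integrable_on_mult_right integrable_on_mult_left sub[OF w(1) x] sub[OF si x])
      finally show ?thesis by (simp only: integral_mult_right integral_mult_left)
    qed
    also have "\<dots> \<le> B0 * ((1 + S2) / r) + S1 * E + S2 * ((m + n) / (2 * q))"
      using w(3) S2x[OF x] S1x[OF x] m0 n0 q B0 E0 by (intro add_mono mult_left_mono mult_right_mono) auto
    also have "\<dots> \<le> (1 + S2) / r * T + S1 * E + S2 / r * T"
    proof (intro add_mono qq order_refl)
      have "B0 * ((1 + S2) / r) \<le> T * ((1 + S2) / r)" using m0 n0 B0 S2p r by (intro mult_right_mono) (auto simp: T_def)
      then show "B0 * ((1 + S2) / r) \<le> (1 + S2) / r * T" by (simp add: mult.commute)
    qed
    also have "\<dots> = (1 + 2 * S2) * (1 + S1) / r * T" by (simp add: E_def add_divide_distrib algebra_simps)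
    finally show ?thesis by (simp add: \<alpha>_def)
  qed
  \<comment> \<open>\<open>\<delta>\<close> dominates both error coefficients, and the lower bound
    on \<open>cmod \<kappa>\<close> gives \<open>4 * \<delta> \<le> 1\<close>, so that
    \<open>\<delta> * T\<close> can be absorbed.\<close>
  define \<delta> where "\<delta> = D / r"
  have \<delta>: "0 \<le> \<delta>" "4 * \<delta> \<le> 1"
    using D r S1p S2p by (auto simp: \<delta>_def D_def r_def q_def)
  have bet': "norm (\<beta> x - mat (exp (- 2 * \<kappa> * of_real x)) ** b 0) \<le> \<delta> * T" if "x \<in> {0..pi}" for x
  proof -
    have "(1 + 2 * S2) / r * T \<le> \<delta> * T" unfolding \<delta>_def D_def
      using S1p S2p r T0 by (intro mult_right_mono divide_right_mono) (auto simp: mult_le_cancel_left1)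
    with bet[OF that] show ?thesis by linarith
  qed
  have alp': "norm (\<alpha> x - a 0) \<le> \<delta> * T" if "x \<in> {0..pi}" for x
  proof -
    have "(1 + 2 * S2) * (1 + S1) / r * T \<le> \<delta> * T" unfolding \<delta>_def D_def
      using S1p S2p r T0 by (intro mult_right_mono divide_right_mono mult_left_mono) auto
    with alp[OF that] show ?thesis by linarith
  qed
  have "m \<le> norm (a 0) + \<delta> * T"
    using alp'[OF xm(1)] norm_triangle_sub[of "\<alpha> xm" "a 0"] unfolding m_def by linarith
  moreover have "n \<le> B0 + \<delta> * T"
  proof -
    have "norm (mat (exp (- 2 * \<kappa> * of_real xn)) ** b 0) \<le> 1 * B0"
      unfolding norm_mat_mult B0_def using xn(1) k0 by (intro mult_right_mono) (auto simp: mult_nonneg_nonneg)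
    then show ?thesis
      using bet'[OF xn(1)] norm_triangle_sub[of "\<beta> xn" "mat (exp (- 2 * \<kappa> * of_real xn)) ** b 0"] unfolding n_def by linarith
  qed
  moreover have "\<delta> * T \<le> T / 4" using mult_right_mono[OF \<delta>(2) T0] by simp
  \<comment> \<open>Absorption: adding the bounds for \<open>m\<close> and \<open>n\<close> gives T
    <= A + 2B + 2d with 4d <= T, hence T <= 2A + 4B.\<close>
  moreover have "T' \<le> 4 * (A' + B')" if "m' \<le> A' + d'" "n' \<le> B' + d'" "d' \<le> T' / 4" "0 \<le> A'" "0 \<le> B'" "T' = m' + n' + B'"
    for m' n' A' B' d' T' :: real
  proof -
    have "4 * d' \<le> T'" using that(3) by simp
    moreover have "T' \<le> A' + 2 * B' + 2 * d'" using that(1,2,6) by simp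
    ultimately have "T' \<le> 2 * A' + 4 * B'" by simp
    then show ?thesis using that(4) by simp
  qed
  ultimately have "T \<le> 4 * (norm (a 0) + B0)"
    using norm_ge_zero B0 T_def by blast
  then have "T \<le> 4 * (norm (a 0) + norm (b 0))" by (simp add: B0_def)
  then have "\<delta> * T \<le> \<delta> * (4 * (norm (a 0) + norm (b 0)))" using \<delta>(1) by (rule mult_left_mono)
  also have "\<dots> = 4 * D / sqrt (cmod \<kappa>) * (norm (a 0) + norm (b 0))"
    by (simp add: \<delta>_def r_def q_def)
  finally have fin: "\<delta> * T \<le> 4 * D / sqrt (cmod \<kappa>) * (norm (a 0) + norm (b 0))" .
  show "norm (mat (exp (- \<kappa> * x)) ** a x - a 0) \<le> 4 * D / sqrt (cmod \<kappa>) * (norm (a 0) + norm (b 0))"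
    using alp'[OF x] fin unfolding \<alpha>_def by linarith
  show "norm (mat (exp (- \<kappa> * x)) ** b x - mat (exp (- 2 * \<kappa> * x)) ** b 0) \<le> 4 * D / sqrt (cmod \<kappa>) * (norm (a 0) + norm (b 0))"
    using bet'[OF x] fin unfolding \<beta>_def by linarith
qed

section \<open>Entire functions of order one half\<close>

text \<open>In the right half-plane the argument scaled by 3/4 stays within 3 pi / 8, uniformly away
  from pi / 2. This gives the power 3/4 a real part comparable to its modulus.\<close>

lemma cos_three_quarters_Arg_ge:
  assumes "0 < Re z"
  shows "cos (3/4 * Arg z) \<ge> cos (3 * pi / 8)" "cos (3 * pi / 8) > 0"
proof -
  have "\<bar>Arg z\<bar> \<le> pi / 2" using Arg_Re_nonneg[of z] assms by simp
  then have "\<bar>3/4 * Arg z\<bar> \<le> 3 * pi / 8" by (simp add: abs_mult)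
  then have "cos (3 * pi / 8) \<le> cos \<bar>3/4 * Arg z\<bar>"
    using pi_gt_zero by (intro cos_monotone_0_pi_le abs_ge_zero) linarith+
  then show "cos (3/4 * Arg z) \<ge> cos (3 * pi / 8)" by (simp only: cos_abs_real)
  show "cos (3 * pi / 8) > 0" by (rule cos_gt_zero_pi) (use pi_gt_zero in linarith)+
qed

text \<open>The factor \<open>exp (- \<epsilon> (z + 1) powr (3/4))\<close> beats growth of order one half.\<close>

lemma Phragmen_Lindelof_half_plane:
  assumes f: "f holomorphic_on UNIV" and M: "M > 0" "\<And>y. cmod (f (Complex 0 y)) \<le> M"
    and growth: "\<And>z. cmod (f z) \<le> A * exp (B * sqrt (cmod z))" and z: "0 < Re z"
  shows "cmod (f z) \<le> M"
proof -
  define c where "c = cos (3 * pi / 8)"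
  have c: "c > 0" unfolding c_def by (rule cos_three_quarters_Arg_ge(2)[of 1]) simp
  \<comment> \<open>The exponent lies strictly between the growth order 1/2 and the critical order
    1. The shift by 1 keeps the closed half-plane, including 0, off the branch cut.\<close>
  define p where "p z = (z + 1) powr (complex_of_real (3/4))" for z
  have pRe: "Re (p z) \<ge> c * cmod z powr (3/4)" if "0 \<le> Re z" for z
  proof -
    have pos: "0 < Re (z + 1)" using that by simp
    have nz: "z + 1 \<noteq> 0" using pos by (metis less_irrefl zero_complex.simps(1))
    have "p z = exp (of_real (3/4) * Ln (z + 1))" using nz by (simp add: p_def powr_def)
    then have "Re (p z) = exp (3/4 * ln (cmod (z + 1))) * cos (3/4 * Arg (z + 1))"
      using nz by (simp add: Re_exp Arg_eq_Im_Ln)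
    also have "exp (3/4 * ln (cmod (z + 1))) = cmod (z + 1) powr (3/4)" using nz by (simp add: powr_def)
    finally have eq: "Re (p z) = cmod (z + 1) powr (3/4) * cos (3/4 * Arg (z + 1))" .
    have "c \<le> cos (3/4 * Arg (z + 1))" unfolding c_def using cos_three_quarters_Arg_ge[OF pos] by simp
    moreover have "cmod z \<le> cmod (z + 1)"
    proof (rule power2_le_imp_le)
      show "(cmod z)\<^sup>2 \<le> (cmod (z + 1))\<^sup>2" using that unfolding cmod_power2 by (simp add: power2_eq_square algebra_simps)
    qed simp
    ultimately have "c * cmod z powr (3/4) \<le> cos (3/4 * Arg (z + 1)) * cmod (z + 1) powr (3/4)"
      using c by (intro mult_mono powr_mono2) auto
    then show ?thesis by (simp add: eq mult.commute)
  qed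
  have main: "cmod (f z) \<le> M * exp (\<epsilon> * Re (p z))" if "\<epsilon> > 0" for \<epsilon>
  proof -
    define g where "g w = f w * exp (- of_real \<epsilon> * p w)" for w
    have gn: "cmod (g w) = cmod (f w) * exp (- \<epsilon> * Re (p w))" for w
      by (simp add: g_def norm_mult)
    have "((\<lambda>R. A * exp (B * sqrt R - \<epsilon> * (c * R powr (3/4)))) \<longlongrightarrow> 0) at_top"
      using c that by real_asymp
    then have "\<forall>\<^sub>F R in at_top. A * exp (B * sqrt R - \<epsilon> * (c * R powr (3/4))) < M"
      by (rule order_tendstoD(2)) (use M in auto)
    then obtain R0 where R0: "\<And>R. R \<ge> R0 \<Longrightarrow> A * exp (B * sqrt R - \<epsilon> * (c * R powr (3/4))) < M"
      by (auto simp: eventually_at_top_linorder)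
    define R where "R = max R0 (cmod z + 1)"
    define S where "S = ball 0 R \<inter> {w. 0 < Re w}"
    have clS: "closure S \<subseteq> cball 0 R \<inter> {w. 0 \<le> Re w}"
      by (rule closure_minimal) (auto simp: S_def intro!: closed_Int closed_halfspace_Re_ge)
    have opS: "open S" unfolding S_def by (intro open_Int open_ball open_halfspace_Re_gt)
    have np: "w + 1 \<notin> \<real>\<^sub>\<le>\<^sub>0" if "0 \<le> Re w" for w using that by (auto simp: complex_nonpos_Reals_iff)
    have "g holomorphic_on {w. -1 < Re w}"
      unfolding g_def p_def
      by (intro holomorphic_intros holomorphic_on_subset[OF f]) (auto simp: complex_nonpos_Reals_iff)
    then have hol: "g holomorphic_on interior S" and "continuous_on {w. -1 < Re w} g"
      by (auto intro: holomorphic_on_imp_continuous_on elim!: holomorphic_on_subset simp: S_def dest!: interior_subset[THEN subsetD])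
    then have cont: "continuous_on (closure S) g"
      using clS by (auto elim!: continuous_on_subset)
    have "cmod (g z) \<le> M"
    proof (rule maximum_modulus_frontier[OF hol cont])
      show "bounded S" unfolding S_def by (intro bounded_Int) auto
      show "z \<in> S" using z by (auto simp: S_def R_def)
      fix w assume w: "w \<in> frontier S"
      then have w1: "cmod w \<le> R" "0 \<le> Re w" using clS by (auto simp: frontier_def)
      have w2: "\<not> (cmod w < R \<and> 0 < Re w)" 
      proof -
        have "w \<notin> S" using w opS by (simp add: frontier_def interior_open)
        then show ?thesis by (auto simp: S_def)
      qed
      have e1: "exp (- \<epsilon> * Re (p w)) \<le> exp (- \<epsilon> * (c * cmod w powr (3/4)))"
        using pRe[OF w1(2)] that by (simp add: mult_left_mono)
      show "norm (g w) \<le> M"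
      proof (cases "Re w = 0")
        case True
        then have "w = Complex 0 (Im w)" by (simp add: complex_eq_iff)
        then have "cmod (f w) \<le> M" using M(2)[of "Im w"] by metis
        moreover have "exp (- \<epsilon> * Re (p w)) \<le> 1"
        proof -
          have "0 \<le> c * cmod w powr (3/4)" using c by simp
          then have "exp (- \<epsilon> * (c * cmod w powr (3/4))) \<le> 1" using that by simp
          with e1 show ?thesis by linarith
        qed
        ultimately show ?thesis unfolding gn using M(1) by (metis exp_ge_zero mult.right_neutral mult_mono norm_ge_zero order_less_imp_le)
      next
        case False
        then have wR: "cmod w = R" using w1 w2 by auto
        have "cmod (g w) \<le> (A * exp (B * sqrt R)) * exp (- \<epsilon> * (c * R powr (3/4)))"
          unfolding gn using growth[of w] e1 wR by (intro mult_mono) (auto intro: order_trans[OF norm_ge_zero])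
        also have "\<dots> = A * exp (B * sqrt R - \<epsilon> * (c * R powr (3/4)))" by (simp add: exp_diff exp_minus field_simps)
        also have "\<dots> < M" by (rule R0) (simp add: R_def)
        finally show ?thesis by simp
      qed
    qed
    then show ?thesis unfolding gn by (simp add: exp_minus field_simps)
  qed
  \<comment> \<open>The constant \<open>M\<close> is the same for every \<open>\<epsilon>\<close>,
    so the auxiliary factor can be removed at the fixed point \<open>z\<close> by letting
    \<open>\<epsilon>\<close> tend to 0.\<close>
  have "((\<lambda>\<epsilon>. M * exp (\<epsilon> * Re (p z))) \<longlongrightarrow> M * exp (0 * Re (p z))) (at_right 0)"
    by (intro tendsto_intros)
  moreover have "\<forall>\<^sub>F \<epsilon> in at_right 0. cmod (f z) \<le> M * exp (\<epsilon> * Re (p z))"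
    using eventually_at_right_less[of "0::real"] by eventually_elim (rule main)
  ultimately have "cmod (f z) \<le> M * exp (0 * Re (p z))"
    by (intro tendsto_lowerbound) auto
  then show ?thesis by simp
qed

text \<open>The two limits and continuity bound \<open>f\<close> on the imaginary axis.
  Phragmen-Lindelof for \<open>f\<close> and for its reflection \<open>f (- z)\<close> spreads this
  bound to the plane; the constant given by Liouville equals the limit 0.\<close>

lemma entire_half_order_vanishing:
  assumes f: "f holomorphic_on UNIV"
    and growth: "\<And>z. cmod (f z) \<le> A * exp (B * sqrt (cmod z))"
    and lim: "((\<lambda>y. f (Complex 0 y)) \<longlongrightarrow> 0) at_top" "((\<lambda>y. f (Complex 0 y)) \<longlongrightarrow> 0) at_bot"
  shows "f z = 0"
proof -
  have cf: "continuous_on UNIV f" using f by (rule holomorphic_on_imp_continuous_on)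
  have cy: "continuous_on UNIV (\<lambda>y. f (Complex 0 y))"
    unfolding Complex_eq by (intro continuous_on_compose2[OF cf] continuous_intros) auto
  have "\<forall>\<^sub>F y in at_top. norm (f (Complex 0 y)) < 1" using tendstoD[OF lim(1), of 1] by simp
  then obtain Y1 where Y1: "\<And>y. y \<ge> Y1 \<Longrightarrow> norm (f (Complex 0 y)) < 1" by (auto simp: eventually_at_top_linorder)
  have "\<forall>\<^sub>F y in at_bot. norm (f (Complex 0 y)) < 1" using tendstoD[OF lim(2), of 1] by simp
  then obtain Y2 where Y2: "\<And>y. y \<le> Y2 \<Longrightarrow> norm (f (Complex 0 y)) < 1" by (auto simp: eventually_at_bot_linorder)
  have "compact ((\<lambda>y. f (Complex 0 y)) ` {Y2..Y1})"
    by (intro compact_continuous_image continuous_on_subset[OF cy]) auto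
  then obtain M0 where M0: "\<And>y. y \<in> {Y2..Y1} \<Longrightarrow> norm (f (Complex 0 y)) \<le> M0"
    by (meson bounded_iff compact_imp_bounded imageI)
  define M where "M = max 1 M0"
  have M: "M > 0" "\<And>y. cmod (f (Complex 0 y)) \<le> M"
  proof -
    show "M > 0" by (simp add: M_def)
    fix y show "cmod (f (Complex 0 y)) \<le> M"
      using Y1[of y] Y2[of y] M0[of y] by (cases "y \<ge> Y1"; cases "y \<le> Y2") (auto simp: M_def)
  qed
  have h: "(\<lambda>z. f (- z)) holomorphic_on UNIV"
    using holomorphic_on_compose[OF holomorphic_on_minus[OF holomorphic_on_ident] holomorphic_on_subset[OF f subset_UNIV]]
    by (simp add: o_def)
  have bd: "cmod (f z) \<le> M" for z
  proof -
    consider "0 < Re z" | "Re z < 0" | "Re z = 0" by linarith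
    then show ?thesis
    proof cases
      case 1 then show ?thesis by (rule Phragmen_Lindelof_half_plane[OF f M growth])
    next
      case 2
      have "cmod (f (- (- z))) \<le> M"
      proof (rule Phragmen_Lindelof_half_plane[OF h M(1)])
        show "cmod (f (- Complex 0 y)) \<le> M" for y using M(2)[of "- y"] by (simp add: Complex_eq)
        show "cmod (f (- z)) \<le> A * exp (B * sqrt (cmod z))" for z using growth[of "- z"] by simp
      qed (use 2 in simp)
      then show ?thesis by simp
    next
      case 3
      then have "z = Complex 0 (Im z)" by (simp add: complex_eq_iff)
      then show ?thesis using M(2) by metis
    qed
  qed
  then have "bounded (range f)" by (auto simp: bounded_iff)
  then obtain c where c: "\<And>z. f z = c" using Liouville_theorem[OF f] unfolding constant_on_def by auto
  then have "((\<lambda>y::real. c) \<longlongrightarrow> 0) at_top" using lim(1) by simp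
  then have "c = 0" by (simp add: tendsto_const_iff)
  with c show ?thesis by simp
qed

section \<open>Weyl solutions for large spectral parameter\<close>

text \<open>Complex scalar multiplication; \<open>*\<^sub>R\<close> handles real scalars only.
  Unlike a factor \<open>mat c\<close>, a scalar in this form is moved out of products by
  simplification.\<close>

definition csc :: "complex \<Rightarrow> complex^'n^'m \<Rightarrow> complex^'n^'m" where
  "csc c A = (\<chi> i j. c * A $ i $ j)"

lemma mat_mult_csc: "mat c ** A = csc c A"
  by (simp add: csc_def vec_eq_iff)

lemma csc_mult_left [simp]: "csc c (A :: complex^'n^'m) ** (B :: complex^'p^'n) = csc c (A ** B)"
  by (simp add: mat_mult_csc[symmetric] matrix_mul_assoc)

lemma csc_mult_right [simp]: "(A :: complex^'n^'m) ** csc c (B :: complex^'p^'n) = csc c (A ** B)"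
  by (simp add: mat_mult_csc[symmetric] mult_mat_left_commute)

lemma csc_csc [simp]: "csc c (csc d A) = csc (c * d) A" by (simp add: csc_def vec_eq_iff)
lemma csc_one [simp]: "csc 1 A = A" by (simp add: csc_def vec_eq_iff)
lemma csc_zero [simp]: "csc c 0 = 0" "csc 0 A = 0" by (simp_all add: csc_def vec_eq_iff)
lemma csc_add: "csc c (A + B) = csc c A + csc c B" by (simp add: csc_def vec_eq_iff distrib_left)
lemma csc_diff: "csc c (A - B) = csc c A - csc c B" by (simp add: csc_def vec_eq_iff right_diff_distrib)
lemma csc_minus: "csc c (- A) = - csc c A" by (simp add: csc_def vec_eq_iff)
lemma csc_uminus: "csc (- c) A = - csc c A" by (simp add: csc_def vec_eq_iff)
lemma norm_csc: "norm (csc c (A :: complex^'n^'m)) = cmod c * norm A"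
  by (simp add: mat_mult_csc[symmetric] norm_mat_mult)
lemma dagger_csc: "dagger (csc c A) = csc (cnj c) (dagger A)"
  by (simp add: csc_def dagger_def vec_eq_iff)

lemmas mat_distrib = mm.add_left mm.add_right mm.diff_left mm.diff_right mm.minus_left mm.minus_right
  csc_add csc_diff csc_minus csc_uminus

lemma orth_projectorD:
  assumes "orth_projector T"
  shows "dagger T = T" "T ** T = T" "dagger (perp T) = perp T"
    "T ** perp T = 0" "perp T ** T = 0" "perp T ** perp T = perp T"
    "T ** (T ** A) = T ** A" "T ** (perp T ** A) = 0" "perp T ** (T ** A) = 0" "perp T ** (perp T ** A) = perp T ** A"
    "T + perp T = mat 1"
proof -
  show T: "dagger T = T" "T ** T = T" using assms by (auto simp: orth_projector_def)
  show "dagger (perp T) = perp T" using T by (simp add: perp_def dagger_diff)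
  show P: "T ** perp T = 0" "perp T ** T = 0" "perp T ** perp T = perp T"
    using T by (auto simp: perp_def mat_distrib)
  show "T ** (T ** A) = T ** A" "T ** (perp T ** A) = 0" "perp T ** (T ** A) = 0" "perp T ** (perp T ** A) = perp T ** A"
    unfolding matrix_mul_assoc by (simp_all add: T P)
  show "T + perp T = mat 1" by (simp add: perp_def)
qed

lemma V1_mult: "V1 T (\<lambda>t. Y t ** c) (\<lambda>t. Z t ** c) = V1 T Y Z ** c"
  by (simp add: V1_def mat_distrib matrix_mul_assoc)
lemma V2_mult: "V2 T H (\<lambda>t. Y t ** c) (\<lambda>t. Z t ** c) = V2 T H Y Z ** c"
  by (simp add: V2_def mat_distrib matrix_mul_assoc)
lemma V1_perp_mult: "V1_perp T (\<lambda>t. Y t ** c) (\<lambda>t. Z t ** c) = V1_perp T Y Z ** c"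
  by (simp add: V1_perp_def mat_distrib matrix_mul_assoc)

text \<open>Multiplying the condition by \<open>perp T\<close> and by \<open>T\<close> decouples it:
  \<open>Y pi\<close> lies in the range of \<open>T\<close>, and the \<open>T\<close> part of
  \<open>Z pi\<close> is prescribed by \<open>H\<close>.\<close>

lemma V2_zeroD:
  assumes T: "orth_projector T" and H: "H = T ** H ** T" and V: "V2 T H Y Z = 0"
  shows "perp T ** Y pi = 0" "T ** Y pi = Y pi" "T ** Z pi = H ** Y pi" "T ** H = H" "H ** T = H" "H ** perp T = 0"
proof -
  note P = orth_projectorD[OF T]
  show TH: "T ** H = H" by (subst (1 2) H) (simp add: matrix_mul_assoc P(2))
  show HT: "H ** T = H" by (subst (1 2) H) (simp add: matrix_mul_assoc[symmetric] P(2))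
  show "H ** perp T = 0" by (simp add: perp_def mat_distrib HT)
  have "perp T ** V2 T H Y Z = - (perp T ** Y pi)" by (simp add: V2_def mat_distrib P)
  then show p: "perp T ** Y pi = 0" using V by simp
  then show "T ** Y pi = Y pi" by (simp add: perp_def mat_distrib)
  have "V2 T H Y Z = T ** Z pi - T ** (H ** Y pi)" using p by (simp add: V2_def mat_distrib)
  then show "T ** Z pi = H ** Y pi" using V TH by (simp add: matrix_mul_assoc)
qed

text \<open>The condition at \<open>pi\<close> leaves free exactly \<open>T ** Y pi\<close> and
  \<open>perp T ** Z pi\<close>. The solution \<open>\<theta>\<close> is normalised so that its
  columns parametrise these data; uniqueness from the endpoint \<open>pi\<close> does the
  rest.\<close>

lemma sol_V2_zero_representation:
  fixes \<theta> \<theta>q :: "real \<Rightarrow> complex^'m^'m" and Y Z :: "real \<Rightarrow> complex^'n^'m"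
  assumes \<sigma>: "herm_L2 \<sigma>" and T: "orth_projector T" and H: "H = T ** H ** T"
    and c: "sol \<sigma> lam \<theta> \<theta>q" "\<theta> pi = csc (1/\<kappa>) T" "\<theta>q pi = csc (1/\<kappa>) H - perp T" and \<kappa>: "\<kappa> \<noteq> 0"
    and s: "sol \<sigma> lam Y Z" and V: "V2 T H Y Z = 0"
  obtains d where "\<And>x. x \<in> {0..pi} \<Longrightarrow> Y x = \<theta> x ** d" "\<And>x. x \<in> {0..pi} \<Longrightarrow> Z x = \<theta>q x ** d"
proof -
  note P = orth_projectorD[OF T] and VD = V2_zeroD[OF T H V]
  \<comment> \<open>Inverts the endpoint values of \<open>\<theta>\<close>: \<open>\<kappa>\<close>
    undoes the factor \<open>1 / \<kappa>\<close> on the range of \<open>T\<close>, the minus sign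
    undoes the one in front of \<open>perp T\<close>.\<close>
  define d where "d = csc \<kappa> (T ** Y pi) - perp T ** Z pi"
  have e1: "Y pi = \<theta> pi ** d"
    unfolding c d_def using \<kappa> by (simp add: mat_distrib P VD)
  have "\<theta>q pi ** d = H ** Y pi + perp T ** Z pi"
    unfolding c d_def using \<kappa> by (simp add: mat_distrib P VD) (simp add: matrix_mul_assoc VD)
  also have "\<dots> = (T + perp T) ** Z pi" by (simp add: VD mat_distrib)
  also have "\<dots> = Z pi" by (simp add: P)
  finally have e2: "Z pi = \<theta>q pi ** d" by simp
  show ?thesis
    by (rule that[of d]) (use sol_unique_end[OF \<sigma> s sol_mult_right[OF c(1)] e1 e2] in auto)
qed

lemma exp_le_inverse:
  assumes "q \<ge> 1" "k \<ge> q / 2"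
  shows "exp (- (2 * k * pi)) \<le> 1 / q"
proof -
  have "q \<le> q * pi" using pi_gt3 assms by (simp add: mult_le_cancel_left1)
  also have "\<dots> \<le> 2 * k * pi" using assms by (intro mult_right_mono) auto
  also have "\<dots> \<le> exp (2 * k * pi)" using exp_ge_add_one_self[of "2 * k * pi"] by linarith
  finally have "1 / exp (2 * k * pi) \<le> 1 / q" using assms by (intro divide_left_mono) auto
  then show ?thesis by (simp add: exp_minus inverse_eq_divide)
qed

text \<open>The right factor compensates the size of \<open>\<Phi>\<close>, which is about 1/kappa
  on the range of \<open>T1\<close> and about 1 on its complement. For square matrices
  \<open>Q ** Q' = mat 1\<close> means that \<open>Q\<close> is invertible: the stacked endpoint
  values of \<open>\<Phi>\<close> and \<open>\<Phi>q\<close> span the same subspace as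
  \<open>T2\<close> stacked on \<open>H2 + perp T2\<close>.\<close>

definition Weyl_estimates where
  "Weyl_estimates \<sigma> T1 T2 H2 C \<kappa> \<Phi> \<Phi>q \<longleftrightarrow>
     sol \<sigma> (- (\<kappa>\<^sup>2)) \<Phi> \<Phi>q \<and> V1 T1 \<Phi> \<Phi>q = mat 1 \<and> V2 T2 H2 \<Phi> \<Phi>q = 0 \<and>
     (\<forall>x\<in>{0..pi}. norm (\<Phi> x ** (csc \<kappa> T1 + perp T1)) \<le> C * exp (- Re \<kappa> * x)) \<and>
     norm (csc (1/\<kappa>) (V1_perp T1 \<Phi> \<Phi>q) - perp T1) \<le> C / sqrt (cmod \<kappa>) \<and>
     (\<exists>Q Q'. Q ** Q' = mat 1 \<and> \<Phi> pi = T2 ** Q \<and> \<Phi>q pi = (H2 + perp T2) ** Q)"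

text \<open>The solution satisfying the condition at \<open>pi\<close> is the reflection of a solution growing from \<open>0\<close>;
  the right factor normalising it makes its growing part tend to the identity matrix.\<close>

lemma Weyl_solution_asymptotics:
  fixes \<sigma> :: "real \<Rightarrow> complex^'m^'m"
  assumes \<sigma>: "herm_L2 \<sigma>" and T1: "orth_projector T1" and T2: "orth_projector T2" and H2: "H2 = T2 ** H2 ** T2"
  shows "\<exists>C K. \<forall>\<kappa>. K \<le> cmod \<kappa> \<and> cmod \<kappa> / 2 \<le> Re \<kappa> \<longrightarrow> (\<exists>\<Phi> \<Phi>q :: real \<Rightarrow> complex^'m^'m.
     Weyl_estimates \<sigma> T1 T2 H2 C \<kappa> \<Phi> \<Phi>q \<and>
     (\<forall>Y Z :: real \<Rightarrow> complex^'m^'m. sol \<sigma> (- (\<kappa>\<^sup>2)) Y Z \<and> V1 T1 Y Z = mat 1 \<and> V2 T2 H2 Y Z = 0 \<longrightarrow>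
        (\<forall>x\<in>{0..pi}. Y x = \<Phi> x \<and> Z x = \<Phi>q x)) \<and>
     (\<forall>Y Z :: real \<Rightarrow> complex^1^'m. sol \<sigma> (- (\<kappa>\<^sup>2)) Y Z \<and> V1 T1 Y Z = 0 \<and> V2 T2 H2 Y Z = 0 \<longrightarrow>
        (\<forall>x\<in>{0..pi}. Y x = 0)))"
proof -
  define \<sigma>r where "\<sigma>r = (\<lambda>t. - \<sigma> (pi - t))"
  have \<sigma>r: "herm_L2 \<sigma>r" unfolding \<sigma>r_def by (rule herm_L2_reflect[OF \<sigma>])
  note P1 = orth_projectorD[OF T1] and P2 = orth_projectorD[OF T2]
  have TH: "T2 ** H2 = H2" by (subst (1 2) H2) (simp add: matrix_mul_assoc P2(2))
  have HT: "H2 ** T2 = H2" by (subst (1 2) H2) (simp add: matrix_mul_assoc[symmetric] P2(2))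
  define Dr where "Dr = (1 + 2 * integral {0..pi} (\<lambda>t. (norm (\<sigma>r t))\<^sup>2)) * (2 + integral {0..pi} (\<lambda>t. norm (\<sigma>r t)))"
  define NI where "NI = norm (mat 1 :: complex^'m^'m)"
  define c where "c = NI + norm (T2 - perp T2) + 2 * norm H2"
  define C1 where "C1 = 4 * Dr * c + norm H2 + c"
  define \<tau> where "\<tau> = norm T1 + norm (perp T1)"
  define C where "C = 8 * c * NI + norm T1 + \<tau> * (8 * \<tau> * C1 * NI) * \<tau>"
  \<comment> \<open>The first square yields the smallness hypothesis of
    \<open>asymptotic_estimate\<close>, the second one \<open>norm E \<le> 1/2\<close> and thereby a
    uniformly bounded inverse of \<open>mat 1 + E\<close>.\<close>
  define K where "K = max 1 (max ((4 * Dr)\<^sup>2) ((4 * \<tau> * C1)\<^sup>2))"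
  have Dr0: "Dr \<ge> 0" unfolding Dr_def
    by (intro mult_nonneg_nonneg add_nonneg_nonneg integral_nonneg)
       (use herm_L2_norm_integrable[OF \<sigma>r] \<sigma>r set_lebesgue_integral_eq_integral(1) in \<open>auto simp: herm_L2_def intro!: integral_nonneg\<close>)
  have nn: "NI \<ge> 0" "c \<ge> 0" "C1 \<ge> 0" "\<tau> \<ge> 0" using Dr0 by (auto simp: NI_def c_def C1_def \<tau>_def)
  show ?thesis
  proof (rule exI[of _ C], rule exI[of _ K], intro allI impI)
    fix \<kappa> assume "K \<le> cmod \<kappa> \<and> cmod \<kappa> / 2 \<le> Re \<kappa>"
    then have Kq: "K \<le> cmod \<kappa>" and k: "cmod \<kappa> / 2 \<le> Re \<kappa>" by auto
    define q where "q = cmod \<kappa>"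
    define r where "r = sqrt q"
    have q: "q \<ge> 1" and q1: "cmod \<kappa> \<ge> 1" using Kq by (auto simp: K_def q_def)
    have r: "r \<ge> 1" "r * r = q" "r > 0" using q by (auto simp: r_def)
    have rq: "1 / q \<le> 1 / r" using r q by (intro divide_left_mono) (auto simp: mult_le_cancel_left1 simp flip: r(2))
    have k0: "Re \<kappa> > 0" using q k by (simp add: q_def)
    have \<kappa>0: "\<kappa> \<noteq> 0" using q by (auto simp: q_def)
    have rD: "4 * Dr \<le> sqrt (cmod \<kappa>)" using Kq by (intro real_le_rsqrt) (simp add: K_def)
    have r\<tau>: "4 * \<tau> * C1 \<le> r" unfolding r_def q_def using Kq by (intro real_le_rsqrt) (simp add: K_def)
    have iq: "cmod (1 / \<kappa>) = 1 / q" by (simp add: q_def norm_divide)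
    have iq1: "1 / q \<le> 1" using q by simp
    \<comment> \<open>Reflected endpoint data of a solution satisfying the condition at
      \<open>pi\<close>. The factor \<open>1 / \<kappa>\<close> makes \<open>a 0\<close> the
      identity up to \<open>H2 / \<kappa>\<close>.\<close>
    obtain X Xq where X: "sol \<sigma>r (- (\<kappa>\<^sup>2)) X Xq" "X 0 = csc (1/\<kappa>) T2" "Xq 0 = perp T2 - csc (1/\<kappa>) H2"
      using sol_exists[OF \<sigma>r] by blast
    define a where "a t = csc \<kappa> (X t) + Xq t" for t
    define b where "b t = csc \<kappa> (X t) - Xq t" for t
    have a0: "a 0 = mat 1 - csc (1/\<kappa>) H2"
      using \<kappa>0 P2(11) by (simp add: a_def X algebra_simps)
    have b0: "b 0 = (T2 - perp T2) + csc (1/\<kappa>) H2"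
      using \<kappa>0 by (simp add: b_def X algebra_simps)
    have nH: "norm (csc (1/\<kappa>) H2) \<le> norm H2 / r" "norm (csc (1/\<kappa>) H2) \<le> norm H2"
    proof -
      have "norm (csc (1/\<kappa>) H2) = 1 / q * norm H2" by (simp only: norm_csc iq)
      moreover have "1 / q * norm H2 \<le> 1 / r * norm H2" by (rule mult_right_mono[OF rq]) simp
      moreover have "1 / q * norm H2 \<le> 1 * norm H2" by (rule mult_right_mono[OF iq1]) simp
      ultimately show "norm (csc (1/\<kappa>) H2) \<le> norm H2 / r" "norm (csc (1/\<kappa>) H2) \<le> norm H2" by simp_all
    qed
    have na: "norm (a 0) \<le> NI + norm H2"
      unfolding a0 NI_def using norm_triangle_ineq4[of "mat 1" "csc (1/\<kappa>) H2"] nH(2) by linarith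
    have nb: "norm (b 0) \<le> norm (T2 - perp T2) + norm H2"
      unfolding b0 using norm_triangle_ineq[of "T2 - perp T2" "csc (1/\<kappa>) H2"] nH(2) by linarith
    have nab: "norm (a 0) + norm (b 0) \<le> c" using na nb by (simp add: c_def)
    define \<delta> where "\<delta> = 4 * Dr / r"
    have \<delta>: "0 \<le> \<delta>" "\<delta> \<le> 1" using rD r Dr0 by (auto simp: \<delta>_def r_def q_def)
    have \<delta>c: "4 * Dr / sqrt (cmod \<kappa>) * (norm (a 0) + norm (b 0)) \<le> \<delta> * c"
      unfolding \<delta>_def r_def q_def by (rule mult_left_mono[OF nab]) (use Dr0 in auto)
    have est: "norm (csc (exp (- \<kappa> * x)) (a x) - a 0) \<le> \<delta> * c"
      "norm (csc (exp (- \<kappa> * x)) (b x) - csc (exp (- 2 * \<kappa> * x)) (b 0)) \<le> \<delta> * c" if "x \<in> {0..pi}" for x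
      using asymptotic_estimate[OF \<sigma>r X(1) q1 k rD[unfolded Dr_def] that] \<delta>c
      unfolding mat_mult_csc a_def[symmetric] b_def[symmetric] Dr_def[symmetric] by linarith+
    define Ea where "Ea = csc (exp (- \<kappa> * pi)) (a pi) - mat 1"
    define Eb where "Eb = csc (exp (- \<kappa> * pi)) (b pi)"
    have pi: "pi \<in> {0..pi}" by simp
    have nEa: "norm Ea \<le> C1 / r"
    proof -
      have "Ea = (csc (exp (- \<kappa> * pi)) (a pi) - a 0) - csc (1/\<kappa>) H2" by (simp add: Ea_def a0)
      then have "norm Ea \<le> norm (csc (exp (- \<kappa> * pi)) (a pi) - a 0) + norm (csc (1/\<kappa>) H2)" by (metis norm_triangle_ineq4)
      also have "\<dots> \<le> \<delta> * c + norm H2 / r" using est(1)[OF pi] nH by (intro add_mono)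
      also have "\<dots> = (4 * Dr * c + norm H2) / r" by (simp add: \<delta>_def add_divide_distrib)
      also have "\<dots> \<le> C1 / r" using nn r by (intro divide_right_mono) (auto simp: C1_def)
      finally show ?thesis .
    qed
    have nEb: "norm Eb \<le> C1 / r"
    proof -
      have "norm Eb \<le> norm (csc (exp (- 2 * \<kappa> * pi)) (b 0)) + norm (Eb - csc (exp (- 2 * \<kappa> * pi)) (b 0))"
        using norm_triangle_ineq[of "csc (exp (- 2 * \<kappa> * pi)) (b 0)" "Eb - csc (exp (- 2 * \<kappa> * pi)) (b 0)"] by simp
      also have "norm (csc (exp (- 2 * \<kappa> * pi)) (b 0)) = exp (- (2 * Re \<kappa> * pi)) * norm (b 0)"
        by (simp add: norm_csc)
      also have "\<dots> \<le> (1 / r) * c"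
      proof (rule mult_mono)
        show "exp (- (2 * Re \<kappa> * pi)) \<le> 1 / r" using exp_le_inverse[OF q k[folded q_def]] rq by linarith
        show "norm (b 0) \<le> c" using nab norm_ge_zero[of "a 0"] by linarith
      qed (use r in auto)
      also have "norm (Eb - csc (exp (- 2 * \<kappa> * pi)) (b 0)) \<le> \<delta> * c" using est(2)[OF pi] by (simp add: Eb_def)
      also have "(1 / r) * c + \<delta> * c = (4 * Dr * c + c) / r" by (simp add: \<delta>_def add_divide_distrib)
      also have "\<dots> \<le> C1 / r" using nn r by (intro divide_right_mono) (auto simp: C1_def)
      finally show ?thesis by simp
    qed
    define e where "e = exp (\<kappa> * of_real pi)"
    have e: "e \<noteq> 0" "exp (- \<kappa> * of_real pi) = 1 / e" by (auto simp: e_def exp_minus inverse_eq_divide)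
    \<comment> \<open>After crossing the interval the component \<open>b\<close> is negligible
      against \<open>a\<close>, so both values are explicit scalars times the identity plus
      O(1/sqrt|kappa|), whatever the boundary data.\<close>
    have Xpi: "X pi = csc (e / (2 * \<kappa>)) (mat 1 + Ea + Eb)" "Xq pi = csc (e / 2) (mat 1 + Ea - Eb)"
      unfolding Ea_def Eb_def e a_def b_def using \<kappa>0 e(1)
      by (auto simp: csc_def vec_eq_iff field_simps)
    define \<theta> where "\<theta> = (\<lambda>x. X (pi - x))"
    define \<theta>q where "\<theta>q = (\<lambda>x. - Xq (pi - x))"
    have sc: "sol \<sigma> (- (\<kappa>\<^sup>2)) \<theta> \<theta>q"
      using sol_reflect[OF X(1)] by (simp add: \<theta>_def \<theta>q_def \<sigma>r_def)
    have \<theta>pi: "\<theta> pi = csc (1/\<kappa>) T2" "\<theta>q pi = csc (1/\<kappa>) H2 - perp T2" by (auto simp: \<theta>_def \<theta>q_def X)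
    have \<theta>0: "\<theta> 0 = csc (e / (2 * \<kappa>)) (mat 1 + Ea + Eb)" "\<theta>q 0 = csc (- e / 2) (mat 1 + Ea - Eb)"
      by (auto simp: \<theta>_def \<theta>q_def Xpi csc_uminus)
    \<comment> \<open>\<open>E\<close> is the relative error of \<open>V1\<close> and
      \<open>E'\<close> that of \<open>V1_perp\<close>: the two forms interchange the roles of the
      value and the quasi-derivative, hence the opposite signs of \<open>Eb\<close>.\<close>
    define E where "E = T1 ** (Ea - Eb) + perp T1 ** (Ea + Eb)"
    define E' where "E' = T1 ** (Ea + Eb) + perp T1 ** (Ea - Eb)"
    have nEE: "norm (T1 ** (F :: complex^'m^'m) + perp T1 ** F') \<le> 2 * \<tau> * C1 / r"
      if "norm F \<le> 2 * (C1 / r)" "norm F' \<le> 2 * (C1 / r)" for F F'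
    proof -
      have "norm (T1 ** F + perp T1 ** F') \<le> norm (T1 ** F) + norm (perp T1 ** F')" by (rule norm_triangle_ineq)
      also have "\<dots> \<le> norm T1 * norm F + norm (perp T1) * norm F'" by (intro add_mono norm_matrix_mult_le)
      also have "\<dots> \<le> norm T1 * (2 * (C1 / r)) + norm (perp T1) * (2 * (C1 / r))"
        using that by (intro add_mono mult_left_mono) auto
      also have "\<dots> = 2 * \<tau> * C1 / r" by (simp add: \<tau>_def add_divide_distrib algebra_simps)
      finally show ?thesis .
    qed
    have nE1: "norm (Ea + Eb) \<le> 2 * (C1 / r)" "norm (Ea - Eb) \<le> 2 * (C1 / r)"
      using norm_triangle_ineq[of Ea Eb] norm_triangle_ineq4[of Ea Eb] nEa nEb by linarith+
    have nE: "norm E \<le> 2 * \<tau> * C1 / r" and nE': "norm E' \<le> 2 * \<tau> * C1 / r"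
      unfolding E_def E'_def by (intro nEE nE1)+
    have h: "2 * \<tau> * C1 / r \<le> 1 / 2" using r\<tau> r by (simp add: field_simps)
    then have E12: "norm E \<le> 1/2" using nE by linarith
    then obtain R where R: "(mat 1 + E) ** R = mat 1" "R ** (mat 1 + E) = mat 1" "norm R \<le> NI / (1 - norm E)"
      using one_plus_small_invertible[of E] unfolding NI_def by auto
    have nR: "norm R \<le> 2 * NI"
    proof -
      have "NI / (1 - norm E) \<le> NI / (1 / 2)" using E12 nn by (intro divide_left_mono) auto
      with R(3) show ?thesis by simp
    qed
    define D where "D = csc \<kappa> T1 + perp T1"
    define Di where "Di = csc (1/\<kappa>) T1 + perp T1"
    have DDi: "D ** Di = mat 1" "Di ** D = mat 1"
      unfolding D_def Di_def using \<kappa>0 by (auto simp: mat_distrib P1)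
    define W where "W = V1 T1 \<theta> \<theta>q"
    have DE: "D ** E = csc \<kappa> (T1 ** (Ea - Eb)) + perp T1 ** (Ea + Eb)"
      unfolding D_def E_def mm.add_left mm.add_right csc_mult_left by (simp add: P1)
    have W: "W = csc (- e / (2 * \<kappa>)) (D ** (mat 1 + E))"
    proof -
      have "D ** (mat 1 + E) = csc \<kappa> (T1 ** (mat 1 + Ea - Eb)) + perp T1 ** (mat 1 + Ea + Eb)"
        unfolding mm.add_right[of D] DE unfolding D_def by (simp add: mat_distrib)
      moreover have "W = csc (- e / 2) (T1 ** (mat 1 + Ea - Eb)) - csc (e / (2 * \<kappa>)) (perp T1 ** (mat 1 + Ea + Eb))"
        unfolding W_def V1_def \<theta>0 csc_mult_right ..
      ultimately show ?thesis using \<kappa>0 by (simp add: csc_add csc_uminus)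
    qed
    define Wi where "Wi = csc (- 2 * \<kappa> / e) (R ** Di)"
    have cc: "(- e / (2 * \<kappa>)) * (- 2 * \<kappa> / e) = 1" "(- 2 * \<kappa> / e) * (- e / (2 * \<kappa>)) = 1" using \<kappa>0 e(1) by auto
    have WWi: "W ** Wi = mat 1"
    proof -
      have "W ** Wi = csc ((- e / (2 * \<kappa>)) * (- 2 * \<kappa> / e)) (D ** ((mat 1 + E) ** R) ** Di)"
        unfolding W Wi_def csc_mult_left csc_mult_right csc_csc by (simp only: matrix_mul_assoc mult.commute)
      then show ?thesis unfolding cc R(1) by (simp add: DDi)
    qed
    have WiW: "Wi ** W = mat 1" using WWi matrix_left_right_inverse by blast
    define \<Phi> where "\<Phi> = (\<lambda>x. \<theta> x ** Wi)"
    define \<Phi>q where "\<Phi>q = (\<lambda>x. \<theta>q x ** Wi)"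
    have s\<Phi>: "sol \<sigma> (- (\<kappa>\<^sup>2)) \<Phi> \<Phi>q" unfolding \<Phi>_def \<Phi>q_def by (rule sol_mult_right[OF sc])
    have V1\<Phi>: "V1 T1 \<Phi> \<Phi>q = mat 1" unfolding \<Phi>_def \<Phi>q_def V1_mult W_def[symmetric] by (rule WWi)
    have V2\<theta>: "V2 T2 H2 \<theta> \<theta>q = 0" by (simp add: V2_def \<theta>pi mat_distrib P2 TH HT)
    have V2\<Phi>: "V2 T2 H2 \<Phi> \<Phi>q = 0" unfolding \<Phi>_def \<Phi>q_def V2_mult V2\<theta> by simp
    have bnd: "norm (\<Phi> x ** D) \<le> C * exp (- Re \<kappa> * x)" if x: "x \<in> {0..pi}" for x
    proof -
      define y where "y = pi - x"
      have y: "y \<in> {0..pi}" using x by (auto simp: y_def)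
      have dc: "\<delta> * c \<le> c" using \<delta>(2) nn(2) by (simp add: mult_left_le_one_le \<delta>(1))
      have "norm (csc (exp (- \<kappa> * y)) (a y)) \<le> norm (a 0) + \<delta> * c"
        using norm_triangle_sub[of "csc (exp (- \<kappa> * y)) (a y)" "a 0"] est(1)[OF y] by linarith
      then have a1: "exp (- Re \<kappa> * y) * norm (a y) \<le> norm (a 0) + c" using dc by (simp add: norm_csc)
      have "norm (csc (exp (- 2 * \<kappa> * y)) (b 0)) \<le> 1 * norm (b 0)"
        unfolding norm_csc using y k0 by (intro mult_right_mono) (auto simp: mult_nonneg_nonneg)
      then have "norm (csc (exp (- \<kappa> * y)) (b y)) \<le> norm (b 0) + \<delta> * c"
        using norm_triangle_sub[of "csc (exp (- \<kappa> * y)) (b y)" "csc (exp (- 2 * \<kappa> * y)) (b 0)"] est(2)[OF y] by linarith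
      then have b1: "exp (- Re \<kappa> * y) * norm (b y) \<le> norm (b 0) + c" using dc by (simp add: norm_csc)
      have "a y + b y = csc (2 * \<kappa>) (X y)" by (simp add: a_def b_def csc_def vec_eq_iff)
      then have "2 * q * norm (X y) = norm (a y + b y)" by (simp add: norm_csc norm_mult q_def)
      also have "\<dots> \<le> norm (a y) + norm (b y)" by (rule norm_triangle_ineq)
      finally have "exp (- Re \<kappa> * y) * (2 * q * norm (X y)) \<le> exp (- Re \<kappa> * y) * (norm (a y) + norm (b y))"
        by (rule mult_left_mono) simp
      also have "\<dots> \<le> 4 * c" using a1 b1 nab nn(2) by (simp add: distrib_left)
      finally have X1: "exp (- Re \<kappa> * y) * (2 * q * norm (X y)) \<le> 4 * c" .
      have "\<Phi> x ** D = csc (- 2 * \<kappa> / e) (X y ** (R ** (Di ** D)))"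
        unfolding \<Phi>_def \<theta>_def Wi_def y_def by (simp add: matrix_mul_assoc)
      then have "norm (\<Phi> x ** D) = 2 * q * exp (- Re \<kappa> * pi) * norm (X y ** R)"
        by (simp add: DDi norm_csc norm_divide norm_mult q_def e_def exp_minus field_simps)
      also have "\<dots> \<le> 2 * q * exp (- Re \<kappa> * pi) * (norm (X y) * norm R)"
        using q by (intro mult_left_mono norm_matrix_mult_le) auto
      \<comment> \<open>The inverse of \<open>W\<close> decays like exp(- Re kappa pi), while
        \<open>X\<close> grows at most like exp(Re kappa y) with \<open>y = pi - x\<close>. What
        survives is the decay in \<open>x\<close>.\<close>
      also have "exp (- Re \<kappa> * pi) = exp (- Re \<kappa> * y) * exp (- Re \<kappa> * x)"
        by (simp add: exp_add[symmetric] y_def algebra_simps)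
      also have "2 * q * (exp (- Re \<kappa> * y) * exp (- Re \<kappa> * x)) * (norm (X y) * norm R) =
        (exp (- Re \<kappa> * y) * (2 * q * norm (X y))) * norm R * exp (- Re \<kappa> * x)" by simp
      also have "\<dots> \<le> (4 * c) * (2 * NI) * exp (- Re \<kappa> * x)"
        by (rule mult_right_mono[OF mult_mono[OF X1 nR]]) (use nn in auto)
      also have "\<dots> \<le> C * exp (- Re \<kappa> * x)"
      proof (rule mult_right_mono)
        have "0 \<le> norm T1 + \<tau> * (8 * \<tau> * C1 * NI) * \<tau>" using nn by (intro add_nonneg_nonneg mult_nonneg_nonneg) auto
        then show "(4 * c) * (2 * NI) \<le> C" unfolding C_def by simp
      qed simp
      finally show ?thesis .
    qed
    have Mb: "norm (csc (1/\<kappa>) (V1_perp T1 \<Phi> \<Phi>q) - perp T1) \<le> C / sqrt (cmod \<kappa>)"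
    proof -
      define N where "N = T1 - csc \<kappa> (perp T1)"
      have "N ** (mat 1 + E') = T1 ** (mat 1 + Ea + Eb) - csc \<kappa> (perp T1 ** (mat 1 + Ea - Eb))"
        unfolding N_def E'_def mm.diff_left mm.add_right csc_mult_left by (simp add: P1 mat_distrib)
      moreover have "V1_perp T1 \<theta> \<theta>q = csc (e / (2 * \<kappa>)) (T1 ** (mat 1 + Ea + Eb)) + csc (- e / 2) (perp T1 ** (mat 1 + Ea - Eb))"
        unfolding V1_perp_def \<theta>0 csc_mult_right ..
      ultimately have Vp: "V1_perp T1 \<theta> \<theta>q = csc (e / (2 * \<kappa>)) (N ** (mat 1 + E'))"
        using \<kappa>0 by (simp add: csc_diff csc_uminus)
      \<comment> \<open>\<open>R\<close> inverts \<open>mat 1 + E\<close>, not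
        \<open>mat 1 + E'\<close>; \<open>G\<close> is the small discrepancy. Without it the
        quotient would be \<open>Pm ** Di\<close>, that is \<open>perp T1\<close> up to T1 over
        kappa squared.\<close>
      define G where "G = (E' - E) ** R"
      have G: "(mat 1 + E') ** R = mat 1 + G"
      proof -
        have "(mat 1 + E') ** R = (mat 1 + E) ** R + (E' - E) ** R" by (simp add: mat_distrib)
        then show ?thesis by (simp add: R(1) G_def)
      qed
      define Pm where "Pm = perp T1 - csc (1/\<kappa>) T1"
      have "csc (1/\<kappa>) (V1_perp T1 \<Phi> \<Phi>q) = csc ((1/\<kappa>) * ((e / (2 * \<kappa>)) * (- 2 * \<kappa> / e))) (N ** ((mat 1 + E') ** R) ** Di)"
        unfolding V1_perp_mult[of T1 \<theta> Wi \<theta>q, folded \<Phi>_def \<Phi>q_def] Vp unfolding Wi_def csc_mult_left csc_mult_right csc_csc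
        by (simp only: matrix_mul_assoc mult.commute mult.left_commute)
      also have "(1/\<kappa>) * ((e / (2 * \<kappa>)) * (- 2 * \<kappa> / e)) = - (1/\<kappa>)" using \<kappa>0 e(1) by simp
      also have "csc (- (1/\<kappa>)) (N ** ((mat 1 + E') ** R) ** Di) = Pm ** (mat 1 + G) ** Di"
      proof -
        have "Pm = csc (- (1/\<kappa>)) N" unfolding Pm_def N_def using \<kappa>0 by (simp add: csc_diff csc_uminus)
        then show ?thesis by (simp add: G)
      qed
      also have "Pm ** (mat 1 + G) ** Di = Pm ** Di + Pm ** G ** Di" by (simp add: mat_distrib)
      also have "Pm ** Di = perp T1 - csc (1/\<kappa>\<^sup>2) T1"
        unfolding Pm_def Di_def by (simp add: mat_distrib P1 power2_eq_square)
      finally have eq: "csc (1/\<kappa>) (V1_perp T1 \<Phi> \<Phi>q) - perp T1 = Pm ** G ** Di - csc (1/\<kappa>\<^sup>2) T1" by simp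
      have nT: "norm (csc (1/\<kappa>) T1) \<le> norm T1"
        using mult_right_mono[OF iq1, of "norm T1"] by (simp only: norm_csc iq) simp
      have nPm: "norm Pm \<le> \<tau>" unfolding Pm_def \<tau>_def
        using norm_triangle_ineq4[of "perp T1" "csc (1/\<kappa>) T1"] nT by linarith
      have nDi: "norm Di \<le> \<tau>" unfolding Di_def \<tau>_def
        using norm_triangle_ineq[of "csc (1/\<kappa>) T1" "perp T1"] nT by linarith
      have nG: "norm G \<le> (8 * \<tau> * C1 * NI) / r"
      proof -
        have "norm G \<le> norm (E' - E) * norm R" unfolding G_def by (rule norm_matrix_mult_le)
        also have "\<dots> \<le> (4 * \<tau> * C1 / r) * (2 * NI)"
        proof (rule mult_mono[OF _ nR])
          have "norm (E' - E) \<le> 2 * \<tau> * C1 / r + 2 * \<tau> * C1 / r"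
            by (rule order_trans[OF norm_triangle_ineq4 add_mono[OF nE' nE]])
          then show "norm (E' - E) \<le> 4 * \<tau> * C1 / r" by (simp add: mult_ac)
        qed (use nn r in auto)
        finally show ?thesis by (simp add: field_simps)
      qed
      have "norm (Pm ** G ** Di) \<le> norm (Pm ** G) * norm Di" by (rule norm_matrix_mult_le)
      also have "\<dots> \<le> (norm Pm * norm G) * norm Di" by (intro mult_right_mono norm_matrix_mult_le) simp
      also have "\<dots> \<le> (\<tau> * ((8 * \<tau> * C1 * NI) / r)) * \<tau>"
        using nPm nG nDi nn r by (intro mult_mono) auto
      finally have t1: "norm (Pm ** G ** Di) \<le> \<tau> * (8 * \<tau> * C1 * NI) * \<tau> / r" by simp
      have t2: "norm (csc (1/\<kappa>\<^sup>2) T1) \<le> norm T1 / r"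
      proof -
        have "norm (csc (1/\<kappa>\<^sup>2) T1) = (1/q) * ((1/q) * norm T1)" by (simp add: norm_csc norm_divide norm_mult q_def power2_eq_square)
        also have "\<dots> \<le> (1/r) * (1 * norm T1)" using rq iq1 q r by (intro mult_mono mult_right_mono) auto
        finally show ?thesis by simp
      qed
      have "norm (csc (1/\<kappa>) (V1_perp T1 \<Phi> \<Phi>q) - perp T1) \<le> \<tau> * (8 * \<tau> * C1 * NI) * \<tau> / r + norm T1 / r"
        unfolding eq using norm_triangle_ineq4[of "Pm ** G ** Di" "csc (1/\<kappa>\<^sup>2) T1"] t1 t2 by linarith
      also have "\<dots> = (norm T1 + \<tau> * (8 * \<tau> * C1 * NI) * \<tau>) / r" by (simp add: add_divide_distrib)
      also have "\<dots> \<le> C / r" using nn r unfolding C_def by (intro divide_right_mono) auto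
      finally show ?thesis by (simp add: r_def q_def)
    qed
    have uniq: "\<forall>x\<in>{0..pi}. Y x = \<Phi> x \<and> Z x = \<Phi>q x"
      if "sol \<sigma> (- (\<kappa>\<^sup>2)) Y Z" "V1 T1 Y Z = mat 1" "V2 T2 H2 Y Z = 0" for Y Z :: "real \<Rightarrow> complex^'m^'m"
    proof -
      note u = that
      obtain d where d: "\<And>x. x \<in> {0..pi} \<Longrightarrow> Y x = \<theta> x ** d" "\<And>x. x \<in> {0..pi} \<Longrightarrow> Z x = \<theta>q x ** d"
        using sol_V2_zero_representation[OF \<sigma> T2 H2 sc \<theta>pi \<kappa>0 u(1,3)] by blast
      have "V1 T1 Y Z = W ** d" unfolding W_def V1_mult[symmetric] by (simp add: V1_def d)
      then have "W ** d = mat 1" using u(2) by simp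
      then have "Wi ** (W ** d) = Wi" by simp
      then have "d = Wi" by (simp add: matrix_mul_assoc WiW)
      then show ?thesis using d by (simp add: \<Phi>_def \<Phi>q_def)
    qed
    have noev: "\<forall>x\<in>{0..pi}. Y x = 0"
      if "sol \<sigma> (- (\<kappa>\<^sup>2)) Y Z" "V1 T1 Y Z = 0" "V2 T2 H2 Y Z = 0" for Y Z :: "real \<Rightarrow> complex^1^'m"
    proof -
      note u = that
      obtain d where d: "\<And>x. x \<in> {0..pi} \<Longrightarrow> Y x = \<theta> x ** d" "\<And>x. x \<in> {0..pi} \<Longrightarrow> Z x = \<theta>q x ** d"
        using sol_V2_zero_representation[OF \<sigma> T2 H2 sc \<theta>pi \<kappa>0 u(1,3)] by blast
      have "V1 T1 Y Z = W ** d" unfolding W_def V1_mult[symmetric] by (simp add: V1_def d)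
      then have "W ** d = 0" using u(2) by simp
      then have "Wi ** (W ** d) = 0" by simp
      then have "d = 0" by (simp add: matrix_mul_assoc WiW)
      then show ?thesis using d by simp
    qed
    have QQ: "\<exists>Q Q'. Q ** Q' = mat 1 \<and> \<Phi> pi = T2 ** Q \<and> \<Phi>q pi = (H2 + perp T2) ** Q"
    proof (intro exI conjI)
      \<comment> \<open>\<open>T2 ** Wi\<close> and \<open>perp T2 ** Wi\<close> are the independent
        parts of the endpoint values, rescaled as in \<open>\<theta>\<close>. As \<open>H2\<close>
        annihilates \<open>perp T2\<close>, one factor \<open>?Q\<close> serves both values, and its
        inverse is built from \<open>W\<close>.\<close>
      let ?Q = "csc (1/\<kappa>) (T2 ** Wi) - perp T2 ** Wi" and ?Q' = "csc \<kappa> (W ** T2) - W ** perp T2"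
      have "?Q ** ?Q' = T2 ** (Wi ** W) ** T2 + perp T2 ** (Wi ** W) ** perp T2 - csc (1/\<kappa>) (T2 ** (Wi ** W) ** perp T2) - csc \<kappa> (perp T2 ** (Wi ** W) ** T2)"
        using \<kappa>0 by (simp add: mat_distrib matrix_mul_assoc)
      then show "?Q ** ?Q' = mat 1" by (simp add: WiW P2)
      show "\<Phi> pi = T2 ** ?Q" by (simp add: \<Phi>_def \<theta>pi mat_distrib P2)
      have "H2 ** (perp T2 ** Wi) = 0" by (simp add: perp_def mat_distrib matrix_mul_assoc HT)
      moreover have "H2 ** (T2 ** Wi) = H2 ** Wi" by (simp add: matrix_mul_assoc HT)
      ultimately show "\<Phi>q pi = (H2 + perp T2) ** ?Q" by (simp add: \<Phi>q_def \<theta>pi mat_distrib P2)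
    qed
    show "\<exists>\<Phi> \<Phi>q :: real \<Rightarrow> complex^'m^'m.
     Weyl_estimates \<sigma> T1 T2 H2 C \<kappa> \<Phi> \<Phi>q \<and>
     (\<forall>Y Z :: real \<Rightarrow> complex^'m^'m. sol \<sigma> (- (\<kappa>\<^sup>2)) Y Z \<and> V1 T1 Y Z = mat 1 \<and> V2 T2 H2 Y Z = 0 \<longrightarrow>
        (\<forall>x\<in>{0..pi}. Y x = \<Phi> x \<and> Z x = \<Phi>q x)) \<and>
     (\<forall>Y Z :: real \<Rightarrow> complex^1^'m. sol \<sigma> (- (\<kappa>\<^sup>2)) Y Z \<and> V1 T1 Y Z = 0 \<and> V2 T2 H2 Y Z = 0 \<longrightarrow>
        (\<forall>x\<in>{0..pi}. Y x = 0))"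
      unfolding Weyl_estimates_def
    proof (rule exI[of _ \<Phi>], rule exI[of _ \<Phi>q], intro conjI ballI allI impI)
      show "norm (\<Phi> x ** (csc \<kappa> T1 + perp T1)) \<le> C * exp (- Re \<kappa> * x)" if "x \<in> {0..pi}" for x
        using bnd[OF that] unfolding D_def .
    qed (use s\<Phi> V1\<Phi> V2\<Phi> Mb QQ uniq noev in blast)+
  qed
qed

text \<open>The right factor, inverse to the one used for \<open>\<Phi>\<close>, makes
  \<open>a 0\<close> the identity and \<open>b 0\<close> equal to \<open>T - perp T\<close>. All
  constants are therefore independent of \<open>\<kappa>\<close>, and the general estimate applies
  directly from 0.\<close>

lemma S_solution_asymptotics:
  fixes \<sigma> :: "real \<Rightarrow> complex^'m^'m"
  assumes \<sigma>: "herm_L2 \<sigma>" and T: "orth_projector T"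
  shows "\<exists>C K. \<forall>\<kappa>. K \<le> cmod \<kappa> \<and> cmod \<kappa> / 2 \<le> Re \<kappa> \<longrightarrow>
    (\<forall>S Sq :: real \<Rightarrow> complex^'m^'m. sol \<sigma> (- (\<kappa>\<^sup>2)) S Sq \<and> S 0 = T \<and> Sq 0 = perp T \<longrightarrow>
      (\<forall>x\<in>{0..pi}. norm (S x ** (csc (1/\<kappa>) T + perp T)) \<le> C * exp (Re \<kappa> * x) / cmod \<kappa>))"
proof -
  define Dr where "Dr = (1 + 2 * integral {0..pi} (\<lambda>t. (norm (\<sigma> t))\<^sup>2)) * (2 + integral {0..pi} (\<lambda>t. norm (\<sigma> t)))"
  note P = orth_projectorD[OF T]
  define c where "c = norm (mat 1 :: complex^'m^'m) + norm (T - perp T)"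
  have c0: "c \<ge> 0" by (simp add: c_def)
  define K where "K = max 1 ((4 * Dr)\<^sup>2)"
  show ?thesis
  proof (rule exI[of _ "2 * c"], rule exI[of _ K], intro allI impI ballI)
    fix \<kappa> :: complex and S Sq :: "real \<Rightarrow> complex^'m^'m" and x
    assume A: "K \<le> cmod \<kappa> \<and> cmod \<kappa> / 2 \<le> Re \<kappa>"
      and B: "sol \<sigma> (- (\<kappa>\<^sup>2)) S Sq \<and> S 0 = T \<and> Sq 0 = perp T" and x: "x \<in> {0..pi}"
    have Kq: "K \<le> cmod \<kappa>" and k: "cmod \<kappa> / 2 \<le> Re \<kappa>" using A by auto
    have s: "sol \<sigma> (- (\<kappa>\<^sup>2)) S Sq" "S 0 = T" "Sq 0 = perp T" using B by auto
    define q where "q = cmod \<kappa>"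
    have q: "q \<ge> 1" and q1: "cmod \<kappa> \<ge> 1" using Kq by (auto simp: K_def q_def)
    have k0: "Re \<kappa> > 0" using q k by (simp add: q_def)
    have \<kappa>0: "\<kappa> \<noteq> 0" using q by (auto simp: q_def)
    have rD: "4 * Dr \<le> sqrt (cmod \<kappa>)" using Kq by (intro real_le_rsqrt) (simp add: K_def)
    define Di where "Di = csc (1/\<kappa>) T + perp T"
    define Y where "Y = (\<lambda>t. S t ** Di)"
    define Z where "Z = (\<lambda>t. Sq t ** Di)"
    have YZ: "sol \<sigma> (- (\<kappa>\<^sup>2)) Y Z" unfolding Y_def Z_def by (rule sol_mult_right[OF s(1)])
    define a where "a t = csc \<kappa> (Y t) + Z t" for t
    define b where "b t = csc \<kappa> (Y t) - Z t" for t
    have a0: "a 0 = mat 1" and b0: "b 0 = T - perp T"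
      unfolding a_def b_def Y_def Z_def s Di_def using \<kappa>0 P(11) by (simp_all add: mat_distrib P)
    have nab: "norm (a 0) + norm (b 0) = c" unfolding a0 b0 c_def ..
    have \<delta>: "4 * Dr / sqrt (cmod \<kappa>) * c \<le> 1 * c" 
    proof (rule mult_right_mono[OF _ c0])
      have "0 < sqrt (cmod \<kappa>)" using \<kappa>0 by simp
      then show "4 * Dr / sqrt (cmod \<kappa>) \<le> 1" using rD by (simp add: divide_le_eq)
    qed
    have est: "norm (csc (exp (- \<kappa> * x)) (a x) - a 0) \<le> c"
      "norm (csc (exp (- \<kappa> * x)) (b x) - csc (exp (- 2 * \<kappa> * x)) (b 0)) \<le> c"
      using asymptotic_estimate[OF \<sigma> YZ q1 k rD[unfolded Dr_def] x] \<delta>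
      unfolding mat_mult_csc a_def[symmetric] b_def[symmetric] Dr_def[symmetric] nab by linarith+
    have a1: "exp (- Re \<kappa> * x) * norm (a x) \<le> norm (a 0) + c"
      using norm_triangle_sub[of "csc (exp (- \<kappa> * x)) (a x)" "a 0"] est(1) by (simp add: norm_csc)
    have "norm (csc (exp (- 2 * \<kappa> * x)) (b 0)) \<le> 1 * norm (b 0)"
      unfolding norm_csc using x k0 by (intro mult_right_mono) (auto simp: mult_nonneg_nonneg)
    then have "norm (csc (exp (- \<kappa> * x)) (b x)) \<le> norm (b 0) + c"
      using norm_triangle_sub[of "csc (exp (- \<kappa> * x)) (b x)" "csc (exp (- 2 * \<kappa> * x)) (b 0)"] est(2) by linarith
    then have b1: "exp (- Re \<kappa> * x) * norm (b x) \<le> norm (b 0) + c" by (simp add: norm_csc)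
    have "a x + b x = csc (2 * \<kappa>) (Y x)" by (simp add: a_def b_def csc_def vec_eq_iff)
    then have "2 * q * norm (Y x) = norm (a x + b x)" by (simp add: norm_csc norm_mult q_def)
    also have "\<dots> \<le> norm (a x) + norm (b x)" by (rule norm_triangle_ineq)
    finally have "exp (- Re \<kappa> * x) * (2 * q * norm (Y x)) \<le> exp (- Re \<kappa> * x) * (norm (a x) + norm (b x))"
      by (rule mult_left_mono) simp
    also have "\<dots> \<le> 4 * c" using a1 b1 nab c0 by (simp add: distrib_left)
    finally have "exp (Re \<kappa> * x) * (exp (- Re \<kappa> * x) * (2 * q * norm (Y x))) \<le> exp (Re \<kappa> * x) * (4 * c)"
      by (rule mult_left_mono) simp
    then have "2 * q * norm (Y x) \<le> exp (Re \<kappa> * x) * (4 * c)" by (simp add: mult.assoc[symmetric] exp_add[symmetric])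
    then have "norm (Y x) \<le> 2 * c * exp (Re \<kappa> * x) / q" using q by (simp add: field_simps)
    then show "norm (S x ** (csc (1/\<kappa>) T + perp T)) \<le> 2 * c * exp (Re \<kappa> * x) / cmod \<kappa>"
      by (simp add: Y_def Di_def q_def)
  qed
qed

section \<open>Recovering the problem from the Weyl matrix\<close>

lemma L1_deriv_zero_imp_zero:
  assumes L: "L1_deriv a b f f'" and f: "\<And>x. x \<in> {a..b} \<Longrightarrow> f x = c"
  obtains N where "negligible N" "\<And>x. x \<in> {a<..<b} - N \<Longrightarrow> f' x = 0"
proof -
  obtain N where N: "negligible N" "\<And>x. x \<in> {a<..<b} - N \<Longrightarrow> (f has_vector_derivative f' x) (at x)"
    using L1_deriv_has_vector_derivative[OF L] by blast
  show ?thesis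
  proof (rule that[OF N(1)])
    fix x assume x: "x \<in> {a<..<b} - N"
    have "((\<lambda>_. c) has_vector_derivative f' x) (at x)"
      by (rule has_vector_derivative_transform_within_open[OF N(2)[OF x], of "{a<..<b}"]) (use x f in auto)
    then show "f' x = 0" using vector_derivative_unique_at[OF _ has_vector_derivative_const] by blast
  qed
qed

text \<open>The primitive vanishes identically, and a continuous integrand is its derivative at
  every point, endpoints included.\<close>

lemma continuous_negligible_zero:
  fixes f :: "real \<Rightarrow> 'a::euclidean_space"
  assumes f: "continuous_on {a..b} f" and ab: "a < b" and N: "negligible N" "\<And>x. x \<in> {a<..<b} - N \<Longrightarrow> f x = 0"
    and x: "x \<in> {a..b}"
  shows "f x = 0"
proof -
  have int: "integral {a..y} f = 0" if "y \<in> {a..b}" for y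
  proof -
    have "integral {a..y} f = integral {a..y} (\<lambda>_. 0)"
      by (rule integral_spike[of "N \<union> {a, b}"]) (use N that in \<open>auto simp: negligible_Un\<close>)
    then show ?thesis by simp
  qed
  have "((\<lambda>u. integral {a..u} f) has_vector_derivative f x) (at x within {a..b})"
    by (rule integral_has_vector_derivative[OF f x])
  then have "((\<lambda>_. 0) has_vector_derivative f x) (at x within {a..b})"
    by (rule has_vector_derivative_transform[OF x, rotated]) (use int in auto)
  then show ?thesis
    using vector_derivative_unique_within_closed_interval[of a b x "\<lambda>_. 0" "f x" 0] ab x by simp
qed

text \<open>For a projector \<open>T\<close> these are the conditions \<open>V1 = mat 1\<close>,
  \<open>V1_perp = 0\<close> solved for the values at 0; \<open>initS\<close> does the same with the
  two right-hand sides exchanged.\<close>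

definition initC :: "complex^'m^'m \<Rightarrow> (real \<Rightarrow> complex^'m^'m) \<Rightarrow> (real \<Rightarrow> complex^'m^'m) \<Rightarrow> bool" where
  "initC T Y Z \<longleftrightarrow> Y 0 = - perp T \<and> Z 0 = T"

definition initS :: "complex^'m^'m \<Rightarrow> (real \<Rightarrow> complex^'m^'m) \<Rightarrow> (real \<Rightarrow> complex^'m^'m) \<Rightarrow> bool" where
  "initS T Y Z \<longleftrightarrow> Y 0 = T \<and> Z 0 = perp T"

text \<open>The matrices \<open>P11\<close>, \<open>P12\<close>, \<open>P21\<close>, \<open>P22\<close> are the blocks of the transfer matrix carrying the solutions of one
  equation to those of the other; once \<open>P12\<close> vanishes, its differential equation forces
  \<open>P11 = P22 = I\<close> and \<open>P21 = \<sigma>' - \<sigma>\<close> almost everywhere, with constant \<open>P21\<close>.\<close>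

lemma potential_eq_if_transfer_vanishes:
  fixes \<sigma> \<sigma>' :: "real \<Rightarrow> complex^'m^'m"
  assumes \<sigma>: "herm_L2 \<sigma>" and \<sigma>': "herm_L2 \<sigma>'" and T: "orth_projector T"
    and C: "sol \<sigma> 0 C Cq" "initC T C Cq" and S: "sol \<sigma> 0 S Sq" "initS T S Sq"
    and C': "sol \<sigma>' 0 C' Cq'" "initC T C' Cq'" and S': "sol \<sigma>' 0 S' Sq'" "initS T S' Sq'"
    and zero: "\<And>x. x \<in> {0..pi} \<Longrightarrow> C x ** dagger (S' x) - S x ** dagger (C' x) = 0"
  obtains N where "negligible N" "\<And>x. x \<in> {0..pi} - N \<Longrightarrow> \<sigma> x = \<sigma>' x"
proof -
  note P = orth_projectorD[OF T]
  have h': "dagger (\<sigma>' t) = \<sigma>' t" for t using \<sigma>' by (simp add: herm_L2_def)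
  have m0: "mat 0 ** A = 0" for A :: "complex^'m^'m" by (simp add: mat_mult_csc)
  note L = C(1)[unfolded sol_def] S(1)[unfolded sol_def] C'(1)[unfolded sol_def] S'(1)[unfolded sol_def]
  note LC = conjunct1[OF L(1)] conjunct2[OF L(1)] note LS = conjunct1[OF L(2)] conjunct2[OF L(2)]
  note LC' = conjunct1[OF L(3)] conjunct2[OF L(3)] note LS' = conjunct1[OF L(4)] conjunct2[OF L(4)]
  define P11 where "P11 x = S x ** dagger (Cq' x) - C x ** dagger (Sq' x)" for x
  define P12 where "P12 x = C x ** dagger (S' x) - S x ** dagger (C' x)" for x
  define P21 where "P21 x = Sq x ** dagger (Cq' x) - Cq x ** dagger (Sq' x)" for x
  define P22 where "P22 x = Cq x ** dagger (S' x) - Sq x ** dagger (C' x)" for x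
  note simps = dagger_add dagger_diff dagger_minus dagger_mult h' m0 mat_distrib matrix_mul_assoc
  have D12: "L1_deriv 0 pi P12 (\<lambda>t. \<sigma> t ** P12 t + P12 t ** \<sigma>' t + (P22 t - P11 t))"
    unfolding P12_def
    by (rule L1_deriv_cong'[OF L1_deriv_diff[OF
          L1_deriv_bilinear[OF bounded_bilinear_matrix_mult LC(1) L1_deriv_dagger[OF LS'(1)]]
          L1_deriv_bilinear[OF bounded_bilinear_matrix_mult LS(1) L1_deriv_dagger[OF LC'(1)]]] refl])
      (simp add: P22_def P11_def simps)
  have D11: "L1_deriv 0 pi P11 (\<lambda>t. \<sigma> t ** P11 t + P21 t - P11 t ** \<sigma>' t + P12 t ** \<sigma>' t ** \<sigma>' t)"
    unfolding P11_def
    by (rule L1_deriv_cong'[OF L1_deriv_diff[OF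
          L1_deriv_bilinear[OF bounded_bilinear_matrix_mult LS(1) L1_deriv_dagger[OF LC'(2)]]
          L1_deriv_bilinear[OF bounded_bilinear_matrix_mult LC(1) L1_deriv_dagger[OF LS'(2)]]] refl])
      (simp add: P12_def P21_def simps)
  have D22: "L1_deriv 0 pi P22 (\<lambda>t. - (\<sigma> t ** P22 t) - \<sigma> t ** \<sigma> t ** P12 t + P22 t ** \<sigma>' t - P21 t)"
    unfolding P22_def
    by (rule L1_deriv_cong'[OF L1_deriv_diff[OF
          L1_deriv_bilinear[OF bounded_bilinear_matrix_mult LC(2) L1_deriv_dagger[OF LS'(1)]]
          L1_deriv_bilinear[OF bounded_bilinear_matrix_mult LS(2) L1_deriv_dagger[OF LC'(1)]]] refl])
      (simp add: P12_def P21_def simps)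
  have D21: "L1_deriv 0 pi P21 (\<lambda>t. - (\<sigma> t ** P21 t) - \<sigma> t ** \<sigma> t ** P11 t - P21 t ** \<sigma>' t + P22 t ** \<sigma>' t ** \<sigma>' t)"
    unfolding P21_def
    by (rule L1_deriv_cong'[OF L1_deriv_diff[OF
          L1_deriv_bilinear[OF bounded_bilinear_matrix_mult LS(2) L1_deriv_dagger[OF LC'(2)]]
          L1_deriv_bilinear[OF bounded_bilinear_matrix_mult LC(2) L1_deriv_dagger[OF LS'(2)]]] refl])
      (simp add: P11_def P22_def simps)
  have z: "P12 x = 0" if "x \<in> {0..pi}" for x using zero[OF that] by (simp add: P12_def)
  \<comment> \<open>With \<open>P12 = 0\<close> its own equation reduces to \<open>P22 = P11\<close>
    almost everywhere, and continuity removes the exceptional set.\<close>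
  have eq: "P22 x = P11 x" if x: "x \<in> {0..pi}" for x
  proof -
    obtain N where N: "negligible N" "\<And>x. x \<in> {0<..<pi} - N \<Longrightarrow> \<sigma> x ** P12 x + P12 x ** \<sigma>' x + (P22 x - P11 x) = 0"
      using L1_deriv_zero_imp_zero[OF D12 z] by blast
    have "P22 x - P11 x = 0"
    proof (rule continuous_negligible_zero[OF _ pi_gt_zero N(1) _ x])
      show "continuous_on {0..pi} (\<lambda>x. P22 x - P11 x)"
        by (intro continuous_intros L1_deriv_continuous[OF D22] L1_deriv_continuous[OF D11])
      show "P22 x - P11 x = 0" if "x \<in> {0<..<pi} - N" for x using N(2)[OF that] z[of x] that by simp
    qed
    then show ?thesis by simp
  qed
  have i: "P11 0 = mat 1" "P22 0 = mat 1" "P21 0 = 0"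
    using C(2) S(2) C'(2) S'(2) by (simp_all add: P11_def P22_def P21_def initC_def initS_def simps P)
  \<comment> \<open>In the sum of the equations for \<open>P11\<close> and \<open>P22\<close> every
    remaining term cancels once the two blocks coincide, so each keeps its initial value.\<close>
  have one: "P11 x = mat 1" if x: "x \<in> {0..pi}" for x
  proof -
    have "P11 x + P22 x = P11 0 + P22 0"
      by (rule L1_deriv_const_on[OF L1_deriv_add[OF D11 D22] _ x]) (simp add: z eq mat_distrib)
    then have "2 *\<^sub>R P11 x = 2 *\<^sub>R mat 1" by (simp add: i eq[OF x] scaleR_2)
    then show ?thesis by simp
  qed
  obtain N where N: "negligible N" "\<And>x. x \<in> {0<..<pi} - N \<Longrightarrow> \<sigma> x ** P11 x + P21 x - P11 x ** \<sigma>' x + P12 x ** \<sigma>' x ** \<sigma>' x = 0"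
    using L1_deriv_zero_imp_zero[OF D11 one] by blast
  define M where "M = N \<union> {0, pi}"
  have M: "negligible M" using N(1) by (simp add: M_def negligible_Un)
  have d: "P21 x = \<sigma>' x - \<sigma> x" if "x \<in> {0..pi} - M" for x
    using N(2)[of x] that one[of x] z[of x] by (simp add: M_def algebra_simps)
  \<comment> \<open>Inserting \<open>P11 = P22 = mat 1\<close> and
    \<open>P21 = \<sigma>' - \<sigma>\<close> into the equation for \<open>P21\<close> cancels all
    quadratic terms. So \<open>P21\<close> is constant, and its value at 0 is zero.\<close>
  have "L1_deriv 0 pi P21 (\<lambda>_. 0)"
  proof (rule L1_deriv_cong[OF D21 refl M])
    fix x assume x: "x \<in> {0..pi} - M"
    then show "- (\<sigma> x ** P21 x) - \<sigma> x ** \<sigma> x ** P11 x - P21 x ** \<sigma>' x + P22 x ** \<sigma>' x ** \<sigma>' x = 0"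
      using one[of x] eq[of x] d[OF x] by (simp add: mat_distrib)
  qed
  then have "P21 x = 0" if "x \<in> {0..pi}" for x
    using L1_deriv_const_on[of 0 pi P21 "\<lambda>_. 0", OF _ _ that] i(3) by simp
  then show ?thesis using that[OF M] d by force
qed

text \<open>Cancelling the invertible \<open>Q\<close> turns a condition on one solution into matrix
  identities. The first of them says that the range of \<open>T\<close> lies in the range of
  \<open>T'\<close>.\<close>

lemma boundary_projector_unique:
  assumes T: "orth_projector T" and T': "orth_projector T'" and H': "H' = T' ** H' ** T'"
    and Q: "Q ** Q' = mat 1" and \<Phi>: "\<Phi> pi = T ** Q" "\<Phi>q pi = (H + perp T) ** Q" and V: "V2 T' H' \<Phi> \<Phi>q = 0"
  shows "perp T' ** T = 0" "T' ** (H + perp T) = H' ** T"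
proof -
  note VD = V2_zeroD[OF T' H' V]
  have "perp T' ** T ** Q = 0" using VD(1) by (simp add: \<Phi> matrix_mul_assoc)
  then have "perp T' ** T ** Q ** Q' = 0" by simp
  then show "perp T' ** T = 0" by (simp add: matrix_mul_assoc[symmetric] Q)
  have "T' ** (H + perp T) ** Q = H' ** T ** Q" using VD(3) by (simp only: \<Phi> matrix_mul_assoc)
  then have "T' ** (H + perp T) ** Q ** Q' = H' ** T ** Q ** Q'" by simp
  then show "T' ** (H + perp T) = H' ** T" by (simp only: matrix_mul_assoc[symmetric] Q matrix_mul_rid)
qed

lemma boundary_data_unique:
  assumes T: "orth_projector T" and H: "H = T ** H ** T" and T': "orth_projector T'" and H': "H' = T' ** H' ** T'"
    and Q: "Q ** Qi = mat 1" "\<Phi> pi = T ** Q" "\<Phi>q pi = (H + perp T) ** Q" "V2 T H \<Phi> \<Phi>q = 0"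
    and Q': "Q' ** Qi' = mat 1" "\<Phi> pi = T' ** Q'" "\<Phi>q pi = (H' + perp T') ** Q'" "V2 T' H' \<Phi> \<Phi>q = 0"
  shows "T = T'" "H = H'"
proof -
  have "perp T' ** T = 0" "perp T ** T' = 0"
    using boundary_projector_unique[OF T T' H' Q(1-3) Q'(4)] boundary_projector_unique[OF T' T H Q'(1-3) Q(4)] by auto
  \<comment> \<open>Both range inclusions hold, and taking the adjoint exchanges the two products,
    so the orthogonal projectors coincide.\<close>
  then have "T = T' ** T" "T' = T ** T'" by (auto simp: perp_def mat_distrib)
  moreover have "dagger (T ** T') = T' ** T" by (simp add: dagger_mult orth_projectorD[OF T] orth_projectorD[OF T'])
  ultimately show TT: "T = T'" using orth_projectorD(1)[OF T'] by metis
  have "T' ** (H + perp T) = H' ** T" using boundary_projector_unique(2)[OF T T' H' Q(1-3) Q'(4)] .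
  then have "T ** H = H' ** T" unfolding TT[symmetric] by (simp add: mat_distrib orth_projectorD[OF T])
  then show "H = H'" using V2_zeroD(4)[OF T H Q(4)] V2_zeroD(5)[OF T' H' Q'(4)] TT by simp
qed

text \<open>Both solutions satisfy the same condition at \<open>pi\<close> with Hermitian
  \<open>H2\<close>, which makes their Wronskian vanish there and hence also at 0. In terms of the
  initial data it equals \<open>dagger M' - M\<close>.\<close>

lemma Weyl_matrix_symmetric:
  fixes \<Phi> \<Phi>q \<Psi> \<Psi>q :: "real \<Rightarrow> complex^'m^'m"
  assumes \<sigma>: "herm_L2 \<sigma>" and T1: "orth_projector T1" and T2: "orth_projector T2" and H2: "dagger H2 = H2" "H2 = T2 ** H2 ** T2"
    and \<Phi>: "sol \<sigma> lam \<Phi> \<Phi>q" "\<Phi> 0 = T1 ** M - perp T1" "\<Phi>q 0 = T1 + perp T1 ** M" "V2 T2 H2 \<Phi> \<Phi>q = 0"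
    and \<Psi>: "sol \<sigma> (cnj lam) \<Psi> \<Psi>q" "\<Psi> 0 = T1 ** M' - perp T1" "\<Psi>q 0 = T1 + perp T1 ** M'" "V2 T2 H2 \<Psi> \<Psi>q = 0"
  shows "dagger M' = M"
proof -
  note P1 = orth_projectorD[OF T1] and P2 = orth_projectorD[OF T2]
  note V = V2_zeroD[OF T2 H2(2) \<Phi>(4)] and V' = V2_zeroD[OF T2 H2(2) \<Psi>(4)]
  have "dagger (\<Psi> pi) ** \<Phi>q pi = dagger (T2 ** \<Psi> pi) ** \<Phi>q pi" by (simp add: V')
  also have "\<dots> = dagger (\<Psi> pi) ** (T2 ** \<Phi>q pi)" by (simp add: dagger_mult P2 matrix_mul_assoc)
  also have "\<dots> = dagger (H2 ** \<Psi> pi) ** \<Phi> pi" by (simp add: V dagger_mult H2(1) matrix_mul_assoc)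
  also have "\<dots> = dagger (T2 ** \<Psi>q pi) ** \<Phi> pi" by (simp add: V')
  also have "\<dots> = dagger (\<Psi>q pi) ** (T2 ** \<Phi> pi)" by (simp add: dagger_mult P2 matrix_mul_assoc)
  also have "\<dots> = dagger (\<Psi>q pi) ** \<Phi> pi" by (simp add: V)
  finally have "dagger (\<Psi> pi) ** \<Phi>q pi - dagger (\<Psi>q pi) ** \<Phi> pi = 0" by simp
  then have "dagger (\<Psi> 0) ** \<Phi>q 0 - dagger (\<Psi>q 0) ** \<Phi> 0 = 0"
    using Wronskian_const[OF \<sigma> \<Phi>(1) \<Psi>(1), of pi] by simp
  moreover have "dagger (\<Psi> 0) ** \<Phi>q 0 - dagger (\<Psi>q 0) ** \<Phi> 0 =
      (dagger M' ** T1 + dagger M' ** perp T1) - (T1 ** M + perp T1 ** M)"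
    unfolding \<Phi> \<Psi> by (simp add: dagger_add dagger_diff dagger_mult P1(1-10) mat_distrib matrix_mul_assoc[symmetric])
  moreover have "\<dots> = dagger M' - M"
    unfolding mm.add_left[symmetric] mm.add_right[symmetric] P1(11) by simp
  ultimately show ?thesis by simp
qed

lemma V1_initial:
  assumes T: "orth_projector T" and V: "V1 T \<Phi> \<Phi>q = mat 1"
  shows "\<Phi> 0 = T ** V1_perp T \<Phi> \<Phi>q - perp T" "\<Phi>q 0 = T + perp T ** V1_perp T \<Phi> \<Phi>q"
proof -
  note P = orth_projectorD[OF T]
  have "T ** V1 T \<Phi> \<Phi>q = T ** \<Phi>q 0" "perp T ** V1 T \<Phi> \<Phi>q = - (perp T ** \<Phi> 0)"
    "T ** V1_perp T \<Phi> \<Phi>q = T ** \<Phi> 0" "perp T ** V1_perp T \<Phi> \<Phi>q = perp T ** \<Phi>q 0"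
    by (simp_all add: V1_def V1_perp_def mat_distrib P)
  then have *: "T ** \<Phi>q 0 = T" "perp T ** \<Phi> 0 = - perp T" "T ** V1_perp T \<Phi> \<Phi>q = T ** \<Phi> 0" "perp T ** V1_perp T \<Phi> \<Phi>q = perp T ** \<Phi>q 0"
    using V by (simp_all, metis add.inverse_inverse)
  have "\<Phi> 0 = (T + perp T) ** \<Phi> 0" "\<Phi>q 0 = (T + perp T) ** \<Phi>q 0" unfolding P by simp_all
  then show "\<Phi> 0 = T ** V1_perp T \<Phi> \<Phi>q - perp T" "\<Phi>q 0 = T + perp T ** V1_perp T \<Phi> \<Phi>q"
    by (simp_all add: mm.add_left *)
qed

lemma Weyl_representation:
  assumes \<sigma>: "herm_L2 \<sigma>" and T: "orth_projector T"
    and \<Phi>: "sol \<sigma> lam \<Phi> \<Phi>q" "V1 T \<Phi> \<Phi>q = mat 1"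
    and C: "sol \<sigma> lam C Cq" "initC T C Cq" and S: "sol \<sigma> lam S Sq" "initS T S Sq" and x: "x \<in> {0..pi}"
  shows "\<Phi> x = C x + S x ** V1_perp T \<Phi> \<Phi>q"
  using sol_unique(1)[OF \<sigma> \<Phi>(1) sol_add[OF C(1) sol_mult_right[OF S(1)]] _ _ x, of "V1_perp T \<Phi> \<Phi>q"]
    V1_initial[OF T \<Phi>(2)] C(2) S(2) by (simp add: initC_def initS_def)

lemma sol_family_growth:
  assumes \<sigma>: "herm_L2 \<sigma>" and x: "x \<in> {0..pi}"
    and s: "\<And>lam. sol \<sigma> lam (Y lam) (Z lam)" "\<And>lam. Y lam 0 = y0" "\<And>lam. Z lam 0 = z0"
  shows "\<exists>A B. \<forall>lam. norm (Y lam x) \<le> A * exp (B * sqrt (cmod lam))"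
proof (intro exI allI)
  fix lam :: complex
  \<comment> \<open>This choice balances the two parts of the exponent
    \<open>k + cmod lam / k\<close>: each is at most 1 plus the square root of
    \<open>cmod lam\<close>.\<close>
  define k where "k = 1 + sqrt (cmod lam)"
  have k: "k \<ge> 1" by (simp add: k_def)
  have ke: "k \<le> exp (sqrt (cmod lam))" unfolding k_def by (rule exp_ge_add_one_self)
  have "cmod lam / k \<le> sqrt (cmod lam)"
  proof -
    have "cmod lam = sqrt (cmod lam) * sqrt (cmod lam)" by simp
    also have "\<dots> \<le> sqrt (cmod lam) * k" unfolding k_def by (intro mult_left_mono) auto
    finally show ?thesis using k by (simp add: pos_divide_le_eq)
  qed
  then have e: "pi * (k + cmod lam / k) \<le> pi * (1 + 2 * sqrt (cmod lam))" by (simp add: k_def)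
  have m: "sol_mass \<sigma> > 0" using sol_mass_def[of \<sigma>] by simp
  have "norm (Y lam x) \<le> (k * norm y0 + norm z0) * (sol_mass \<sigma> * exp (pi * (k + cmod lam / k)))"
    using sol_growth[OF \<sigma> s(1) k x] by (simp add: s)
  also have "\<dots> \<le> (k * norm y0 + k * norm z0) * (sol_mass \<sigma> * exp (pi * (1 + 2 * sqrt (cmod lam))))"
    using k m e by (intro mult_mono add_mono) (auto simp: mult_le_cancel_right1)
  also have "\<dots> \<le> (exp (sqrt (cmod lam)) * norm y0 + exp (sqrt (cmod lam)) * norm z0) * (sol_mass \<sigma> * exp (pi * (1 + 2 * sqrt (cmod lam))))"
    using ke m k by (intro mult_right_mono add_mono) auto
  also have "\<dots> = ((norm y0 + norm z0) * sol_mass \<sigma> * exp pi) * exp ((1 + 2 * pi) * sqrt (cmod lam))"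
    by (simp add: algebra_simps exp_add)
  finally show "norm (Y lam x) \<le> ((norm y0 + norm z0) * sol_mass \<sigma> * exp pi) * exp ((1 + 2 * pi) * sqrt (cmod lam))" .
qed

lemma sol_family_exists:
  assumes \<sigma>: "herm_L2 \<sigma>"
  obtains Y Z where "\<And>lam. sol \<sigma> lam (Y lam) (Z lam)" "\<And>lam. Y lam 0 = y0" "\<And>lam. Z lam 0 = z0"
proof -
  have "\<forall>lam. \<exists>U. sol \<sigma> lam (fst U) (snd U) \<and> fst U 0 = y0 \<and> snd U 0 = z0"
    using sol_exists[OF \<sigma>, of _ y0 z0] by (metis fst_conv snd_conv)
  then obtain U where "\<And>lam. sol \<sigma> lam (fst (U lam)) (snd (U lam)) \<and> fst (U lam) 0 = y0 \<and> snd (U lam) 0 = z0"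
    by metis
  then show ?thesis using that[of "\<lambda>lam. fst (U lam)" "\<lambda>lam. snd (U lam)"] by blast
qed

lemma sol_family_holomorphic:
  fixes Y Z :: "complex \<Rightarrow> real \<Rightarrow> complex^'n^'m"
  assumes \<sigma>: "herm_L2 \<sigma>" and x: "x \<in> {0..pi}"
    and s: "\<And>lam. sol \<sigma> lam (Y lam) (Z lam)" "\<And>lam. Y lam 0 = y0" "\<And>lam. Z lam 0 = z0"
  shows "(\<lambda>lam. Y lam x $ i $ j) holomorphic_on UNIV" "(\<lambda>lam. cnj (Y (cnj lam) x $ i $ j)) holomorphic_on UNIV"
proof -
  show h: "(\<lambda>lam. Y lam x $ i $ j) holomorphic_on UNIV"
    unfolding holomorphic_on_def field_differentiable_def
    using sol_entry_has_field_derivative[OF \<sigma> s x] by simp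
  have "(cnj \<circ> (\<lambda>lam. Y lam x $ i $ j) \<circ> cnj) holomorphic_on UNIV"
    by (rule holomorphic_on_compose_cnj_cnj) (use h in \<open>auto intro: holomorphic_on_subset\<close>)
  then show "(\<lambda>lam. cnj (Y (cnj lam) x $ i $ j)) holomorphic_on UNIV" by (simp add: o_def)
qed

text \<open>Carries the estimates back to the original notions. Large \<open>\<kappa>\<close> in the
  sector yield no eigenvalues, and uniqueness of the Weyl solution gives the definite description in
  \<open>weyl_matrix\<close> its meaning.\<close>

lemma bvp_Weyl_asymptotics:
  fixes \<sigma> :: "real \<Rightarrow> complex^'m^'m"
  assumes "bvp \<sigma> T1 T2 H2"
  obtains s C K where "herm_L2 s" "AE x in lebesgue_on {0<..<pi}. \<sigma> x = s x"
    "\<And>\<kappa>. K \<le> cmod \<kappa> \<Longrightarrow> cmod \<kappa> / 2 \<le> Re \<kappa> \<Longrightarrow> \<not> eigenvalue \<sigma> T1 T2 H2 (- (\<kappa>\<^sup>2)) \<and>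
      (\<exists>\<Phi> \<Phi>q :: real \<Rightarrow> complex^'m^'m. Weyl_estimates s T1 T2 H2 C \<kappa> \<Phi> \<Phi>q \<and>
        weyl_matrix \<sigma> T1 T2 H2 (- (\<kappa>\<^sup>2)) = V1_perp T1 \<Phi> \<Phi>q)"
proof -
  have b: "L2_potential \<sigma>" "orth_projector T1" "orth_projector T2" "H2 = T2 ** H2 ** T2" using assms unfolding bvp_def by blast+
  obtain s where s: "herm_L2 s" "AE x in lebesgue_on {0<..<pi}. \<sigma> x = s x"
    using L2_potential_obtain_herm_L2[OF b(1)] by blast
  obtain C K where CK: "\<And>\<kappa>. K \<le> cmod \<kappa> \<Longrightarrow> cmod \<kappa> / 2 \<le> Re \<kappa> \<Longrightarrow> \<exists>\<Phi> \<Phi>q :: real \<Rightarrow> complex^'m^'m.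
     Weyl_estimates s T1 T2 H2 C \<kappa> \<Phi> \<Phi>q \<and>
     (\<forall>Y Z :: real \<Rightarrow> complex^'m^'m. sol s (- (\<kappa>\<^sup>2)) Y Z \<and> V1 T1 Y Z = mat 1 \<and> V2 T2 H2 Y Z = 0 \<longrightarrow>
        (\<forall>x\<in>{0..pi}. Y x = \<Phi> x \<and> Z x = \<Phi>q x)) \<and>
     (\<forall>Y Z :: real \<Rightarrow> complex^1^'m. sol s (- (\<kappa>\<^sup>2)) Y Z \<and> V1 T1 Y Z = 0 \<and> V2 T2 H2 Y Z = 0 \<longrightarrow>
        (\<forall>x\<in>{0..pi}. Y x = 0))"
    using Weyl_solution_asymptotics[OF s(1) b(2-4)] by (elim exE) (rule that, blast)
  show ?thesis
  proof (rule that[OF s])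
    fix \<kappa> assume \<kappa>: "K \<le> cmod \<kappa>" "cmod \<kappa> / 2 \<le> Re \<kappa>"
    from CK[OF \<kappa>] obtain \<Phi> \<Phi>q :: "real \<Rightarrow> complex^'m^'m" where all: "Weyl_estimates s T1 T2 H2 C \<kappa> \<Phi> \<Phi>q \<and>
     (\<forall>Y Z :: real \<Rightarrow> complex^'m^'m. sol s (- (\<kappa>\<^sup>2)) Y Z \<and> V1 T1 Y Z = mat 1 \<and> V2 T2 H2 Y Z = 0 \<longrightarrow>
        (\<forall>x\<in>{0..pi}. Y x = \<Phi> x \<and> Z x = \<Phi>q x)) \<and>
     (\<forall>Y Z :: real \<Rightarrow> complex^1^'m. sol s (- (\<kappa>\<^sup>2)) Y Z \<and> V1 T1 Y Z = 0 \<and> V2 T2 H2 Y Z = 0 \<longrightarrow>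
        (\<forall>x\<in>{0..pi}. Y x = 0))"
      by (elim exE) (rule that)
    then have p: "sol s (- (\<kappa>\<^sup>2)) \<Phi> \<Phi>q" "V1 T1 \<Phi> \<Phi>q = mat 1" "V2 T2 H2 \<Phi> \<Phi>q = 0"
      and bd: "\<forall>x\<in>{0..pi}. norm (\<Phi> x ** (csc \<kappa> T1 + perp T1)) \<le> C * exp (- Re \<kappa> * x)"
        "norm (csc (1/\<kappa>) (V1_perp T1 \<Phi> \<Phi>q) - perp T1) \<le> C / sqrt (cmod \<kappa>)"
        "\<exists>Q Q'. Q ** Q' = mat 1 \<and> \<Phi> pi = T2 ** Q \<and> \<Phi>q pi = (H2 + perp T2) ** Q"
      and un: "\<And>Y Z :: real \<Rightarrow> complex^'m^'m. sol s (- (\<kappa>\<^sup>2)) Y Z \<Longrightarrow> V1 T1 Y Z = mat 1 \<Longrightarrow> V2 T2 H2 Y Z = 0 \<Longrightarrow>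
        \<forall>x\<in>{0..pi}. Y x = \<Phi> x \<and> Z x = \<Phi>q x"
      and ne: "\<And>Y Z :: real \<Rightarrow> complex^1^'m. sol s (- (\<kappa>\<^sup>2)) Y Z \<Longrightarrow> V1 T1 Y Z = 0 \<Longrightarrow> V2 T2 H2 Y Z = 0 \<Longrightarrow> \<forall>x\<in>{0..pi}. Y x = 0"
      unfolding Weyl_estimates_def by blast+
    have "\<not> eigenvalue \<sigma> T1 T2 H2 (- (\<kappa>\<^sup>2))"
      unfolding eigenvalue_def solution_iff_sol[OF s] using ne by blast
    moreover have "weyl_matrix \<sigma> T1 T2 H2 (- (\<kappa>\<^sup>2)) = V1_perp T1 \<Phi> \<Phi>q"
      unfolding weyl_matrix_def weyl_solution_def solution_iff_sol[OF s]
    proof (rule the_equality)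
      show "\<exists>\<Psi> \<Psi>q. (sol s (- (\<kappa>\<^sup>2)) \<Psi> \<Psi>q \<and> V1 T1 \<Psi> \<Psi>q = mat 1 \<and> V2 T2 H2 \<Psi> \<Psi>q = 0) \<and> V1_perp T1 \<Phi> \<Phi>q = V1_perp T1 \<Psi> \<Psi>q"
        using p by blast
      fix M assume "\<exists>\<Psi> \<Psi>q. (sol s (- (\<kappa>\<^sup>2)) \<Psi> \<Psi>q \<and> V1 T1 \<Psi> \<Psi>q = mat 1 \<and> V2 T2 H2 \<Psi> \<Psi>q = 0) \<and> M = V1_perp T1 \<Psi> \<Psi>q"
      then obtain \<Psi> \<Psi>q where q: "sol s (- (\<kappa>\<^sup>2)) \<Psi> \<Psi>q" "V1 T1 \<Psi> \<Psi>q = mat 1" "V2 T2 H2 \<Psi> \<Psi>q = 0" and M: "M = V1_perp T1 \<Psi> \<Psi>q"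
        by blast
      have "(0::real) \<in> {0..pi}" by simp
      with un[OF q] have "\<Psi> 0 = \<Phi> 0" "\<Psi>q 0 = \<Phi>q 0" by blast+
      then show "M = V1_perp T1 \<Phi> \<Phi>q" by (simp add: M V1_perp_def)
    qed
    ultimately show "\<not> eigenvalue \<sigma> T1 T2 H2 (- (\<kappa>\<^sup>2)) \<and>
      (\<exists>\<Phi> \<Phi>q :: real \<Rightarrow> complex^'m^'m. Weyl_estimates s T1 T2 H2 C \<kappa> \<Phi> \<Phi>q \<and>
        weyl_matrix \<sigma> T1 T2 H2 (- (\<kappa>\<^sup>2)) = V1_perp T1 \<Phi> \<Phi>q)"
      using all by blast
  qed
qed

text \<open>For nonzero \<open>y\<close> the principal root has argument pi/4 or -pi/4, so its real
  part is its modulus over sqrt 2. It thus lies in the sector together with its conjugate.\<close>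

lemma csqrt_imaginary:
  fixes y :: real
  defines "\<kappa> \<equiv> csqrt (- Complex 0 y)"
  shows "- (\<kappa>\<^sup>2) = Complex 0 y" "cmod \<kappa> = sqrt \<bar>y\<bar>" "cmod \<kappa> / 2 \<le> Re \<kappa>"
proof -
  show k: "- (\<kappa>\<^sup>2) = Complex 0 y" by (simp add: \<kappa>_def)
  have "(cmod \<kappa>)\<^sup>2 = \<bar>y\<bar>"
  proof -
    have "(cmod \<kappa>)\<^sup>2 = cmod (- (\<kappa>\<^sup>2))" by (simp add: norm_power)
    also have "\<dots> = \<bar>y\<bar>" unfolding k by (simp add: cmod_def)
    finally show ?thesis .
  qed
  then show "cmod \<kappa> = sqrt \<bar>y\<bar>" by (metis norm_ge_zero real_sqrt_unique)
  have "Re (\<kappa>\<^sup>2) = 0" using arg_cong[OF k, of Re] by simp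
  then have "(Re \<kappa>)\<^sup>2 = (Im \<kappa>)\<^sup>2" by (simp add: power2_eq_square)
  then have "(cmod \<kappa>)\<^sup>2 \<le> (2 * Re \<kappa>)\<^sup>2" by (simp add: cmod_power2 power_mult_distrib)
  then have "cmod \<kappa> \<le> 2 * Re \<kappa>"
    by (rule power2_le_imp_le) (use csqrt_principal[of "- Complex 0 y"] in \<open>auto simp: \<kappa>_def\<close>)
  then show "cmod \<kappa> / 2 \<le> Re \<kappa>" by simp
qed

text \<open>The weight on \<open>A\<close> times the adjoint of the weight on \<open>B\<close> is
  the identity, so both can be inserted into the product. The conjugate in the second weight is
  undone by the adjoint.\<close>

lemma norm_mult_dagger_via_diagonal_le:
  fixes A B :: "complex^'m^'m"
  assumes T: "orth_projector T" and \<kappa>: "\<kappa> \<noteq> 0"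
    and A: "norm (A ** (csc \<kappa> T + perp T)) \<le> a" and B: "norm (B ** (csc (1 / cnj \<kappa>) T + perp T)) \<le> b"
  shows "norm (A ** dagger B) \<le> a * b"
proof -
  note P = orth_projectorD[OF T]
  have "(csc \<kappa> T + perp T) ** (csc (1 / \<kappa>) T + perp T) = mat 1" using \<kappa> by (simp add: mat_distrib P)
  moreover have "dagger (B ** (csc (1 / cnj \<kappa>) T + perp T)) = (csc (1 / \<kappa>) T + perp T) ** dagger B"
    by (simp add: dagger_mult dagger_add dagger_csc P)
  ultimately have "A ** dagger B = (A ** (csc \<kappa> T + perp T)) ** dagger (B ** (csc (1 / cnj \<kappa>) T + perp T))"
    by (metis matrix_mul_assoc matrix_mul_rid)
  also have "norm \<dots> \<le> norm (A ** (csc \<kappa> T + perp T)) * norm (B ** (csc (1 / cnj \<kappa>) T + perp T))"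
    using norm_matrix_mult_le by (metis norm_dagger)
  also have "\<dots> \<le> a * b" using A B norm_ge_zero order_trans by (intro mult_mono) blast+
  finally show ?thesis .
qed

theorem theorem6p3:
  fixes \<sigma> \<sigma>' :: "real \<Rightarrow> complex^'m^'m"
    and T1 T2 H2 T1' T2' H2' :: "complex^'m^'m"
  assumes "bvp \<sigma> T1 T2 H2"
    and "bvp \<sigma>' T1' T2' H2'"
    and "same_weyl_matrix \<sigma> T1 T2 H2 \<sigma>' T1' T2' H2'"
  shows "(AE x in lebesgue_on {0<..<pi}. \<sigma> x = \<sigma>' x) \<and> T1 = T1' \<and> T2 = T2' \<and> H2 = H2'"
proof -
  have T1: "orth_projector T1" and T2: "orth_projector T2" and d1: "H2 = dagger H2" and t1: "H2 = T2 ** H2 ** T2"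
    using assms(1) unfolding bvp_def by blast+
  note H2 = d1[symmetric] t1
  have T1': "orth_projector T1'" and T2': "orth_projector T2'" and d2: "H2' = dagger H2'" and t2: "H2' = T2' ** H2' ** T2'"
    using assms(2) unfolding bvp_def by blast+
  note H2' = d2[symmetric] t2
  obtain s C K where s: "herm_L2 s" "AE x in lebesgue_on {0<..<pi}. \<sigma> x = s x"
    and W: "\<And>\<kappa>. K \<le> cmod \<kappa> \<Longrightarrow> cmod \<kappa> / 2 \<le> Re \<kappa> \<Longrightarrow> \<not> eigenvalue \<sigma> T1 T2 H2 (- (\<kappa>\<^sup>2)) \<and>
      (\<exists>\<Phi> \<Phi>q :: real \<Rightarrow> complex^'m^'m. Weyl_estimates s T1 T2 H2 C \<kappa> \<Phi> \<Phi>q \<and>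
        weyl_matrix \<sigma> T1 T2 H2 (- (\<kappa>\<^sup>2)) = V1_perp T1 \<Phi> \<Phi>q)"
    by (rule bvp_Weyl_asymptotics[OF assms(1)]) (rule that)
  obtain s' C' K' where s': "herm_L2 s'" "AE x in lebesgue_on {0<..<pi}. \<sigma>' x = s' x"
    and W': "\<And>\<kappa>. K' \<le> cmod \<kappa> \<Longrightarrow> cmod \<kappa> / 2 \<le> Re \<kappa> \<Longrightarrow> \<not> eigenvalue \<sigma>' T1' T2' H2' (- (\<kappa>\<^sup>2)) \<and>
      (\<exists>\<Phi> \<Phi>q :: real \<Rightarrow> complex^'m^'m. Weyl_estimates s' T1' T2' H2' C' \<kappa> \<Phi> \<Phi>q \<and>
        weyl_matrix \<sigma>' T1' T2' H2' (- (\<kappa>\<^sup>2)) = V1_perp T1' \<Phi> \<Phi>q)"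
    by (rule bvp_Weyl_asymptotics[OF assms(2)]) (rule that)
  have same: "weyl_matrix \<sigma> T1 T2 H2 (- (\<kappa>\<^sup>2)) = weyl_matrix \<sigma>' T1' T2' H2' (- (\<kappa>\<^sup>2))"
    if "max K K' \<le> cmod \<kappa>" "cmod \<kappa> / 2 \<le> Re \<kappa>" for \<kappa>
    using assms(3) W[of \<kappa>] W'[of \<kappa>] that unfolding same_weyl_matrix_def by auto
  \<comment> \<open>Along positive \<open>\<kappa>\<close> the common matrix M/kappa is within
    O(1/sqrt kappa) of both \<open>perp T1\<close> and \<open>perp T1'\<close>.\<close>
  have "perp T1 - perp T1' = 0"
  proof -
    have le: "norm (perp T1 - perp T1') \<le> (C + C') / sqrt t" if "t \<ge> max 1 (max K K')" for t :: real
    proof -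
      let ?k = "complex_of_real t"
      have k: "max K K' \<le> cmod ?k" "K \<le> cmod ?k" "K' \<le> cmod ?k" "cmod ?k / 2 \<le> Re ?k" "cmod ?k = t" using that by auto
      define M where "M = csc (1 / ?k) (weyl_matrix \<sigma> T1 T2 H2 (- (?k\<^sup>2)))"
      have 1: "norm (M - perp T1) \<le> C / sqrt t" using W[OF k(2,4)] unfolding M_def k(5) Weyl_estimates_def by auto
      have 2: "norm (M - perp T1') \<le> C' / sqrt t" using W'[OF k(3,4)] unfolding M_def same[OF k(1,4)] k(5) Weyl_estimates_def by auto
      have "norm (perp T1 - perp T1') = norm ((M - perp T1') - (M - perp T1))" by simp
      also have "\<dots> \<le> C' / sqrt t + C / sqrt t" by (rule order_trans[OF norm_triangle_ineq4 add_mono[OF 2 1]])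
      finally show ?thesis by (simp add: add_divide_distrib)
    qed
    have "((\<lambda>t. (C + C') / sqrt t) \<longlongrightarrow> 0) at_top" by real_asymp
    then have "norm (perp T1 - perp T1') \<le> 0"
    proof (rule tendsto_lowerbound)
      show "\<forall>\<^sub>F t in at_top. norm (perp T1 - perp T1') \<le> (C + C') / sqrt t"
        using eventually_ge_at_top[of "max 1 (max K K')"] by eventually_elim (rule le)
    qed simp
    then show ?thesis by simp
  qed
  then have TT: "T1' = T1" by (simp add: perp_def)
  obtain CC CQ where CC: "\<And>lam. sol s lam (CC lam) (CQ lam)" "\<And>lam. CC lam 0 = - perp T1" "\<And>lam. CQ lam 0 = T1"
    using sol_family_exists[OF s(1)] by blast
  obtain SS SQ where SS: "\<And>lam. sol s lam (SS lam) (SQ lam)" "\<And>lam. SS lam 0 = T1" "\<And>lam. SQ lam 0 = perp T1"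
    using sol_family_exists[OF s(1)] by blast
  obtain CC' CQ' where CC': "\<And>lam. sol s' lam (CC' lam) (CQ' lam)" "\<And>lam. CC' lam 0 = - perp T1" "\<And>lam. CQ' lam 0 = T1"
    using sol_family_exists[OF s'(1)] by blast
  obtain SS' SQ' where SS': "\<And>lam. sol s' lam (SS' lam) (SQ' lam)" "\<And>lam. SS' lam 0 = T1" "\<And>lam. SQ' lam 0 = perp T1"
    using sol_family_exists[OF s'(1)] by blast
  have iC: "initC T1 (CC lam) (CQ lam)" "initC T1 (CC' lam) (CQ' lam)" for lam by (simp_all add: initC_def CC CC')
  have iS: "initS T1 (SS lam) (SQ lam)" "initS T1 (SS' lam) (SQ' lam)" for lam by (simp_all add: initS_def SS SS')
  \<comment> \<open>The adjoint conjugates entries and the argument \<open>cnj lam\<close>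
    conjugates once more, so the entries of \<open>F x\<close> are holomorphic in
    \<open>lam\<close>.\<close>
  define F where "F x lam = CC lam x ** dagger (SS' (cnj lam) x) - SS lam x ** dagger (CC' (cnj lam) x)" for x lam
  obtain C3 K3 where S3: "\<And>\<kappa> x. K3 \<le> cmod \<kappa> \<Longrightarrow> cmod \<kappa> / 2 \<le> Re \<kappa> \<Longrightarrow> x \<in> {0..pi} \<Longrightarrow>
      norm (SS (- (\<kappa>\<^sup>2)) x ** (csc (1/\<kappa>) T1 + perp T1)) \<le> C3 * exp (Re \<kappa> * x) / cmod \<kappa>"
    using S_solution_asymptotics[OF s(1) T1] SS by meson
  obtain C4 K4 where S4: "\<And>\<kappa> x. K4 \<le> cmod \<kappa> \<Longrightarrow> cmod \<kappa> / 2 \<le> Re \<kappa> \<Longrightarrow> x \<in> {0..pi} \<Longrightarrow>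
      norm (SS' (- (\<kappa>\<^sup>2)) x ** (csc (1/\<kappa>) T1 + perp T1)) \<le> C4 * exp (Re \<kappa> * x) / cmod \<kappa>"
    using S_solution_asymptotics[OF s'(1) T1] SS' by meson
  define K5 where "K5 = max (max 1 (max K K')) (max K3 K4)"
  have decay: "norm (F x (- (\<kappa>\<^sup>2))) \<le> (C * C4 + C' * C3) / cmod \<kappa>"
    if \<kappa>: "K5 \<le> cmod \<kappa>" "cmod \<kappa> / 2 \<le> Re \<kappa>" and x: "x \<in> {0..pi}" for \<kappa> x
  proof -
    define lam where "lam = - (\<kappa>\<^sup>2)"
    have cl: "cnj lam = - ((cnj \<kappa>)\<^sup>2)" by (simp add: lam_def)
    have \<kappa>0: "\<kappa> \<noteq> 0" "cnj \<kappa> \<noteq> 0" using \<kappa>(1) by (auto simp: K5_def)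
    have k: "K \<le> cmod \<kappa>" "K' \<le> cmod \<kappa>" "K' \<le> cmod (cnj \<kappa>)" "K3 \<le> cmod \<kappa>" "K4 \<le> cmod (cnj \<kappa>)" "max K K' \<le> cmod \<kappa>"
      "cmod (cnj \<kappa>) / 2 \<le> Re (cnj \<kappa>)" using \<kappa> by (auto simp: K5_def)
    obtain \<Phi> \<Phi>q where p: "sol s lam \<Phi> \<Phi>q" "V1 T1 \<Phi> \<Phi>q = mat 1"
        "\<forall>x\<in>{0..pi}. norm (\<Phi> x ** (csc \<kappa> T1 + perp T1)) \<le> C * exp (- Re \<kappa> * x)"
        "weyl_matrix \<sigma> T1 T2 H2 lam = V1_perp T1 \<Phi> \<Phi>q"
      using W[OF k(1) \<kappa>(2)] unfolding lam_def Weyl_estimates_def by blast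
    obtain \<Psi> \<Psi>q where q: "sol s' lam \<Psi> \<Psi>q" "V1 T1 \<Psi> \<Psi>q = mat 1" "V2 T2' H2' \<Psi> \<Psi>q = 0"
        "weyl_matrix \<sigma>' T1' T2' H2' lam = V1_perp T1 \<Psi> \<Psi>q"
      using W'[OF k(2) \<kappa>(2)] unfolding lam_def TT Weyl_estimates_def by blast
    \<comment> \<open>The Weyl solution of the second problem at the conjugate point, whose adjoint
      enters \<open>F\<close>. The preceding \<open>\<Psi>\<close> at \<open>lam\<close> itself
      serves to relate its Weyl matrix to \<open>M\<close>.\<close>
    obtain \<Theta> \<Theta>q where r: "sol s' (cnj lam) \<Theta> \<Theta>q" "V1 T1 \<Theta> \<Theta>q = mat 1" "V2 T2' H2' \<Theta> \<Theta>q = 0"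
        "\<forall>x\<in>{0..pi}. norm (\<Theta> x ** (csc (cnj \<kappa>) T1 + perp T1)) \<le> C' * exp (- Re (cnj \<kappa>) * x)"
      using W'[OF k(3) k(7)] unfolding cl TT Weyl_estimates_def by blast
    define M where "M = V1_perp T1 \<Phi> \<Phi>q"
    define M' where "M' = V1_perp T1 \<Theta> \<Theta>q"
    have "V1_perp T1 \<Psi> \<Psi>q = M" using same[OF k(6) \<kappa>(2)] p(4) q(4) unfolding lam_def M_def by simp
    then have MM: "dagger M' = M"
      using Weyl_matrix_symmetric[OF s'(1) T1 T2' H2' q(1) V1_initial[OF T1 q(2)] q(3) r(1) V1_initial[OF T1 r(2)] r(3)]
      by (simp add: M'_def)
    have \<Phi>: "\<Phi> x = CC lam x + SS lam x ** M"
      unfolding M_def by (rule Weyl_representation[OF s(1) T1 p(1,2) CC(1) iC(1) SS(1) iS(1) x])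
    have \<Theta>: "\<Theta> x = CC' (cnj lam) x + SS' (cnj lam) x ** M'"
      unfolding M'_def by (rule Weyl_representation[OF s'(1) T1 r(1,2) CC'(1) iC(2) SS'(1) iS(2) x])
    \<comment> \<open>The two terms \<open>SS lam x ** M ** dagger (SS' (cnj lam) x)\<close>
      produced by the representations cancel because \<open>dagger M' = M\<close>.\<close>
    have "F x lam = \<Phi> x ** dagger (SS' (cnj lam) x) - SS lam x ** dagger (\<Theta> x)"
      unfolding F_def \<Phi> \<Theta> by (simp add: mat_distrib dagger_add dagger_mult MM matrix_mul_assoc)
    then have "norm (F x lam) \<le> norm (\<Phi> x ** dagger (SS' (cnj lam) x)) + norm (\<Theta> x ** dagger (SS lam x))"
    proof -
      assume a: "F x lam = \<Phi> x ** dagger (SS' (cnj lam) x) - SS lam x ** dagger (\<Theta> x)"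
      have "SS lam x ** dagger (\<Theta> x) = dagger (\<Theta> x ** dagger (SS lam x))" by (simp add: dagger_mult)
      then have "norm (SS lam x ** dagger (\<Theta> x)) = norm (\<Theta> x ** dagger (SS lam x))" by simp
      then show ?thesis unfolding a using norm_triangle_ineq4 by metis
    qed
    also have "\<dots> \<le> (C * exp (- Re \<kappa> * x)) * (C4 * exp (Re \<kappa> * x) / cmod \<kappa>) + (C' * exp (- Re \<kappa> * x)) * (C3 * exp (Re \<kappa> * x) / cmod \<kappa>)"
    proof (rule add_mono)
      show "norm (\<Phi> x ** dagger (SS' (cnj lam) x)) \<le> (C * exp (- Re \<kappa> * x)) * (C4 * exp (Re \<kappa> * x) / cmod \<kappa>)"
        using norm_mult_dagger_via_diagonal_le[OF T1 \<kappa>0(1) p(3)[rule_format, OF x] S4[OF k(5,7) x]] unfolding cl by simp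
      have b3: "norm (SS lam x ** (csc (1 / cnj (cnj \<kappa>)) T1 + perp T1)) \<le> C3 * exp (Re \<kappa> * x) / cmod \<kappa>"
        using S3[OF k(4) \<kappa>(2) x] by (simp add: lam_def)
      show "norm (\<Theta> x ** dagger (SS lam x)) \<le> (C' * exp (- Re \<kappa> * x)) * (C3 * exp (Re \<kappa> * x) / cmod \<kappa>)"
        using norm_mult_dagger_via_diagonal_le[OF T1 \<kappa>0(2) r(4)[rule_format, OF x] b3] by simp
    qed
    also have "\<dots> = (C * C4 + C' * C3) * (exp (- Re \<kappa> * x) * exp (Re \<kappa> * x)) / cmod \<kappa>"
      by (simp add: add_divide_distrib algebra_simps)
    also have "exp (- Re \<kappa> * x) * exp (Re \<kappa> * x) = 1" by (simp add: exp_add[symmetric])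
    finally show ?thesis by (simp add: lam_def)
  qed
  have F0: "F x lam = 0" if x: "x \<in> {0..pi}" for x lam
  proof -
    obtain A1 B1 where g1: "\<And>lam. norm (CC lam x) \<le> A1 * exp (B1 * sqrt (cmod lam))" using sol_family_growth[OF s(1) x CC] by blast
    obtain A2 B2 where g2: "\<And>lam. norm (SS lam x) \<le> A2 * exp (B2 * sqrt (cmod lam))" using sol_family_growth[OF s(1) x SS] by blast
    obtain A3 B3 where g3: "\<And>lam. norm (CC' lam x) \<le> A3 * exp (B3 * sqrt (cmod lam))" using sol_family_growth[OF s'(1) x CC'] by blast
    obtain A4 B4 where g4: "\<And>lam. norm (SS' lam x) \<le> A4 * exp (B4 * sqrt (cmod lam))" using sol_family_growth[OF s'(1) x SS'] by blast
    have A: "0 \<le> A1" "0 \<le> A2" "0 \<le> A3" "0 \<le> A4"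
      using order_trans[OF norm_ge_zero g1[of 0]] order_trans[OF norm_ge_zero g2[of 0]]
        order_trans[OF norm_ge_zero g3[of 0]] order_trans[OF norm_ge_zero g4[of 0]] by auto
    define B where "B = max (B1 + B4) (B2 + B3)"
    have "F x lam $ i $ j = 0" for i j
    proof (rule entire_half_order_vanishing[of "\<lambda>lam. F x lam $ i $ j" "A1 * A4 + A2 * A3" B])
      have "(\<lambda>lam. (\<Sum>k\<in>UNIV. CC lam x $ i $ k * cnj (SS' (cnj lam) x $ j $ k)) - (\<Sum>k\<in>UNIV. SS lam x $ i $ k * cnj (CC' (cnj lam) x $ j $ k))) holomorphic_on UNIV"
        by (intro holomorphic_on_diff holomorphic_on_sum holomorphic_on_mult
            sol_family_holomorphic[OF s(1) x CC] sol_family_holomorphic[OF s(1) x SS]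
            sol_family_holomorphic[OF s'(1) x CC'] sol_family_holomorphic[OF s'(1) x SS'])
      then show "(\<lambda>lam. F x lam $ i $ j) holomorphic_on UNIV"
        by (simp add: F_def matrix_matrix_mult_def dagger_def)
      have en: "cmod (F x lam $ i $ j) \<le> norm (F x lam)" for lam
        using Finite_Cartesian_Product.norm_nth_le[of "F x lam" i] Finite_Cartesian_Product.norm_nth_le[of "F x lam $ i" j] by linarith
      show "cmod (F x lam $ i $ j) \<le> (A1 * A4 + A2 * A3) * exp (B * sqrt (cmod lam))" for lam
      proof -
        define y where "y = sqrt (cmod lam)"
        have y: "y \<ge> 0" by (simp add: y_def)
        have pr: "norm (P ** dagger Q) \<le> (A * A') * exp (B * y)"
          if "norm P \<le> A * exp (b * y)" "norm Q \<le> A' * exp (b' * y)" "0 \<le> A" "0 \<le> A'" "b + b' \<le> B"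
          for P Q :: "complex^'m^'m" and A A' b b'
        proof -
          have "norm (P ** dagger Q) \<le> norm P * norm Q" using norm_matrix_mult_le[of P "dagger Q"] by simp
          also have "\<dots> \<le> (A * exp (b * y)) * (A' * exp (b' * y))" using that by (intro mult_mono) auto
          also have "\<dots> = (A * A') * exp ((b + b') * y)" by (simp add: exp_add[symmetric] algebra_simps)
          also have "\<dots> \<le> (A * A') * exp (B * y)" using that y by (intro mult_left_mono) (auto intro: mult_right_mono)
          finally show ?thesis .
        qed
        have 1: "norm (CC lam x ** dagger (SS' (cnj lam) x)) \<le> (A1 * A4) * exp (B * y)"
          by (rule pr[of _ _ B1 _ _ B4]) (use g1[of lam] g4[of "cnj lam"] A in \<open>auto simp: y_def B_def\<close>)
        have 2: "norm (SS lam x ** dagger (CC' (cnj lam) x)) \<le> (A2 * A3) * exp (B * y)"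
          by (rule pr[of _ _ B2 _ _ B3]) (use g2[of lam] g3[of "cnj lam"] A in \<open>auto simp: y_def B_def\<close>)
        have "norm (F x lam) \<le> (A1 * A4) * exp (B * y) + (A2 * A3) * exp (B * y)"
          unfolding F_def by (rule order_trans[OF norm_triangle_ineq4 add_mono[OF 1 2]])
        with en[of lam] show ?thesis by (simp add: y_def distrib_right)
      qed
      have dec: "cmod (F x (Complex 0 y) $ i $ j) \<le> (C * C4 + C' * C3) / sqrt \<bar>y\<bar>" if "K5\<^sup>2 \<le> \<bar>y\<bar>" for y
      proof -
        have "K5 \<le> sqrt \<bar>y\<bar>" using that by (rule real_le_rsqrt)
        with decay[of "csqrt (- Complex 0 y)" x] x csqrt_imaginary[of y] en[of "Complex 0 y"] show ?thesis by simp
      qed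
      have "\<forall>\<^sub>F y in at_top. cmod (F x (Complex 0 y) $ i $ j) \<le> (C * C4 + C' * C3) / sqrt \<bar>y\<bar>"
        using eventually_ge_at_top[of "K5\<^sup>2"] by eventually_elim (auto intro: dec)
      moreover have "((\<lambda>y. (C * C4 + C' * C3) / sqrt \<bar>y\<bar>) \<longlongrightarrow> 0) at_top" by real_asymp
      ultimately show "((\<lambda>y. F x (Complex 0 y) $ i $ j) \<longlongrightarrow> 0) at_top" by (rule Lim_null_comparison)
      have "\<forall>\<^sub>F y in at_bot. cmod (F x (Complex 0 y) $ i $ j) \<le> (C * C4 + C' * C3) / sqrt \<bar>y\<bar>"
        using eventually_le_at_bot[of "- (K5\<^sup>2)"] by eventually_elim (auto intro: dec)
      moreover have "((\<lambda>y. (C * C4 + C' * C3) / sqrt \<bar>y\<bar>) \<longlongrightarrow> 0) at_bot" by real_asymp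
      ultimately show "((\<lambda>y. F x (Complex 0 y) $ i $ j) \<longlongrightarrow> 0) at_bot" by (rule Lim_null_comparison)
    qed
    then show ?thesis by (simp add: vec_eq_iff)
  qed
  \<comment> \<open>The transfer argument is run at the spectral parameter 0, which is its own
    conjugate.\<close>
  obtain N where N: "negligible N" "\<And>x. x \<in> {0..pi} - N \<Longrightarrow> s x = s' x"
  proof (rule potential_eq_if_transfer_vanishes[OF s(1) s'(1) T1 CC(1) iC(1) SS(1) iS(1) CC'(1) iC(2) SS'(1) iS(2)])
    show "CC 0 x ** dagger (SS' 0 x) - SS 0 x ** dagger (CC' 0 x) = 0" if "x \<in> {0..pi}" for x
      using F0[OF that, of 0] by (simp add: F_def)
  qed (use that in blast)
  have "AE x in lebesgue_on {0<..<pi}. s x = s' x"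
    unfolding AE_lebesgue_on_iff_negligible[OF sets_lebesgue_Ioo] by (intro exI[of _ N]) (use N in auto)
  with s(2) s'(2) have "AE x in lebesgue_on {0<..<pi}. \<sigma> x = \<sigma>' x" by eventually_elim simp
  moreover have "T2 = T2' \<and> H2 = H2'"
  proof -
    let ?k = "complex_of_real K5"
    have "K5 \<ge> 1" by (simp add: K5_def)
    then have k: "K \<le> cmod ?k" "K' \<le> cmod ?k" "max K K' \<le> cmod ?k" "cmod ?k / 2 \<le> Re ?k" by (auto simp: K5_def)
    define lam where "lam = - (?k\<^sup>2)"
    obtain \<Phi> \<Phi>q Q Qi where p: "sol s lam \<Phi> \<Phi>q" "V1 T1 \<Phi> \<Phi>q = mat 1" "V2 T2 H2 \<Phi> \<Phi>q = 0"
        "weyl_matrix \<sigma> T1 T2 H2 lam = V1_perp T1 \<Phi> \<Phi>q" "Q ** Qi = mat 1" "\<Phi> pi = T2 ** Q" "\<Phi>q pi = (H2 + perp T2) ** Q"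
      using W[OF k(1) k(4)] unfolding lam_def Weyl_estimates_def by blast
    obtain \<Psi> \<Psi>q Q' Qi' where q: "sol s' lam \<Psi> \<Psi>q" "V1 T1 \<Psi> \<Psi>q = mat 1" "V2 T2' H2' \<Psi> \<Psi>q = 0"
        "weyl_matrix \<sigma>' T1' T2' H2' lam = V1_perp T1 \<Psi> \<Psi>q" "Q' ** Qi' = mat 1" "\<Psi> pi = T2' ** Q'" "\<Psi>q pi = (H2' + perp T2') ** Q'"
      using W'[OF k(2) k(4)] unfolding lam_def TT Weyl_estimates_def by blast
    \<comment> \<open>Since the potentials agree almost everywhere, the second Weyl solution solves
      the first equation too. Equal Weyl matrices give equal values at 0, so both sets of boundary
      data describe the same values at \<open>pi\<close>.\<close>
    have q': "sol s lam \<Psi> \<Psi>q"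
      unfolding sol_def
    proof (intro conjI)
      show "L1_deriv 0 pi \<Psi> (\<lambda>t. s t ** \<Psi> t + \<Psi>q t)"
        by (rule L1_deriv_cong[OF q(1)[unfolded sol_def, THEN conjunct1] refl N(1)]) (simp add: N(2))
      show "L1_deriv 0 pi \<Psi>q (\<lambda>t. - (s t ** \<Psi>q t) - s t ** s t ** \<Psi> t - mat lam ** \<Psi> t)"
        by (rule L1_deriv_cong[OF q(1)[unfolded sol_def, THEN conjunct2] refl N(1)]) (simp add: N(2))
    qed
    have "V1_perp T1 \<Phi> \<Phi>q = V1_perp T1 \<Psi> \<Psi>q" using same[OF k(3,4)] p(4) q(4) unfolding lam_def by simp
    then have "\<Phi> 0 = \<Psi> 0" "\<Phi>q 0 = \<Psi>q 0" using V1_initial[OF T1 p(2)] V1_initial[OF T1 q(2)] by simp_all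
    then have e: "\<Psi> pi = \<Phi> pi" "\<Psi>q pi = \<Phi>q pi" using sol_unique[OF s(1) p(1) q', of pi] by simp_all
    have "V2 T2' H2' \<Phi> \<Phi>q = 0" using q(3) by (simp add: V2_def e)
    then show ?thesis
      using boundary_data_unique[OF T2 H2(2) T2' H2'(2) p(5,6,7,3) q(5)] q(6,7) e by simp
  qed
  ultimately show ?thesis using TT by simp
qed

end
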